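(* Let $K\ge2$ and let $o'\neq o$ be a vertex of the $(K+1)$-regular infinite tree $\mathcal T$ with root $o$. For $\ell>d(o,o')$, consider the coloring process on the finite tree $\mathcal T^{(\ell)}$ with two seeds, a blue one at $o$ and a red one at $o'$, and let $(\tilde B^{(\ell)},\tilde R^{(\ell)})$ be the resulting sets of blue and red vertices. Then, as $\ell\to\infty$, the coloring $(\tilde B^{(\ell)},\tilde R^{(\ell)})$ on $\mathcal T^{(\ell)}$ converges in distribution in the local topology to the random coloring of $\mathcal T$ with law $\chi_{o'}$ (defined in the context).
   Context: Tree notation. $K\ge2$ is a fixed integer; $\mathcal T$ is the infinite tree in which every vertex has $K+1$ neighbors, with root $o$, graph distance $d$ and balls $B(v,r)$. $\mathcal T^{(\ell)}=\mathcal T\cap B(o,\ell)$. $\partial\mathcal T$ is the set of infinite rays (infinite non-backtracking paths from $o$), and $\mathcal T_v$ is the set of vertices $w$ such that the geodesic from $o$ to $w$ passes through $v$. Genealogical graph and coloring with two seeds. Let $G=\mathcal T$ or $G=\mathcal T^{(\ell)}$, with seeds $o,o'$. The seeds have arrival time $0$ and no parent; the other vertices have i.i.d. arrival times $\tau_v$ with an atomless distribution on $(0,\infty)$. The parent of a non-seed vertex $v$ is chosen uniformly at random (independently for different vertices, given the arrival times) among the vertices of $G$ with arrival time strictly smaller than $\tau_v$ that are at minimal graph distance from $v$. The genealogical graph has an oriented edge from each non-seed vertex to its parent. The ancestral path of a vertex is obtained by iterating the parent map. On $\mathcal T^{(\ell)}$ every ancestral path ends at a seed and the vertex takes the color of this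 seed. Components in infinite volume. Let $\tilde{\mathcal G}$ be the genealogical graph on the infinite tree $\mathcal T$ with seeds $o,o'$. Almost surely, its connected components are $\tilde{\mathcal U}_o$ and $\tilde{\mathcal U}_{o'}$ (the components of $o$ and $o'$) together with infinite components $(\tilde{\mathcal C}_i)_{i\in I}$ containing no seed, each of which has an asymptotic direction $\operatorname{dir}\tilde{\mathcal C}_i=(w_k)_{k\ge1}\in\partial\mathcal T$, meaning that for every vertex $v$ of $\tilde{\mathcal C}_i$ and every $k$ all but finitely many vertices of the ancestral path of $v$ belong to $\mathcal T_{w_k}$. For a ray $(w_k)\in\partial\mathcal T$, the difference $d(w_k,o)-d(w_k,o')$ is eventually constant; the direction is asymptotically closer to $o$, closer to $o'$, or at equal distance from both, according to whether this constant is negative, positive or zero. The law $\chi_{o'}$. Color all vertices of $\tilde{\mathcal U}_o$ in blue and all vertices of $\tilde{\mathcal U}_{o'}$ in red. If $\operatorname{dir}\tilde{\mathcal C}_i$ is asymptotically closer to $o$ (resp. to $o'$), color all vertices of $\tilde{\mathcal C}_i$ in blue (resp. red). For each $\tilde{\mathcal C}_i$ whose direction is at equal distance from $o$ and $o'$, pick an independent Bernoulli random variable $X_i$ with parameter $1/2$ and color the whole cluster blue if $X_i=1$ and red otherwise. $\chi_{o'}$ is the distribution of the resulting two-coloring of $\mathcal T$. Convergence in distribution in the local topology means that for every $N\ge0$ the law of the coloring restricted to $B(o,N)$ converges to the law of the limit coloring restricted to $B(o,N)$. *)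

theory Defs
  imports "HOL-Probability.Probability"
begin

section \<open>Graphs and trees\<close>

text \<open>A graph is given by its adjacency relation; its vertex set is the whole type.\<close>

definition walk :: "('v \<Rightarrow> 'v \<Rightarrow> bool) \<Rightarrow> 'v \<Rightarrow> 'v list \<Rightarrow> 'v \<Rightarrow> bool" where
  "walk E u p v \<longleftrightarrow> p \<noteq> [] \<and> hd p = u \<and> last p = v \<and> successively E p"

definition regular_tree :: "nat \<Rightarrow> ('v \<Rightarrow> 'v \<Rightarrow> bool) \<Rightarrow> bool" where
  "regular_tree K E \<longleftrightarrow>
     symp E \<and> irreflp E \<and>
     (\<forall>u v. \<exists>p. walk E u p v) \<and>
     \<not> (\<exists>p. length p \<ge> 3 \<and> distinct p \<and> successively E p \<and> E (last p) (hd p)) \<and>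
     (\<forall>v. finite {w. E v w} \<and> card {w. E v w} = K + 1)"

definition gdist :: "('v \<Rightarrow> 'v \<Rightarrow> bool) \<Rightarrow> 'v \<Rightarrow> 'v \<Rightarrow> nat" where
  "gdist E u v = (LEAST n. \<exists>p. walk E u p v \<and> length p = Suc n)"

definition gball :: "('v \<Rightarrow> 'v \<Rightarrow> bool) \<Rightarrow> 'v \<Rightarrow> nat \<Rightarrow> 'v set" where
  "gball E v n = {w. gdist E v w \<le> n}"

definition geodesic :: "('v \<Rightarrow> 'v \<Rightarrow> bool) \<Rightarrow> 'v \<Rightarrow> 'v list \<Rightarrow> 'v \<Rightarrow> bool" where
  "geodesic E u p v \<longleftrightarrow> walk E u p v \<and> length p = Suc (gdist E u v)"

definition subtree :: "('v \<Rightarrow> 'v \<Rightarrow> bool) \<Rightarrow> 'v \<Rightarrow> 'v \<Rightarrow> 'v set" where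
  "subtree E r v = {w. \<exists>p. geodesic E r p w \<and> v \<in> set p}"

definition ray :: "('v \<Rightarrow> 'v \<Rightarrow> bool) \<Rightarrow> 'v \<Rightarrow> (nat \<Rightarrow> 'v) \<Rightarrow> bool" where
  "ray E r w \<longleftrightarrow> w 0 = r \<and> (\<forall>k. E (w k) (w (Suc k))) \<and> (\<forall>k. w (Suc (Suc k)) \<noteq> w k)"

section \<open>Genealogical graph with seeds \<open>r\<close> and \<open>s\<close>\<close>

definition with_seeds :: "'v \<Rightarrow> 'v \<Rightarrow> ('v \<Rightarrow> real) \<Rightarrow> 'v \<Rightarrow> real" where
  "with_seeds r s t v = (if v \<in> {r, s} then 0 else t v)"

text \<open>
  The distance is that of the full tree also when \<open>G\<close> is a ball: balls of a tree are
  geodesically convex, so this is the distance of the induced subgraph.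
\<close>

definition parent_candidates ::
    "('v \<Rightarrow> 'v \<Rightarrow> bool) \<Rightarrow> 'v set \<Rightarrow> ('v \<Rightarrow> real) \<Rightarrow> 'v \<Rightarrow> 'v set" where
  "parent_candidates E G t v =
     {w \<in> G. t w < t v \<and> (\<forall>u \<in> G. t u < t v \<longrightarrow> gdist E v w \<le> gdist E v u)}"

definition parent_kernel ::
    "('v \<Rightarrow> 'v \<Rightarrow> bool) \<Rightarrow> 'v \<Rightarrow> 'v \<Rightarrow> 'v set \<Rightarrow> ('v \<Rightarrow> real) \<Rightarrow> ('v \<Rightarrow> 'v) measure" where
  "parent_kernel E r s G t =
     PiM (G - {r, s}) (\<lambda>v. measure_pmf (pmf_of_set (parent_candidates E G (with_seeds r s t) v)))"

text \<open>
  Law of the parent map on the non-seed vertices of \<open>G\<close>: the arrival times are i.i.d. of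
  law \<open>\<mu>\<close>, and given them the parents are independent and uniform. The candidate set is
  always finite, and it is nonempty when the arrival time is positive, since \<open>r\<close> has
  arrival time 0; so the unspecified value \<open>pmf_of_set {}\<close> only matters on a null event.
\<close>

definition genealogy_law ::
    "('v \<Rightarrow> 'v \<Rightarrow> bool) \<Rightarrow> real measure \<Rightarrow> 'v \<Rightarrow> 'v \<Rightarrow> 'v set \<Rightarrow> ('v \<Rightarrow> 'v) measure" where
  "genealogy_law E \<mu> r s G = bind (PiM (G - {r, s}) (\<lambda>_. \<mu>)) (parent_kernel E r s G)"

definition genealogical_graph :: "'v \<Rightarrow> 'v \<Rightarrow> 'v set \<Rightarrow> ('v \<Rightarrow> 'v) \<Rightarrow> ('v \<times> 'v) set" where
  "genealogical_graph r s G g = {(v, g v) | v. v \<in> G - {r, s}}"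

section \<open>The coloring on a finite ball\<close>

datatype color = Blue | Red

text \<open>
  Seeds have no outgoing edge, so \<open>r\<close> is reachable from \<open>v\<close> iff the ancestral path
  of \<open>v\<close> ends at \<open>r\<close>; on a ball containing both seeds it otherwise ends at \<open>s\<close>
  almost surely.
\<close>

definition finite_coloring :: "'v \<Rightarrow> 'v \<Rightarrow> 'v set \<Rightarrow> ('v \<Rightarrow> 'v) \<Rightarrow> 'v \<Rightarrow> color" where
  "finite_coloring r s G g =
     (\<lambda>v\<in>G. if (v, r) \<in> (genealogical_graph r s G g)\<^sup>* then Blue else Red)"

definition finite_coloring_law ::
    "('v \<Rightarrow> 'v \<Rightarrow> bool) \<Rightarrow> real measure \<Rightarrow> 'v \<Rightarrow> 'v \<Rightarrow> nat \<Rightarrow> ('v \<Rightarrow> color) measure" where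
  "finite_coloring_law E \<mu> r s l =
     distr (genealogy_law E \<mu> r s (gball E r l))
           (PiM (gball E r l) (\<lambda>_. count_space UNIV))
           (finite_coloring r s (gball E r l))"

section \<open>The coloring in infinite volume\<close>

definition component :: "'v \<Rightarrow> 'v \<Rightarrow> ('v \<Rightarrow> 'v) \<Rightarrow> 'v \<Rightarrow> 'v set" where
  "component r s g v =
     (genealogical_graph r s UNIV g \<union> (genealogical_graph r s UNIV g)\<inverse>)\<^sup>* `` {v}"

definition free_components :: "'v \<Rightarrow> 'v \<Rightarrow> ('v \<Rightarrow> 'v) \<Rightarrow> 'v set set" where
  "free_components r s g = {C \<in> range (component r s g). r \<notin> C \<and> s \<notin> C}"

text \<open>
  Only meant for a component \<open>C\<close> without seeds, where the ancestral path of \<open>v\<close> is the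
  infinite sequence of the iterates \<open>(g ^^ n) v\<close>.
\<close>

definition is_direction ::
    "('v \<Rightarrow> 'v \<Rightarrow> bool) \<Rightarrow> 'v \<Rightarrow> ('v \<Rightarrow> 'v) \<Rightarrow> 'v set \<Rightarrow> (nat \<Rightarrow> 'v) \<Rightarrow> bool" where
  "is_direction E r g C w \<longleftrightarrow>
     ray E r w \<and> (\<forall>v\<in>C. \<forall>k. eventually (\<lambda>n. (g ^^ n) v \<in> subtree E r (w k)) sequentially)"

text \<open>
  For a ray \<open>w\<close> the difference \<open>d(w\<^sub>k,a) - d(w\<^sub>k,b)\<close> is eventually constant, so its
  eventual sign is the sign of that constant.
\<close>

definition dir_closer ::
    "('v \<Rightarrow> 'v \<Rightarrow> bool) \<Rightarrow> 'v \<Rightarrow> ('v \<Rightarrow> 'v) \<Rightarrow> 'v set \<Rightarrow> 'v \<Rightarrow> 'v \<Rightarrow> bool" where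
  "dir_closer E r g C a b \<longleftrightarrow>
     (\<exists>w. is_direction E r g C w \<and> eventually (\<lambda>k. gdist E (w k) a < gdist E (w k) b) sequentially)"

definition dir_equidistant ::
    "('v \<Rightarrow> 'v \<Rightarrow> bool) \<Rightarrow> 'v \<Rightarrow> ('v \<Rightarrow> 'v) \<Rightarrow> 'v set \<Rightarrow> 'v \<Rightarrow> 'v \<Rightarrow> bool" where
  "dir_equidistant E r g C a b \<longleftrightarrow>
     (\<exists>w. is_direction E r g C w \<and> eventually (\<lambda>k. gdist E (w k) a = gdist E (w k) b) sequentially)"

definition tied_components ::
    "('v \<Rightarrow> 'v \<Rightarrow> bool) \<Rightarrow> 'v \<Rightarrow> 'v \<Rightarrow> ('v \<Rightarrow> 'v) \<Rightarrow> 'v set set" where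
  "tied_components E r s g = {C \<in> free_components r s g. dir_equidistant E r g C r s}"

text \<open>
  \<open>X\<close> is a family of coins indexed by the tied components. The final \<open>Red\<close> is reached
  only when a component without seed has no direction, which is a null event.
\<close>

definition limit_coloring ::
    "('v \<Rightarrow> 'v \<Rightarrow> bool) \<Rightarrow> 'v \<Rightarrow> 'v \<Rightarrow> ('v \<Rightarrow> 'v) \<Rightarrow> ('v set \<Rightarrow> bool) \<Rightarrow> 'v \<Rightarrow> color" where
  "limit_coloring E r s g X v =
     (let C = component r s g v in
      if r \<in> C then Blue
      else if s \<in> C then Red
      else if dir_closer E r g C r s then Blue
      else if dir_closer E r g C s r then Red
      else if C \<in> tied_components E r s g then (if X C then Blue else Red)
      else Red)"

definition chi ::
    "('v \<Rightarrow> 'v \<Rightarrow> bool) \<Rightarrow> real measure \<Rightarrow> 'v \<Rightarrow> 'v \<Rightarrow> ('v \<Rightarrow> color) measure" where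
  "chi E \<mu> r s =
     bind (genealogy_law E \<mu> r s UNIV)
       (\<lambda>g. distr (PiM (tied_components E r s g) (\<lambda>_. measure_pmf (bernoulli_pmf (1/2))))
                  (PiM UNIV (\<lambda>_. count_space UNIV))
                  (limit_coloring E r s g))"

section \<open>Convergence in distribution in the local topology\<close>

definition restricted_law ::
    "('v \<Rightarrow> 'v \<Rightarrow> bool) \<Rightarrow> 'v \<Rightarrow> nat \<Rightarrow> ('v \<Rightarrow> color) measure \<Rightarrow> ('v \<Rightarrow> color) measure" where
  "restricted_law E r N L =
     distr L (PiM (gball E r N) (\<lambda>_. count_space UNIV)) (\<lambda>c. restrict c (gball E r N))"

text \<open>
  There are finitely many colorings of \<open>gball E r N\<close> and all sets of them are measurable,
  so weak convergence of their laws is tested against all real functions. For \<open>l < N\<close> the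
  restriction of a coloring of \<open>gball E r l\<close> to \<open>gball E r N\<close> is junk, which
  does not affect the limit.
\<close>

definition locally_converges ::
    "('v \<Rightarrow> 'v \<Rightarrow> bool) \<Rightarrow> 'v \<Rightarrow> (nat \<Rightarrow> ('v \<Rightarrow> color) measure) \<Rightarrow> ('v \<Rightarrow> color) measure \<Rightarrow> bool" where
  "locally_converges E r L L' \<longleftrightarrow>
     (\<forall>N. \<forall>f :: ('v \<Rightarrow> color) \<Rightarrow> real.
        (\<lambda>l. \<integral>c. f c \<partial>restricted_law E r N (L l)) \<longlonglongrightarrow> (\<integral>c. f c \<partial>restricted_law E r N L'))"

end

theory Submission imports Defs begin

text \<open>
  The color of a vertex \<open>v\<close> is decided by its ancestral path, and along this path the arrival
  times decrease. Fix a level \<open>k > d r s\<close> and call a vertex low if it is earlier than every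
  non-seed vertex within distance \<open>2 * k\<close> of \<open>r\<close>. A low vertex lies in the subtree below some
  vertex \<open>w\<close> of level \<open>k\<close>, and its parent is again low and below \<open>w\<close>, unless it is a seed: a
  vertex elsewhere that is not farther away than the seeds would belong to that neighborhood of
  \<open>r\<close> and would be too late (\<open>trap\<close>). Hence a path that has become low below \<open>w\<close> ends at the seed
  nearer to \<open>w\<close>, or it never ends and has a direction below \<open>w\<close>, which is asymptotically closer to
  that same seed. Both on a ball and on the whole tree, the color of \<open>v\<close> is therefore forced by
  the entry point of \<open>v\<close>, its first ancestor that is a seed or low, except for entry points below
  a vertex \<open>w\<close> at equal distance from the seeds.

  In that case the two seeds can be exchanged as parents of the low vertices below \<open>w\<close>. Such
  vertices are at equal distance from both seeds, so a uniformly chosen parent keeps its law, the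
  entry points do not change, and all colors decided below \<open>w\<close> are reversed; in infinite volume
  the coins of the components with a direction below \<open>w\<close> are turned as well. Averaging over all
  sets of equidistant vertices \<open>w\<close> shows that, given the entry points, the undetermined colors are
  independent fair coins, provided that different entry points lie below different \<open>w\<close> (\<open>average\<close>,
  \<open>fin_average\<close>, \<open>inf_average\<close>). The entry points only depend on the parents of finitely many
  vertices, and a large ball does not restrict these parents; so the entry points have the same
  law on the ball and on the tree (\<open>same_entries\<close>). For given times, the two colorings of a finite
  set thus differ in law at most by the probability that two of its vertices have different entry
  points below the same \<open>w\<close> (\<open>quenched_compare\<close>). Dominated convergence over the times then gives
  the theorem.

  Two facts about almost every choice of the times are needed, and both are proved by first
  moments, summed over all paths of candidate parents, whatever the choices of the parents. First,
  the times along an infinite path tend to the bottom of the distribution (\<open>AE_times_vanish\<close>);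
  therefore every path reaches a seed or becomes low. Secondly, two infinite paths that never meet
  cannot have the same direction (\<open>AE_good\<close>); therefore the probability of different entry points
  below the same \<open>w\<close> tends to zero with \<open>k\<close> (\<open>bad_prob_tendsto\<close>). For the first moments one
  explores the tree along a path. The explored vertices are later than the current vertex \<open>x\<close> and
  lie on one side of it, so that one of the at least three branches at \<open>x\<close> is still unexplored
  (\<open>fresh_branch\<close>). If the times are measured by their distribution function, with value \<open>p\<close> at
  \<open>x\<close>, then a jump over distance \<open>n\<close> requires that about \<open>K ^ n\<close> fresh times exceed that of \<open>x\<close>.
  The expected number of candidate jumps is thus of order
  \<open>\<Sum>n. p * K ^ n * (1 - p) ^ (K ^ n)\<close>, which is bounded uniformly in \<open>p\<close>. Since the new time
  is uniform below the old one, a suitable weight makes the expected number of paths contract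
  (\<open>cpaths_decay\<close>, \<open>cpairs_decay\<close>). If two paths that never meet had the same direction, they
  would at every stage have to cross the middle between their current vertices (\<open>same_dir_cross\<close>).
  The chance of this decays exponentially in their distance (\<open>cross_bound\<close>), and since the jumps
  get longer as the times get smaller, its expectation contracts.
\<close>

section \<open>Geometry of a regular tree\<close>

lemma walk_relpowp: "(\<exists>p. walk E u p v \<and> length p = Suc n) \<longleftrightarrow> (E ^^ n) u v"
proof (induction n arbitrary: u)
  case 0
  show ?case
    by (auto simp: walk_def length_Suc_conv intro!: exI[of _ "[v]"])
next
  case (Suc n)
  show ?case
  proof
    assume "\<exists>p. walk E u p v \<and> length p = Suc (Suc n)"
    then obtain p where p: "walk E u p v" "length p = Suc (Suc n)" by blast
    then obtain a b q where q: "p = a # b # q" by (auto simp: length_Suc_conv)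
    then have "walk E b (b # q) v" "length (b # q) = Suc n" "E u b"
      using p by (auto simp: walk_def)
    then have "(E ^^ n) b v" using Suc.IH by blast
    then show "(E ^^ Suc n) u v" using \<open>E u b\<close> by (meson relpowp_Suc_I2)
  next
    assume "(E ^^ Suc n) u v"
    then obtain b where b: "E u b" "(E ^^ n) b v" by (meson relpowp_Suc_D2)
    then obtain p where p: "walk E b p v" "length p = Suc n" using Suc.IH by blast
    then have "walk E u (u # p) v" "length (u # p) = Suc (Suc n)"
      using b by (auto simp: walk_def successively_Cons)
    then show "\<exists>p. walk E u p v \<and> length p = Suc (Suc n)" by blast
  qed
qed

locale tree =
  fixes K :: nat and E :: "'v \<Rightarrow> 'v \<Rightarrow> bool"
  assumes K2: "K \<ge> 2" and reg: "regular_tree K E"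
begin

abbreviation d :: "'v \<Rightarrow> 'v \<Rightarrow> nat" where "d \<equiv> gdist E"

lemma E_sym: "E u v \<Longrightarrow> E v u"
  using reg unfolding regular_tree_def by (auto dest: sympD)

lemma E_irrefl: "\<not> E u u"
  using reg unfolding regular_tree_def by (auto simp: irreflp_def)

lemma finite_nbrs: "finite {w. E v w}" and card_nbrs: "card {w. E v w} = K + 1"
  using reg unfolding regular_tree_def by auto

lemma d_Least: "d u v = (LEAST n. (E ^^ n) u v)"
  unfolding gdist_def walk_relpowp ..

lemma relpowp_d: "(E ^^ d u v) u v"
proof -
  obtain p where p: "walk E u p v" using reg unfolding regular_tree_def by blast
  then have "length p = Suc (length p - 1)" by (cases p) (auto simp: walk_def)
  then have "\<exists>n. (E ^^ n) u v" using p walk_relpowp[of E u v "length p - 1"] by metis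
  then show ?thesis unfolding d_Least by (rule LeastI_ex)
qed

lemma d_le_relpowp: "(E ^^ n) u v \<Longrightarrow> d u v \<le> n"
  unfolding d_Least by (rule Least_le)

lemma d_zero [simp]: "d u v = 0 \<longleftrightarrow> u = v"
  using relpowp_d[of u v] d_le_relpowp[of 0 u v] by fastforce

lemma d_self [simp]: "d u u = 0" by simp

lemma d_pos [simp]: "0 < d u v \<longleftrightarrow> u \<noteq> v" using d_zero[of u v] by linarith

lemma d_triangle: "d u w \<le> d u v + d v w"
  using relpowp_d[of u v] relpowp_d[of v w] by (intro d_le_relpowp) (auto simp: relpowp_add)

lemma relpowp_sym: "(E ^^ n) u v \<Longrightarrow> (E ^^ n) v u"
proof (induction n arbitrary: u)
  case (Suc n)
  then show ?case by (metis E_sym relpowp_Suc_D2 relpowp_Suc_I)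
qed auto

lemma d_sym: "d u v = d v u"
  by (meson antisym d_le_relpowp relpowp_d relpowp_sym)

lemma d_nbr: "E u v \<Longrightarrow> d u v = 1"
  using d_le_relpowp[of 1 u v] d_zero[of u v] E_irrefl by (cases "d u v") auto

lemma d_nbr_le: "E x c \<Longrightarrow> d x z \<le> Suc (d c z)"
  using d_triangle[of x z c] d_nbr by fastforce

lemma d_Suc: "d u v = Suc n \<Longrightarrow> \<exists>c. E u c \<and> d c v = n"
proof -
  assume a: "d u v = Suc n"
  then have "(E ^^ Suc n) u v" using relpowp_d by metis
  then obtain c where c: "E u c" "(E ^^ n) c v" by (meson relpowp_Suc_D2)
  then have "d c v \<le> n" by (simp add: d_le_relpowp)
  moreover have "Suc n \<le> Suc (d c v)" using d_nbr_le[OF c(1), of v] a by simp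
  ultimately show ?thesis using c by auto
qed

text \<open>A shortest walk between two neighbors of \<open>x\<close> that avoids \<open>x\<close> would close up to a cycle
  through \<open>x\<close>.\<close>

lemma nbrs_separated:
  assumes "E x c" "E x c'" "c \<noteq> c'"
  shows "\<not> (\<lambda>u v. E u v \<and> u \<noteq> x \<and> v \<noteq> x)\<^sup>*\<^sup>* c c'"
proof
  let ?R = "\<lambda>u v. E u v \<and> u \<noteq> x \<and> v \<noteq> x"
  assume "?R\<^sup>*\<^sup>* c c'"
  then obtain n where "(?R ^^ n) c c'" by (meson rtranclp_imp_relpowp)
  then obtain p0 where "walk ?R c p0 c'" using walk_relpowp[of ?R c c' n] by blast
  then obtain p where p: "walk ?R c p c'" and min: "\<And>q. walk ?R c q c' \<Longrightarrow> length p \<le> length q"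
    using ex_has_least_nat[of "\<lambda>p. walk ?R c p c'" p0 length] by blast
  have "distinct p"
  proof (rule ccontr)
    assume "\<not> distinct p"
    then obtain xs ys zs y where e: "p = xs @ [y] @ ys @ [y] @ zs"
      using not_distinct_decomp by blast
    have "walk ?R c (xs @ [y] @ zs) c'"
      using p unfolding e walk_def
      by (auto simp: successively_append_iff successively_Cons hd_append split: if_splits)
    from min[OF this] show False unfolding e by simp
  qed
  have ne: "p \<noteq> []" "hd p = c" "last p = c'" "successively ?R p" using p by (auto simp: walk_def)
  have "length p \<ge> 2"
  proof (rule ccontr)
    assume "\<not> 2 \<le> length p"
    then obtain y where "p = [y]" using ne(1) by (cases p; cases "tl p") auto
    then show False using ne assms(3) by simp
  qed
  have xp: "x \<notin> set p"
  proof
    assume "x \<in> set p"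
    then obtain a b where ab: "p = a @ x # b" by (meson split_list)
    show False
    proof (cases b)
      case Nil
      then show ?thesis using ne ab assms E_irrefl by auto
    next
      case (Cons y b')
      then show ?thesis using ne ab by (auto simp: successively_append_iff)
    qed
  qed
  have "successively E p" using ne(4) by (rule successively_mono) auto
  then have "successively E (x # p)" using ne assms by (cases p) auto
  moreover have "E (last (x # p)) (hd (x # p))" using ne assms E_sym by simp
  moreover have "length (x # p) \<ge> 3" using \<open>length p \<ge> 2\<close> by simp
  moreover have "distinct (x # p)" using xp \<open>distinct p\<close> by simp
  ultimately show False using reg unfolding regular_tree_def by blast
qed

lemma geodesic_avoids:
  assumes "d c z \<le> d x z" "c \<noteq> x"
  shows "(\<lambda>u v. E u v \<and> u \<noteq> x \<and> v \<noteq> x)\<^sup>*\<^sup>* c z"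
  using assms
proof (induction "d c z" arbitrary: c)
  case (Suc n)
  then obtain c1 where c1: "E c c1" "d c1 z = n" using d_Suc by metis
  then have "c1 \<noteq> x" using Suc by auto
  then show ?case using Suc.hyps(1)[of c1] c1 Suc by (auto intro: converse_rtranclp_into_rtranclp)
qed auto

text \<open>Geodesics from two such neighbors to \<open>z\<close> avoid \<open>x\<close> and would join the neighbors.\<close>

lemma towards_unique_le:
  assumes "E x c" "E x c'" "d c z \<le> d x z" "d c' z \<le> d x z"
  shows "c = c'"
proof (rule ccontr)
  assume ne: "c \<noteq> c'"
  let ?R = "\<lambda>u v. E u v \<and> u \<noteq> x \<and> v \<noteq> x"
  have cx: "c \<noteq> x" "c' \<noteq> x" using assms E_irrefl by auto
  have "?R\<^sup>*\<^sup>* c z" "?R\<^sup>*\<^sup>* c' z" using geodesic_avoids assms cx by auto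
  moreover have "symp ?R" using E_sym by (auto intro!: sympI)
  ultimately have "?R\<^sup>*\<^sup>* c c'" by (meson rtranclp_trans symp_rtranclp sympD)
  with nbrs_separated assms ne show False by blast
qed

definition towards :: "'v \<Rightarrow> 'v \<Rightarrow> 'v" where
  "towards x z = (SOME c. E x c \<and> d x z = Suc (d c z))"

lemma towards: assumes "x \<noteq> z" shows "E x (towards x z)" "d x z = Suc (d (towards x z) z)"
proof -
  obtain n where "d x z = Suc n" using assms by (cases "d x z") auto
  then have "\<exists>c. E x c \<and> d x z = Suc (d c z)" using d_Suc by metis
  from someI_ex[OF this] show "E x (towards x z)" "d x z = Suc (d (towards x z) z)"
    unfolding towards_def by auto
qed

lemma towards_eqI: "E x c \<Longrightarrow> d c z \<le> d x z \<Longrightarrow> x \<noteq> z \<Longrightarrow> c = towards x z"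
  by (rule towards_unique_le[of x _ _ z]) (use towards[of x z] in auto)

lemma nbr_away: "E x c \<Longrightarrow> x = z \<or> c \<noteq> towards x z \<Longrightarrow> d c z = Suc (d x z)"
proof -
  assume a: "E x c" "x = z \<or> c \<noteq> towards x z"
  have "d c z \<le> Suc (d x z)" using d_nbr_le[OF E_sym[OF a(1)]] .
  moreover have "\<not> d c z \<le> d x z"
    using a towards_eqI[OF a(1)] E_irrefl by (cases "x = z") auto
  ultimately show ?thesis by simp
qed

text \<open>Betweenness: \<open>y\<close> lies on the geodesic from \<open>x\<close> to \<open>z\<close>.\<close>

definition bet :: "'v \<Rightarrow> 'v \<Rightarrow> 'v \<Rightarrow> bool" where "bet x y z \<longleftrightarrow> d x z = d x y + d y z"

lemma bet_sym: "bet x y z \<longleftrightarrow> bet z y x"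
  unfolding bet_def by (simp add: d_sym add.commute)

lemma bet_triv [simp]: "bet x x z" "bet x z z" unfolding bet_def by auto

lemma bet_self: "bet x y x \<longleftrightarrow> x = y" unfolding bet_def using d_sym by auto

text \<open>Otherwise a geodesic from \<open>y\<close> to \<open>z\<close> would join two different neighbors of \<open>x\<close> without
  visiting \<open>x\<close>.\<close>

lemma through:
  assumes "y \<noteq> x" "z \<noteq> x" "towards x y \<noteq> towards x z"
  shows "bet y x z"
  using assms
proof (induction "d y x" arbitrary: y rule: less_induct)
  case less
  show ?case
  proof (cases "towards y x = x")
    case True
    then have "E y x" using towards less.prems by metis
    moreover have "y = towards x y"
      using towards_eqI[of x y y] E_sym[OF \<open>E y x\<close>] less.prems by simp
    ultimately have "d y z = Suc (d x z)"
      using nbr_away[of x y z] E_sym less.prems by metis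
    then show ?thesis using d_nbr[OF \<open>E y x\<close>] by (simp add: bet_def)
  next
    case False
    define y' where "y' = towards y x"
    have y': "E y y'" "d y x = Suc (d y' x)" using towards less.prems unfolding y'_def by auto
    have ne: "y' \<noteq> x" using False y'_def by simp
    define c where "c = towards x y"
    have c: "E x c" "d x y = Suc (d c y)" using towards[of x y] less.prems unfolding c_def by auto
    have cy: "c \<noteq> y"
    proof
      assume "c = y"
      then have "d y x = 1" using c d_nbr d_sym by metis
      then show False using y' ne by simp
    qed
    define y'' where "y'' = towards y c"
    have y'': "E y y''" "d y c = Suc (d y'' c)" using towards[of y c] cy unfolding y''_def by auto
    have "d y'' x \<le> Suc (d c y'')" using d_nbr_le[OF c(1), of y''] d_sym by metis
    then have "d y'' x \<le> d y x" using y'' c d_sym by (metis le_SucI)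
    then have "y'' = y'" using towards_eqI[OF y''(1)] less.prems y'_def by auto
    then have "d c y' \<le> d x y'"
      using y''(2) c(2) y'(2) d_sym[of y c] d_sym[of y x] d_sym[of y' c] d_sym[of y' x] by simp
    then have "c = towards x y'" using towards_eqI[OF c(1)] ne by metis
    then have t': "towards x y' = towards x y" using c_def by simp
    have IH: "bet y' x z" using less.hyps[of y'] y' ne t' less.prems by auto
    then have y'z: "y' \<noteq> z" using less.prems ne by (auto simp: bet_def)
    have "d (towards y' x) z \<le> d y' z"
    proof -
      have "d (towards y' x) z \<le> d (towards y' x) x + d x z" by (rule d_triangle)
      then show ?thesis using towards(2)[OF ne] IH unfolding bet_def by simp
    qed
    then have "towards y' x = towards y' z" using towards_eqI[of y' "towards y' x" z] towards[OF ne] y'z by simp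
    moreover have "y \<noteq> towards y' x" using towards[OF ne] y' by auto
    ultimately have "d y z = Suc (d y' z)" using nbr_away[OF E_sym[OF y'(1)], of z] by auto
    then show ?thesis using IH y' unfolding bet_def by simp
  qed
qed

lemma not_bet_iff: "\<not> bet y x z \<longleftrightarrow> y \<noteq> x \<and> z \<noteq> x \<and> towards x y = towards x z"
proof
  assume "\<not> bet y x z" then show "y \<noteq> x \<and> z \<noteq> x \<and> towards x y = towards x z"
    using through by (metis bet_triv)
next
  assume a: "y \<noteq> x \<and> z \<noteq> x \<and> towards x y = towards x z"
  have "d y z \<le> d y (towards x y) + d (towards x y) z" by (rule d_triangle)
  then show "\<not> bet y x z" using a towards(2)[of x y] towards(2)[of x z] d_sym[of y x] d_sym[of y "towards x y"]
    unfolding bet_def by auto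
qed

text \<open>Points that \<open>z\<close> does not separate lie in the same branch at \<open>z\<close>.\<close>

lemma same_branch_trans: "\<not> bet u z x \<Longrightarrow> \<not> bet x z w \<Longrightarrow> \<not> bet u z w"
  unfolding not_bet_iff by auto

lemma tripod: "bet u y z \<Longrightarrow> bet u y x \<or> bet x y z"
  using same_branch_trans by blast

lemma bet_antisym: "bet x y z \<Longrightarrow> bet x y' z \<Longrightarrow> d x y = d x y' \<Longrightarrow> y = y'"
  using tripod[of x y z y'] unfolding bet_def by auto

lemma bet_trans: "bet x y z \<Longrightarrow> bet x w y \<Longrightarrow> bet x w z"
  using d_triangle[of x z w] d_triangle[of w z y] unfolding bet_def by linarith

lemma ex_between: "k \<le> d x z \<Longrightarrow> \<exists>y. bet x y z \<and> d x y = k"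
proof (induction k)
  case (Suc k)
  then obtain y where y: "bet x y z" "d x y = k" by auto
  then have "y \<noteq> z" using Suc.prems by auto
  have "bet x (towards y z) z \<and> d x (towards y z) = Suc k"
    using towards[OF \<open>y \<noteq> z\<close>] y d_triangle[of x "towards y z" y] d_triangle[of x z "towards y z"]
      d_nbr[of y "towards y z"] unfolding bet_def by auto
  then show ?case by blast
qed (auto intro: exI[of _ x])

definition branch :: "'v \<Rightarrow> 'v \<Rightarrow> 'v set" where
  "branch x c = {z. z \<noteq> x \<and> towards x z = c}"

lemma branch_iff: "E x c \<Longrightarrow> z \<in> branch x c \<longleftrightarrow> d x z = Suc (d c z)"
proof -
  assume c: "E x c"
  show ?thesis
  proof
    assume "z \<in> branch x c" then show "d x z = Suc (d c z)" unfolding branch_def using towards by auto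
  next
    assume a: "d x z = Suc (d c z)" then have "z \<noteq> x" by auto
    then show "z \<in> branch x c" using towards_eqI[OF c, of z] a unfolding branch_def by auto
  qed
qed

definition sph :: "'v \<Rightarrow> nat \<Rightarrow> 'v set" where "sph x n = {z. d x z = n}"

lemma branch_sphere_Suc:
  assumes c: "E x c"
  shows "branch x c \<inter> sph x (Suc (Suc n)) = (\<Union>c'\<in>{c'. E c c'} - {x}. branch c c' \<inter> sph c (Suc n))"
proof (intro set_eqI iffI)
  fix z assume z: "z \<in> branch x c \<inter> sph x (Suc (Suc n))"
  then have dz: "d c z = Suc n" "d x z = Suc (Suc n)" using branch_iff[OF c] by (auto simp: sph_def)
  then have "c \<noteq> z" by auto
  define c' where "c' = towards c z"
  have "E c c'" "d c z = Suc (d c' z)" using towards[OF \<open>c \<noteq> z\<close>] c'_def by auto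
  moreover from this have "c' \<noteq> x" using dz by auto
  moreover have "z \<in> branch c c'" using \<open>c \<noteq> z\<close> c'_def by (auto simp: branch_def)
  ultimately show "z \<in> (\<Union>c'\<in>{c'. E c c'} - {x}. branch c c' \<inter> sph c (Suc n))"
    using dz by (auto simp: sph_def)
next
  fix z assume "z \<in> (\<Union>c'\<in>{c'. E c c'} - {x}. branch c c' \<inter> sph c (Suc n))"
  then obtain c' where c': "E c c'" "c' \<noteq> x" "z \<in> branch c c'" "d c z = Suc n" by (auto simp: sph_def)
  then have "towards c z = c'" "c \<noteq> z" by (auto simp: branch_def)
  then have "d x z = Suc (d c z)" using nbr_away[OF E_sym[OF c], of z] c' by auto
  then show "z \<in> branch x c \<inter> sph x (Suc (Suc n))" using c' branch_iff[OF c] by (auto simp: sph_def)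
qed

lemma branch_sphere_1: assumes c: "E x c" shows "branch x c \<inter> sph x (Suc 0) = {c}"
  using d_nbr[OF c] by (auto simp: branch_iff[OF c] sph_def)

lemma card_branch_sphere:
  assumes "E x c"
  shows "finite (branch x c \<inter> sph x (Suc n)) \<and> card (branch x c \<inter> sph x (Suc n)) = K ^ n"
  using assms
proof (induction n arbitrary: x c)
  case 0
  then show ?case by (simp add: branch_sphere_1)
next
  case (Suc n)
  let ?I = "{c'. E c c'} - {x}"
  have I: "finite ?I" "card ?I = K" using finite_nbrs card_nbrs E_sym[OF Suc.prems] by auto
  have IH: "\<And>c'. c' \<in> ?I \<Longrightarrow> finite (branch c c' \<inter> sph c (Suc n)) \<and> card (branch c c' \<inter> sph c (Suc n)) = K ^ n"
    using Suc.IH by auto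
  have "card (\<Union>c'\<in>?I. branch c c' \<inter> sph c (Suc n)) = (\<Sum>c'\<in>?I. card (branch c c' \<inter> sph c (Suc n)))"
    by (intro card_UN_disjoint) (use I IH in \<open>auto simp: branch_def\<close>)
  also have "\<dots> = K ^ Suc n" using IH I by simp
  finally have 1: "card (\<Union>c'\<in>?I. branch c c' \<inter> sph c (Suc n)) = K ^ Suc n" .
  have "finite (\<Union>c'\<in>?I. branch c c' \<inter> sph c (Suc n))" using I(1) IH by blast
  then show ?case unfolding branch_sphere_Suc[OF Suc.prems] using 1 by blast
qed

lemma sph_Suc: "sph x (Suc n) = (\<Union>c\<in>{c. E x c}. branch x c \<inter> sph x (Suc n))"
proof -
  have "z \<in> sph x (Suc n) \<Longrightarrow> z \<noteq> x \<and> E x (towards x z)" for z using towards(1)[of x z] by (cases "x = z") (auto simp: sph_def)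
  then show ?thesis by (auto simp: branch_def)
qed

lemma finite_sph [simp]: "finite (sph x n)"
proof (cases n)
  case 0 then have "sph x n = {x}" by (auto simp: sph_def)
  then show ?thesis by simp
next
  case (Suc m) have "finite (\<Union>c\<in>{c. E x c}. branch x c \<inter> sph x (Suc m))"
    using card_branch_sphere finite_nbrs by blast
  then show ?thesis using sph_Suc[of x m] Suc by metis
qed

text \<open>The sphere around \<open>x\<close> has of order \<open>K ^ n\<close> vertices, most of which lie in the branches
  at \<open>x\<close> away from \<open>a\<close>, at distance \<open>n + d x a\<close> from \<open>a\<close>. The vertices that are closer to \<open>a\<close> form
  a geometric series; it is dominated because \<open>K * b\<^sup>2\<close> exceeds \<open>1\<close>.\<close>

lemma sum_sph_bound:
  fixes b :: real
  assumes b: "0 < b" "b \<le> 1" "4 / 3 \<le> K * b\<^sup>2"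
  shows "(\<Sum>z\<in>sph x n. b ^ d z a) \<le> 4 * K ^ n * b ^ (n + d x a)"
proof (induction n arbitrary: x)
  case 0
  have "sph x 0 = {x}" by (auto simp: sph_def)
  then show ?case using b by simp
next
  case (Suc n)
  let ?S = "\<lambda>c. branch x c \<inter> sph x (Suc n)"
  have cS: "finite (?S c)" "card (?S c) = K ^ n" if "E x c" for c using card_branch_sphere that by auto
  have split: "(\<Sum>z\<in>sph x (Suc n). b ^ d z a) = (\<Sum>c\<in>{c. E x c}. \<Sum>z\<in>?S c. b ^ d z a)"
    by (subst sph_Suc, intro sum.UNION_disjoint)
      (use cS finite_nbrs in \<open>auto simp: branch_def\<close>)
  have away: "(\<Sum>z\<in>?S c. b ^ d z a) = K ^ n * b ^ (Suc n + d x a)"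
    if c: "E x c" "x = a \<or> c \<noteq> towards x a" for c
  proof -
    have "d z a = Suc n + d x a" if "z \<in> ?S c" for z
    proof (cases "x = a")
      case False
      then have "bet z x a" using that c through[of z x a] by (auto simp: branch_def)
      then show ?thesis using that by (auto simp: bet_def sph_def d_sym)
    qed (use that in \<open>auto simp: sph_def d_sym\<close>)
    then show ?thesis using cS[OF c(1)] by simp
  qed
  show ?case
  proof (cases "x = a")
    case True
    have "(\<Sum>z\<in>sph x (Suc n). b ^ d z a) = (K + 1) * K ^ n * b ^ (Suc n + d x a)"
      unfolding split using True away card_nbrs[of x] by (simp add: algebra_simps)
    also have "\<dots> \<le> 4 * K ^ Suc n * b ^ (Suc n + d x a)"
    proof (rule mult_right_mono)
      have "real (K + 1) \<le> 4 * K" using K2 by simp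
      then have "real (K + 1) * real (K ^ n) \<le> real (4 * K) * real (K ^ n)" by (rule mult_right_mono) simp
      then show "real ((K + 1) * K ^ n) \<le> 4 * K ^ Suc n" by (simp add: algebra_simps)
    qed (use b in simp)
    finally show ?thesis by simp
  next
    case False
    define c0 where "c0 = towards x a"
    have c0: "E x c0" "d x a = Suc (d c0 a)" using towards[OF False] c0_def by auto
    have sub: "?S c0 \<subseteq> sph c0 n" using branch_iff[OF c0(1)] by (auto simp: sph_def)
    have "(\<Sum>z\<in>?S c0. b ^ d z a) \<le> (\<Sum>z\<in>sph c0 n. b ^ d z a)"
      by (rule sum_mono2) (use sub b in auto)
    also have "\<dots> \<le> 4 * K ^ n * b ^ (n + d c0 a)" by (rule Suc.IH)
    finally have 1: "(\<Sum>z\<in>?S c0. b ^ d z a) \<le> 4 * K ^ n * b ^ (n + d c0 a)" .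
    have "(\<Sum>z\<in>sph x (Suc n). b ^ d z a) = (\<Sum>z\<in>?S c0. b ^ d z a) + (\<Sum>c\<in>{c. E x c} - {c0}. \<Sum>z\<in>?S c. b ^ d z a)"
      unfolding split using finite_nbrs c0 by (simp add: sum.remove)
    also have "(\<Sum>c\<in>{c. E x c} - {c0}. \<Sum>z\<in>?S c. b ^ d z a) = K * (K ^ n * b ^ (Suc n + d x a))"
      using away c0_def card_nbrs[of x] finite_nbrs[of x] c0(1) by simp
    also have "(\<Sum>z\<in>?S c0. b ^ d z a) + K * (K ^ n * b ^ (Suc n + d x a)) \<le>
       4 * K ^ n * b ^ (n + d c0 a) + K * (K ^ n * b ^ (Suc n + d x a))" using 1 by simp
    also have "\<dots> = K ^ n * b ^ (n + d c0 a) * (4 + K * b\<^sup>2)"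
      using c0(2) by (simp add: algebra_simps power_add power2_eq_square)
    also have "\<dots> \<le> K ^ n * b ^ (n + d c0 a) * (4 * (K * b\<^sup>2))"
      using b by (intro mult_left_mono) auto
    also have "\<dots> = 4 * K ^ Suc n * b ^ (Suc n + d x a)"
      using c0(2) by (simp add: algebra_simps power_add power2_eq_square)
    finally show ?thesis .
  qed
qed

lemma finite_gball [simp]: "finite (gball E x n)"
proof -
  have "w \<in> (\<Union>i\<in>{..n}. sph x i)" if "w \<in> gball E x n" for w
    using that by (simp add: gball_def sph_def)
  then have "gball E x n \<subseteq> (\<Union>i\<in>{..n}. sph x i)" by blast
  moreover have "finite (\<Union>i\<in>{..n}. sph x i)" by simp
  ultimately show ?thesis by (rule finite_subset)
qed

lemma countable_UNIV: "countable (UNIV :: 'v set)"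
proof -
  have "x \<in> (\<Union>n. gball E undefined n)" for x
    by (rule UN_I[of "d undefined x"]) (simp_all add: gball_def)
  then have "UNIV = (\<Union>n. gball E undefined n)" by blast
  moreover have "countable (\<Union>n. gball E undefined n)"
    by (rule countable_UN) (simp_all add: countable_finite)
  ultimately show ?thesis by simp
qed

lemma subtree_iff: "w \<in> subtree E x v \<longleftrightarrow> bet x v w"
proof
  assume "w \<in> subtree E x v"
  then obtain p where p: "walk E x p w" "length p = Suc (d x w)" "v \<in> set p"
    by (auto simp: subtree_def geodesic_def)
  then obtain p1 p2 where e: "p = p1 @ v # p2" by (meson split_list)
  have "walk E x (p1 @ [v]) v" "walk E v (v # p2) w"
    using p(1) unfolding e walk_def by (auto simp: successively_append_iff hd_append split: if_splits)
  moreover have "length (p1 @ [v]) = Suc (length p1)" "length (v # p2) = Suc (length p2)" by simp_all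
  ultimately have "(E ^^ length p1) x v" "(E ^^ length p2) v w"
    using walk_relpowp[of E x v "length p1"] walk_relpowp[of E v w "length p2"] by blast+
  then have "d x v \<le> length p1" "d v w \<le> length p2" by (auto simp: d_le_relpowp)
  moreover have "d x w = length p1 + length p2" using p(2) e by simp
  ultimately show "bet x v w" using d_triangle[of x w v] unfolding bet_def by linarith
next
  assume b: "bet x v w"
  obtain p1 where p1: "walk E x p1 v" "length p1 = Suc (d x v)"
    using relpowp_d[of x v] walk_relpowp[of E x v] by blast
  obtain p2 where p2: "walk E v p2 w" "length p2 = Suc (d v w)"
    using relpowp_d[of v w] walk_relpowp[of E v w] by blast
  from p2 obtain q where q: "p2 = v # q" by (cases p2) (auto simp: walk_def)
  have "walk E x (p1 @ q) w"
    using p1 p2 q unfolding walk_def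
    by (cases q) (auto simp: successively_append_iff hd_append successively_Cons)
  moreover have "length (p1 @ q) = Suc (d x w)" using p1 p2 q b unfolding bet_def by simp
  moreover have "v \<in> set (p1 @ q)" using p1 unfolding walk_def by auto
  ultimately show "w \<in> subtree E x v" by (auto simp: subtree_def geodesic_def)
qed

text \<open>The set of vertices that have been explored when a path arrives at \<open>x\<close>. It is
  star-shaped around \<open>x\<close>, and \<open>x\<close> does not separate it from some vertex \<open>b\<close>, so it lies in a
  single branch at \<open>x\<close>.\<close>

definition history :: "'v set \<Rightarrow> 'v \<Rightarrow> bool" where
  "history D x \<longleftrightarrow> x \<notin> D \<and> (\<forall>u\<in>D. \<forall>y. bet u y x \<longrightarrow> y \<noteq> x \<longrightarrow> y \<in> D) \<and>
     (\<exists>b. b \<noteq> x \<and> (\<forall>u\<in>D. \<not> bet u x b))"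

lemma history_empty: "history {} x"
proof -
  have "{c. E x c} \<noteq> {}" using card_nbrs[of x] by (auto simp del: Collect_empty_eq)
  then obtain c where "E x c" by blast
  then have "c \<noteq> x" using E_irrefl by blast
  then show ?thesis unfolding history_def by blast
qed

lemma history_star: assumes "history D x" "u \<in> D" "bet u y x" "y \<noteq> x" shows "y \<in> D"
proof -
  have "\<forall>u\<in>D. \<forall>y. bet u y x \<longrightarrow> y \<noteq> x \<longrightarrow> y \<in> D" using assms(1) unfolding history_def by (elim conjE)
  then show ?thesis using assms(2-) by simp
qed

text \<open>When \<open>z\<close> is found to be a nearest earlier vertex, all vertices that are closer to \<open>x\<close>
  than \<open>z\<close> have been seen to be late. The whole new history lies in the branch of \<open>x\<close> at \<open>z\<close>.\<close>

lemma history_jump: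
  assumes "history D x" "z \<notin> D" "z \<noteq> x"
  shows "history (insert x D \<union> {u. d x u < d x z}) z"
  unfolding history_def
proof (intro conjI ballI allI impI)
  show "z \<notin> insert x D \<union> {u. d x u < d x z}" using assms(2,3) by auto
  note star = history_star[OF assms(1)]
  fix u y assume u: "u \<in> insert x D \<union> {u. d x u < d x z}" "bet u y z" "y \<noteq> z"
  have 2: "bet x y z \<Longrightarrow> d x y < d x z" using \<open>y \<noteq> z\<close> by (auto simp: bet_def)
  from tripod[OF u(2), of x] show "y \<in> insert x D \<union> {u. d x u < d x z}"
  proof
    assume "bet u y x"
    then have "d x y \<le> d x u" using d_sym[of u x] d_sym[of y x] by (simp add: bet_def)
    show ?thesis
    proof (cases "u \<in> D")
      case True
      then show ?thesis using star[OF True \<open>bet u y x\<close>] by blast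
    next
      case False
      then have "u = x \<or> d x u < d x z" using u(1) by blast
      then have "d x y < d x z" using \<open>d x y \<le> d x u\<close> assms(3) by (metis d_pos d_zero le_less_trans)
      then show ?thesis by simp
    qed
  next
    assume "bet x y z"
    then show ?thesis using 2 by simp
  qed
next
  note star = history_star[OF assms(1)]
  have "\<not> bet u z x" if "u \<in> insert x D \<union> {u. d x u < d x z}" for u
  proof
    assume b: "bet u z x"
    then have "u \<notin> D" using star[of u z] assms(2,3) by metis
    moreover have "d x z \<le> d x u" using b d_sym[of u x] d_sym[of z x] by (simp add: bet_def)
    ultimately have "u = x" using that by auto
    then show False using b assms(3) by (simp add: bet_self)
  qed
  then show "\<exists>b. b \<noteq> z \<and> (\<forall>u\<in>insert x D \<union> {u. d x u < d x z}. \<not> bet u z b)"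
    using assms(3) by (intro exI[of _ x] conjI ballI) (assumption | simp)+
qed

text \<open>There are at least three branches at \<open>x\<close>: one contains the history, one contains \<open>a\<close>,
  and another one is left.\<close>

lemma fresh_branch:
  assumes "history D x" "a \<noteq> x"
  obtains c where "E x c" "branch x c \<inter> D = {}" "\<And>u. u \<in> branch x c \<Longrightarrow> bet u x a"
proof -
  from assms obtain b where b: "b \<noteq> x" "\<And>u. u \<in> D \<Longrightarrow> \<not> bet u x b" unfolding history_def by blast
  have "\<not> {c. E x c} \<subseteq> {towards x b, towards x a}"
  proof
    assume "{c. E x c} \<subseteq> {towards x b, towards x a}"
    then have "card {c. E x c} \<le> card {towards x b, towards x a}" by (intro card_mono) auto
    also have "\<dots> \<le> 2" by (simp add: card_insert_if)
    finally show False using card_nbrs K2 by simp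
  qed
  then obtain c where c: "E x c" "c \<noteq> towards x b" "c \<noteq> towards x a" by auto
  show thesis
  proof (rule that[of c])
    show "branch x c \<inter> D = {}"
    proof (rule equals0I)
      fix u assume "u \<in> branch x c \<inter> D"
      then have "towards x u = c" "\<not> bet u x b" using b(2) by (auto simp: branch_def)
      then show False using c(2) not_bet_iff by blast
    qed
    show "bet u x a" if "u \<in> branch x c" for u
      using c(3) that not_bet_iff[of u x a] by (auto simp: branch_def)
    show "E x c" by (rule c(1))
  qed
qed

end

section \<open>Arrival times\<close>

locale arrival = tree K E for K and E :: "'v \<Rightarrow> 'v \<Rightarrow> bool" +
  fixes r s :: 'v and \<mu> :: "real measure"
  assumes seeds_ne: "s \<noteq> r"
    and prob_mu: "prob_space \<mu>" and sets_mu: "sets \<mu> = sets borel"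
    and mu_pos: "emeasure \<mu> {0<..} = 1"
    and atomless: "\<And>x. emeasure \<mu> {x} = 0"
begin

sublocale mu: real_distribution \<mu>
  using prob_mu sets_mu by (simp add: real_distribution_def real_distribution_axioms_def)

lemma space_mu [simp]: "space \<mu> = UNIV" by (rule mu.space_eq_univ)

definition F :: "real \<Rightarrow> real" where "F = cdf \<mu>"

lemma F_nonneg [simp]: "0 \<le> F x" and F_le1 [simp]: "F x \<le> 1"
  unfolding F_def using mu.cdf_nonneg mu.cdf_bounded_prob by auto

lemma F_mono: "x \<le> y \<Longrightarrow> F x \<le> F y"
  unfolding F_def by (rule mu.cdf_nondecreasing)

lemma F_cont: "isCont F x"
  unfolding F_def mu.isCont_cdf using atomless by (simp add: measure_def)

lemma F_measurable [measurable]: "F \<in> borel_measurable borel"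
  by (rule borel_measurable_continuous_onI) (use F_cont in \<open>simp add: continuous_at_imp_continuous_on\<close>)

lemma emeasure_lt: "emeasure \<mu> {..<x} = ennreal (F x)"
proof -
  have "emeasure \<mu> {..x} = emeasure \<mu> {..<x} + emeasure \<mu> {x}"
    by (subst plus_emeasure) (auto intro!: arg_cong[where f="emeasure \<mu>"])
  then show ?thesis using atomless by (simp add: F_def cdf_def mu.emeasure_eq_measure)
qed

lemma emeasure_ge: "emeasure \<mu> {x..} = ennreal (1 - F x)"
proof -
  have e: "{x..} = space \<mu> - {..<x}" by auto
  have "emeasure \<mu> {x..} = 1 - ennreal (F x)"
    unfolding e by (subst emeasure_compl) (auto simp: emeasure_lt mu.emeasure_space_1[simplified])
  then show ?thesis by (simp add: ennreal_minus[symmetric])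
qed

lemma F_0: "F 0 = 0"
proof -
  have e: "{..0} = space \<mu> - {0<..}" by auto
  have "emeasure \<mu> {..0} = 0"
    unfolding e by (subst emeasure_compl) (auto simp: mu_pos mu.emeasure_space_1[simplified])
  then show ?thesis by (simp add: F_def cdf_def measure_def)
qed

lemma F_pos: "0 < F x \<Longrightarrow> 0 < x"
  using F_mono[of x 0] F_0 by (cases "x \<le> 0") auto

text \<open>Since \<open>F\<close> is continuous, this is the probability integral transform. It replaces
  integrals over an arrival time by integrals over \<open>{0..1}\<close>.\<close>

lemma distr_F: "distr \<mu> borel F = uniform_measure lborel {0..1}"
proof (rule cdf_unique)
  show "real_distribution (distr \<mu> borel F)" by (rule mu.real_distribution_distr) simp
  show "real_distribution (uniform_measure lborel {0..1::real})"
    by (auto intro!: prob_space_uniform_measure simp: real_distribution_def real_distribution_axioms_def)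
  have eq: "measure \<mu> {x. F x \<le> y} = y" if y: "0 < y" "y < 1" for y
  proof -
    obtain l where l: "F l < y"
      using order_tendstoD(2)[OF mu.cdf_lim_at_bot, of y] y unfolding F_def
      by (metis eventually_at_bot_linorder order_refl)
    obtain h where h: "y < F h"
      using order_tendstoD(1)[OF mu.cdf_lim_at_top_prob, of y] y unfolding F_def
      by (metis eventually_at_top_linorder order_refl)
    have lh: "l \<le> h" using l h F_mono[of h l] by (cases "l \<le> h") auto
    define A where "A = {x. F x \<le> y}"
    have bdd: "bdd_above A" unfolding A_def using h F_mono
      by (intro bdd_aboveI[of _ h]) (metis linorder_le_cases mem_Collect_eq not_less order_trans)
    have "l \<in> A" using l by (simp add: A_def)
    have clA: "closed A"
    proof -
      have "A = F -` {..y}" by (auto simp: A_def)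
      then show ?thesis using F_cont by (metis closed_atMost continuous_at_imp_continuous_on continuous_closed_vimage)
    qed
    have SA: "Sup A \<in> A" using closed_contains_Sup[of A] bdd clA \<open>l \<in> A\<close> by auto
    have A_eq: "A = {..Sup A}"
    proof (intro set_eqI iffI)
      fix x assume "x \<in> A" then show "x \<in> {..Sup A}" using bdd by (simp add: cSup_upper)
    next
      fix x assume "x \<in> {..Sup A}" then show "x \<in> A" using SA F_mono[of x "Sup A"] by (auto simp: A_def)
    qed
    obtain x where x: "F x = y" using IVT[of F l y h] l h lh F_cont by auto
    then have "x \<in> A" by (simp add: A_def)
    then have "x \<le> Sup A" using A_eq by auto
    then have "F (Sup A) = y" using SA F_mono[of x "Sup A"] x by (auto simp: A_def)
    then show ?thesis unfolding A_def[symmetric] by (subst A_eq) (simp add: F_def cdf_def)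
  qed
  show "cdf (distr \<mu> borel F) = cdf (uniform_measure lborel {0..1})"
  proof
    fix y :: real
    have L: "cdf (distr \<mu> borel F) y = measure \<mu> {x. F x \<le> y}"
      unfolding cdf_def by (subst measure_distr) (auto simp: vimage_def)
    have R: "cdf (uniform_measure lborel {0..1}) y = (if y \<le> 0 then 0 else if y < 1 then y else 1)"
    proof -
      have i: "{0..1} \<inter> {..y} = (if y < 0 then {} else if y < 1 then {0..y} else {0..1::real})" by auto
      show ?thesis unfolding cdf_def by (subst measure_uniform_measure) (auto simp: i)
    qed
    consider "y \<le> 0" | "0 < y" "y < 1" | "1 \<le> y" by linarith
    then show "cdf (distr \<mu> borel F) y = cdf (uniform_measure lborel {0..1}) y"
    proof cases
      case 1
      have le: "measure \<mu> {x. F x \<le> y} \<le> e" if "0 < e" "e < 1" for e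
      proof -
        have "{x. F x \<le> e} \<in> sets \<mu>" by simp
        then have "measure \<mu> {x. F x \<le> y} \<le> measure \<mu> {x. F x \<le> e}"
          by (intro mu.finite_measure_mono) (use 1 that in auto)
        then show ?thesis using eq[OF that] by simp
      qed
      have "measure \<mu> {x. F x \<le> y} \<le> 0"
      proof (rule ccontr)
        assume n: "\<not> measure \<mu> {x. F x \<le> y} \<le> 0"
        have "measure \<mu> {x. F x \<le> y} \<le> 1" by (rule mu.prob_le_1)
        then have "0 < measure \<mu> {x. F x \<le> y} / 2" "measure \<mu> {x. F x \<le> y} / 2 < 1"
          using n by linarith+
        from le[OF this] show False using n by linarith
      qed
      then show ?thesis unfolding L R using 1 measure_nonneg[of \<mu> "{x. F x \<le> y}"] by auto
    next
      case 2 then show ?thesis unfolding L R by (simp add: eq)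
    next
      case 3
      then have "F x \<le> y" for x using F_le1[of x] by linarith
      then have "{x. F x \<le> y} = space \<mu>" by simp
      then show ?thesis unfolding L R using 3 mu.prob_space by auto
    qed
  qed
qed

lemma nn_integral_F:
  assumes [measurable]: "g \<in> borel_measurable borel"
  shows "(\<integral>\<^sup>+y. g (F y) \<partial>\<mu>) = (\<integral>\<^sup>+u. g u * indicator {0..1} u \<partial>lborel)"
proof -
  have "(\<integral>\<^sup>+y. g (F y) \<partial>\<mu>) = (\<integral>\<^sup>+u. g u \<partial>distr \<mu> borel F)"
    by (subst nn_integral_distr) auto
  also have "\<dots> = (\<integral>\<^sup>+u. g u * indicator {0..1} u \<partial>lborel) / emeasure lborel {0..1::real}"
    unfolding distr_F by (rule nn_integral_uniform_measure) auto
  finally show ?thesis by (simp add: divide_ennreal_def)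
qed

lemma AE_F_pos: "AE y in \<mu>. 0 < F y"
proof -
  have "(\<integral>\<^sup>+y. indicator {..0} (F y) \<partial>\<mu>) = (\<integral>\<^sup>+u. indicator {..0} u * indicator {0..1::real} u \<partial>lborel)"
    by (rule nn_integral_F[of "indicator {..0}"]) auto
  also have "\<dots> = (\<integral>\<^sup>+u. indicator {0::real} u \<partial>lborel)"
    by (intro nn_integral_cong) (auto split: split_indicator)
  finally have "(\<integral>\<^sup>+y. indicator {..0} (F y) \<partial>\<mu>) = 0" by simp
  then have "AE y in \<mu>. indicator {..0} (F y) = (0::ennreal)" by (subst (asm) nn_integral_0_iff_AE) auto
  then show ?thesis by eventually_elim (auto split: split_indicator_asm)
qed

lemma AE_neq: "AE y in \<mu>. y \<noteq> c"
  by (rule AE_I[where N="{c}"]) (auto simp: atomless)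

text \<open>One jump replaces the time \<open>x\<close> by an independent time below \<open>x\<close>; a weight \<open>F powr a\<close>
  then gains the factor \<open>1 / (a + 1)\<close>, besides the factor \<open>F x\<close> that is the probability of a
  smaller time.\<close>

lemma nn_integral_F_powr:
  assumes "-1 < a"
  shows "(\<integral>\<^sup>+y. indicator {..<x} y * ennreal (F y powr a) \<partial>\<mu>) \<le> ennreal (F x powr (a + 1) / (a + 1))"
proof -
  have "(\<integral>\<^sup>+y. indicator {..<x} y * ennreal (F y powr a) \<partial>\<mu>)
      \<le> (\<integral>\<^sup>+y. indicator {..F x} (F y) * ennreal (F y powr a) \<partial>\<mu>)"
    by (intro nn_integral_mono mult_right_mono) (auto split: split_indicator intro: F_mono)
  also have "\<dots> = (\<integral>\<^sup>+u. indicator {..F x} u * ennreal (u powr a) * indicator {0..1} u \<partial>lborel)"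
    by (rule nn_integral_F[of "\<lambda>u. indicator {..F x} u * ennreal (u powr a)"]) auto
  also have "\<dots> = (\<integral>\<^sup>+u. ennreal (indicator {0..F x} u * u powr a) \<partial>lborel)"
    by (intro nn_integral_cong) (auto split: split_indicator dest: order_trans[OF _ F_le1])
  also have "\<dots> = ennreal (F x powr (a + 1) / (a + 1))"
    using assms by (intro nn_integral_has_integral_lebesgue has_integral_powr_from_0) auto
  finally show ?thesis .
qed

section \<open>Resampling independent times\<close>

abbreviation P :: "('v \<Rightarrow> real) measure" where "P \<equiv> PiM UNIV (\<lambda>_. \<mu>)"

abbreviation tau :: "('v \<Rightarrow> real) \<Rightarrow> 'v \<Rightarrow> real" where "tau \<equiv> with_seeds r s"

sublocale P: product_prob_space "\<lambda>_. \<mu>" UNIV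
  by (rule product_prob_spaceI) (rule prob_mu)

lemma space_P [simp]: "space P = UNIV" by (simp add: space_PiM)

lemma prob_P: "prob_space P" by (rule P.prob_space_axioms)

lemma comp_measurable [measurable]: "(\<lambda>t. t v) \<in> borel_measurable P"
  using measurable_component_singleton[of v UNIV "\<lambda>_. \<mu>"] measurable_cong_sets[OF refl sets_mu] by blast

definition resample :: "'v set \<Rightarrow> ('v \<Rightarrow> real) \<Rightarrow> ('v \<Rightarrow> real) \<Rightarrow> 'v \<Rightarrow> real" where
  "resample S t t' = (\<lambda>v. if v \<in> S then t v else t' v)"

lemma resample_measurable [measurable]: "(\<lambda>(t, t'). resample S t t') \<in> P \<Otimes>\<^sub>M P \<rightarrow>\<^sub>M P"
  unfolding resample_def
  by (rule measurable_PiM_single') (auto simp: split_beta' intro!: measurable_compose[OF measurable_fst] measurable_compose[OF measurable_snd] measurable_component_singleton)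

lemma resample_measurable2 [measurable]: "(\<lambda>t'. resample S t t') \<in> P \<rightarrow>\<^sub>M P"
  unfolding resample_def
  by (rule measurable_PiM_single') (auto intro!: measurable_component_singleton)

lemma resample_in: "v \<in> S \<Longrightarrow> resample S t t' v = t v" and resample_out: "v \<notin> S \<Longrightarrow> resample S t t' v = t' v"
  by (simp_all add: resample_def)

lemma resample_resample: "S \<subseteq> S' \<Longrightarrow> resample S t (resample S' t1 t2) = resample S' (resample S t t1) t2"
  by (auto simp: resample_def fun_eq_iff)

text \<open>This is independence: the times in \<open>S\<close> and those outside of \<open>S\<close> may be taken from two
  independent copies. It plays the role of conditioning on the times in \<open>S\<close>.\<close>

lemma distr_resample: "distr (P \<Otimes>\<^sub>M P) P (\<lambda>(t, t'). resample S t t') = P"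
proof (rule P.PiM_eq)
  interpret PP: pair_prob_space P P ..
  fix J :: "'v set" and A
  assume J: "finite J" and A: "\<And>j. j \<in> J \<Longrightarrow> A j \<in> sets \<mu>"
  let ?C = "\<lambda>I. prod_emb UNIV (\<lambda>_. \<mu>) I (Pi\<^sub>E I A)"
  have C: "?C I \<in> sets P" if "I \<subseteq> J" for I
    using that J A by (intro sets_PiM_I) (auto intro: finite_subset)
  have e: "(\<lambda>(t, t'). resample S t t') -` ?C J \<inter> space (P \<Otimes>\<^sub>M P) = ?C (J \<inter> S) \<times> ?C (J - S)"
    by (auto simp: prod_emb_def space_pair_measure resample_def PiE_iff restrict_def extensional_def split: if_splits)
  have "emeasure (distr (P \<Otimes>\<^sub>M P) P (\<lambda>(t, t'). resample S t t')) (?C J) = emeasure (P \<Otimes>\<^sub>M P) (?C (J \<inter> S) \<times> ?C (J - S))"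
    by (subst emeasure_distr) (auto simp: e C)
  also have "\<dots> = emeasure P (?C (J \<inter> S)) * emeasure P (?C (J - S))"
    by (intro P.emeasure_pair_measure_Times C) auto
  also have "\<dots> = (\<Prod>j\<in>J \<inter> S. emeasure \<mu> (A j)) * (\<Prod>j\<in>J - S. emeasure \<mu> (A j))"
    by (intro arg_cong2[where f="(*)"] P.emeasure_PiM_emb) (use J A in auto)
  also have "\<dots> = (\<Prod>j\<in>J. emeasure \<mu> (A j))"
    using J by (subst prod.union_disjoint[symmetric]) (auto simp: Int_Diff_Un)
  finally show "emeasure (distr (P \<Otimes>\<^sub>M P) P (\<lambda>(t, t'). resample S t t')) (?C J) = (\<Prod>j\<in>J. emeasure \<mu> (A j))" .
qed simp

lemma nn_resample:
  assumes [measurable]: "f \<in> borel_measurable P"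
  shows "(\<integral>\<^sup>+t. f t \<partial>P) = (\<integral>\<^sup>+t. \<integral>\<^sup>+t'. f (resample S t t') \<partial>P \<partial>P)"
proof -
  have "(\<integral>\<^sup>+t. f t \<partial>P) = (\<integral>\<^sup>+t. f t \<partial>distr (P \<Otimes>\<^sub>M P) P (\<lambda>(t, t'). resample S t t'))"
    unfolding distr_resample ..
  also have "\<dots> = (\<integral>\<^sup>+x. f (case x of (t, t') \<Rightarrow> resample S t t') \<partial>(P \<Otimes>\<^sub>M P))"
    by (rule nn_integral_distr) auto
  also have "\<dots> = (\<integral>\<^sup>+t. \<integral>\<^sup>+t'. f (resample S t t') \<partial>P \<partial>P)"
    by (subst P.nn_integral_fst[symmetric]) (auto simp: split_beta')
  finally show ?thesis .
qed

lemma nn_component: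
  assumes [measurable]: "g \<in> borel_measurable borel"
  shows "(\<integral>\<^sup>+t. g (t z) \<partial>P) = (\<integral>\<^sup>+y. g y \<partial>\<mu>)"
proof -
  have "(\<integral>\<^sup>+y. g y \<partial>\<mu>) = (\<integral>\<^sup>+y. g y \<partial>distr P \<mu> (\<lambda>t. t z))" by (simp add: P.PiM_component)
  also have "\<dots> = (\<integral>\<^sup>+t. g (t z) \<partial>P)"
    by (subst nn_integral_distr) (auto simp: sets_mu cong: measurable_cong_sets intro!: measurable_component_singleton)
  finally show ?thesis ..
qed

lemma AE_component: "AE y in \<mu>. Q y \<Longrightarrow> AE t in P. Q (t v)"
  by (rule P.AE_component) auto

lemma tau_measurable [measurable]: "(\<lambda>t. tau t v) \<in> borel_measurable P"
  unfolding with_seeds_def by simp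

lemma tau_less_pred [measurable]: "Measurable.pred P (\<lambda>t. tau t u < tau t v)"
  by (rule borel_measurable_pred_less[OF tau_measurable tau_measurable])

lemma tau_le_pred [measurable]: "Measurable.pred P (\<lambda>t. tau t u \<le> tau t v)"
  using tau_less_pred[of v u] by (simp add: not_less[symmetric] del: not_less)

lemma tau_nonseed: "v \<notin> {r, s} \<Longrightarrow> tau t v = t v" by (simp add: with_seeds_def)

lemma tau_resample_in: "v \<in> S \<Longrightarrow> tau (resample S t t') v = tau t v"
  by (simp add: with_seeds_def resample_def)

lemma late_measurable: "finite A \<Longrightarrow> {t. \<forall>u\<in>A. c \<le> tau t u} \<in> sets P"
proof -
  assume A: "finite A"
  have "Measurable.pred P (\<lambda>t. \<forall>u\<in>A. c \<le> tau t u)"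
    by (intro pred_intros_finite A) measurable
  then show ?thesis by (simp add: pred_def)
qed

lemma emeasure_late:
  assumes A: "finite A" and c: "0 < c"
  shows "emeasure P {t. \<forall>u\<in>A. c \<le> tau t u} \<le> ennreal ((1 - F c) ^ card A)"
proof (cases "A \<inter> {r, s} = {}")
  case True
  then have "{t. \<forall>u\<in>A. c \<le> tau t u} = {t \<in> space P. \<forall>u\<in>A. t u \<in> {c..}}" by (auto simp: with_seeds_def)
  then have "emeasure P {t. \<forall>u\<in>A. c \<le> tau t u} = emeasure P {t \<in> space P. \<forall>u\<in>A. t u \<in> {c..}}" by simp
  also have "\<dots> = (\<Prod>u\<in>A. emeasure \<mu> {c..})"
    by (rule P.emeasure_PiM_Collect) (use A in auto)
  also have "\<dots> = ennreal ((1 - F c) ^ card A)" by (simp add: emeasure_ge ennreal_power)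
  finally show ?thesis by simp
next
  case False
  then have "{t. \<forall>u\<in>A. c \<le> tau t u} = {}" using c by (auto simp: with_seeds_def)
  then show ?thesis by (metis emeasure_empty zero_le)
qed

lemma nn_late:
  assumes [measurable]: "g \<in> borel_measurable borel" and A: "finite A" "z \<notin> A" and c: "0 < c"
  shows "(\<integral>\<^sup>+t. g (t z) * indicator {t. \<forall>u\<in>A. c \<le> tau t u} t \<partial>P) \<le> (\<integral>\<^sup>+y. g y \<partial>\<mu>) * ennreal ((1 - F c) ^ card A)"
proof -
  note [measurable] = late_measurable[OF A(1)]
  have i: "indicator {t. \<forall>u\<in>A. c \<le> tau t u} (resample {z} t t') = (indicator {t. \<forall>u\<in>A. c \<le> tau t u} t' :: ennreal)" for t t'
  proof -
    have "tau (resample {z} t t') u = tau t' u" if "u \<in> A" for u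
      using that A(2) by (auto simp: with_seeds_def resample_def)
    then have "(\<forall>u\<in>A. c \<le> tau (resample {z} t t') u) \<longleftrightarrow> (\<forall>u\<in>A. c \<le> tau t' u)" by simp
    then show ?thesis unfolding indicator_def mem_Collect_eq by presburger
  qed
  let ?f = "\<lambda>t. g (t z) * indicator {t. \<forall>u\<in>A. c \<le> tau t u} t"
  have m: "?f \<in> borel_measurable P" by measurable
  have "(\<integral>\<^sup>+t. ?f t \<partial>P) = (\<integral>\<^sup>+t. \<integral>\<^sup>+t'. ?f (resample {z} t t') \<partial>P \<partial>P)"
    by (rule nn_resample[OF m])
  also have "\<dots> = (\<integral>\<^sup>+t. \<integral>\<^sup>+t'. g (t z) * indicator {t. \<forall>u\<in>A. c \<le> tau t u} t' \<partial>P \<partial>P)"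
    unfolding i by (simp only: resample_in[OF singletonI])
  also have "\<dots> = (\<integral>\<^sup>+t. g (t z) * emeasure P {t. \<forall>u\<in>A. c \<le> tau t u} \<partial>P)"
    by (intro nn_integral_cong) (simp only: nn_integral_cmult_indicator late_measurable[OF A(1)])
  also have "\<dots> = (\<integral>\<^sup>+y. g y \<partial>\<mu>) * emeasure P {t. \<forall>u\<in>A. c \<le> tau t u}"
    by (subst nn_integral_multc) (simp_all add: nn_component)
  also have "\<dots> \<le> (\<integral>\<^sup>+y. g y \<partial>\<mu>) * ennreal ((1 - F c) ^ card A)"
    by (intro mult_left_mono emeasure_late A c) auto
  finally show ?thesis .
qed

section \<open>One ancestral step\<close>

definition cand :: "('v \<Rightarrow> real) \<Rightarrow> 'v \<Rightarrow> 'v set" where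
  "cand t x = parent_candidates E UNIV (tau t) x"

lemma cand_iff: "z \<in> cand t x \<longleftrightarrow> tau t z < tau t x \<and> (\<forall>u\<in>{u. d x u < d x z}. tau t x \<le> tau t u)"
proof
  assume "z \<in> cand t x"
  then have "tau t z < tau t x" "\<And>u. tau t u < tau t x \<Longrightarrow> d x z \<le> d x u"
    by (auto simp: cand_def parent_candidates_def)
  then show "tau t z < tau t x \<and> (\<forall>u\<in>{u. d x u < d x z}. tau t x \<le> tau t u)"
    by (metis linorder_not_le mem_Collect_eq)
next
  assume "tau t z < tau t x \<and> (\<forall>u\<in>{u. d x u < d x z}. tau t x \<le> tau t u)"
  then show "z \<in> cand t x" by (auto simp: cand_def parent_candidates_def not_less[symmetric])
qed

lemma finite_lt_ball: "finite {u. d x u < n}"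
  by (rule finite_subset[OF _ finite_gball[of x n]]) (auto simp: gball_def)

lemma cand_measurable [measurable]: "Measurable.pred P (\<lambda>t. z \<in> cand t x)"
  unfolding cand_iff by (intro pred_intros_logic pred_intros_finite finite_lt_ball tau_less_pred tau_le_pred)

lemma nn_count_measurable:
  assumes "\<And>z. f z \<in> borel_measurable P"
  shows "(\<lambda>t. \<integral>\<^sup>+z. f z t \<partial>count_space (UNIV :: 'v set)) \<in> borel_measurable P"
proof -
  interpret sigma_finite_measure "count_space (UNIV :: 'v set)"
    by (rule sigma_finite_measure_count_space_countable[OF countable_UNIV])
  have "(\<lambda>(z, t). f z t) \<in> borel_measurable (count_space UNIV \<Otimes>\<^sub>M P)"
    by (rule measurable_pair_measure_countable1[OF countable_UNIV]) (use assms in simp)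
  then have "(\<lambda>(t, z). f z t) \<in> borel_measurable (P \<Otimes>\<^sub>M count_space UNIV)"
    by (subst measurable_pair_swap_iff) (simp add: split_beta')
  then show ?thesis by (rule borel_measurable_nn_integral)
qed

text \<open>A lower bound for the number of vertices of one branch at \<open>x\<close> that are closer to \<open>x\<close>
  than distance \<open>n\<close>, namely the number of those at distance \<open>n - 1\<close>.\<close>

definition fresh_card :: "nat \<Rightarrow> nat" where "fresh_card n = (if n < 2 then 0 else K ^ (n - 2))"

lemma ex_fresh_set:
  assumes "E x c"
  obtains A where "finite A" "A \<subseteq> branch x c" "\<And>u. u \<in> A \<Longrightarrow> d x u < n" "card A = fresh_card n"
proof (cases "n < 2")
  case True then show ?thesis using that[of "{}"] by (auto simp: fresh_card_def)
next
  case False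
  then obtain k where n: "n = Suc (Suc k)" by (metis less_2_cases_iff not0_implies_Suc numeral_nat(7) not_less_eq)
  show ?thesis
    by (rule that[of "branch x c \<inter> sph x (Suc k)"])
      (use card_branch_sphere[OF assms, of k] n in \<open>auto simp: fresh_card_def sph_def\<close>)
qed

text \<open>A candidate \<open>z\<close> of \<open>x\<close> has an earlier time than \<open>x\<close>, while all vertices closer to \<open>x\<close>
  than \<open>z\<close> are late. Among the latter are at least \<open>fresh_card (d x z)\<close> vertices of the fresh
  branch, whose times are independent of the known times in \<open>S\<close> and of the time of \<open>z\<close>. After the
  jump, the known times are those of \<open>S\<close>, of \<open>z\<close> and of the vertices closer to \<open>x\<close> than \<open>z\<close>; \<open>B\<close>
  bounds the expectation of the remaining functional \<open>H\<close> given these times.\<close>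

lemma one_step:
  assumes [measurable]: "\<And>z. H z \<in> borel_measurable P" "\<And>z. B z \<in> borel_measurable borel"
    and x: "x \<in> S" "x \<notin> {r, s}" "0 < t x" and c: "E x c" "branch x c \<inter> S = {}"
    and Al: "\<And>z. z \<in> Al \<Longrightarrow> z \<notin> S \<and> z \<notin> {r, s}"
    and N: "\<And>z. AE y in \<mu>. N z y"
    and HB: "\<And>z T. z \<in> Al \<Longrightarrow> (\<And>v. v \<in> S \<Longrightarrow> T v = t v) \<Longrightarrow> N z (T z) \<Longrightarrow> T z < t x \<Longrightarrow>
       (\<And>u. d x u < d x z \<Longrightarrow> t x \<le> tau T u) \<Longrightarrow>
       (\<integral>\<^sup>+t'. H z (resample (insert z (S \<union> {u. d x u < d x z})) T t') \<partial>P) \<le> B z (T z)"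
  shows "(\<integral>\<^sup>+t'. (\<integral>\<^sup>+z. indicator {z \<in> Al. z \<in> cand (resample S t t') x} z * H z (resample S t t') \<partial>count_space UNIV) \<partial>P)
   \<le> (\<integral>\<^sup>+z. indicator Al z * ((\<integral>\<^sup>+y. indicator {..<t x} y * B z y \<partial>\<mu>) * ennreal ((1 - F (t x)) ^ fresh_card (d x z))) \<partial>count_space UNIV)"
proof -
  have mi [measurable]: "(\<lambda>t. indicator {z \<in> Al. z \<in> cand t x} z * H z t) \<in> borel_measurable P" for z
  proof -
    have "(\<lambda>t. indicator {z \<in> Al. z \<in> cand t x} z :: ennreal) = (\<lambda>t. if z \<in> Al \<and> z \<in> cand t x then 1 else 0)"
      by auto
    then show ?thesis by simp
  qed
  have "(\<integral>\<^sup>+t'. (\<integral>\<^sup>+z. indicator {z \<in> Al. z \<in> cand (resample S t t') x} z * H z (resample S t t') \<partial>count_space UNIV) \<partial>P)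
    = (\<integral>\<^sup>+z. (\<integral>\<^sup>+t'. indicator {z \<in> Al. z \<in> cand (resample S t t') x} z * H z (resample S t t') \<partial>P) \<partial>count_space UNIV)"
    by (rule nn_integral_count_space_nn_integral[OF countable_UNIV])
      (use measurable_compose[OF resample_measurable2 mi] in simp)
  also have "\<dots> \<le> (\<integral>\<^sup>+z. indicator Al z * ((\<integral>\<^sup>+y. indicator {..<t x} y * B z y \<partial>\<mu>) * ennreal ((1 - F (t x)) ^ fresh_card (d x z))) \<partial>count_space UNIV)"
  proof (intro nn_integral_mono)
    fix z
    show "(\<integral>\<^sup>+t'. indicator {z \<in> Al. z \<in> cand (resample S t t') x} z * H z (resample S t t') \<partial>P)
      \<le> indicator Al z * ((\<integral>\<^sup>+y. indicator {..<t x} y * B z y \<partial>\<mu>) * ennreal ((1 - F (t x)) ^ fresh_card (d x z)))"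
    proof (cases "z \<in> Al")
      case True
      define Sz where "Sz = insert z (S \<union> {u. d x u < d x z})"
      have z: "z \<notin> S" "z \<notin> {r, s}" using Al True by auto
      obtain A where A: "finite A" "A \<subseteq> branch x c" "\<And>u. u \<in> A \<Longrightarrow> d x u < d x z" "card A = fresh_card (d x z)"
        using ex_fresh_set[OF c(1)] by blast
      have "z \<notin> A" using A(3) by blast
      let ?f = "\<lambda>t. indicator {z \<in> Al. z \<in> cand t x} z * H z t"
      let ?g = "\<lambda>t1. (indicator {..<t x} (t1 z) * B z (t1 z)) * indicator {T. \<forall>u\<in>A. t x \<le> tau T u} t1"
      have f_meas: "(\<lambda>t'. ?f (resample S t t')) \<in> borel_measurable P" using measurable_compose[OF resample_measurable2 mi] by simp
      have "(\<integral>\<^sup>+t'. ?f (resample S t t') \<partial>P) = (\<integral>\<^sup>+t1. \<integral>\<^sup>+t2. ?f (resample S t (resample Sz t1 t2)) \<partial>P \<partial>P)"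
        by (rule nn_resample[OF f_meas])
      also have "\<dots> = (\<integral>\<^sup>+t1. \<integral>\<^sup>+t2. ?f (resample Sz (resample S t t1) t2) \<partial>P \<partial>P)"
        using resample_resample[of S Sz t] by (simp add: Sz_def subset_insertI2)
      also have "\<dots> \<le> (\<integral>\<^sup>+t1. ?g t1 \<partial>P)"
      proof (rule nn_integral_mono_AE)
        show "AE t1 in P. (\<integral>\<^sup>+t2. ?f (resample Sz (resample S t t1) t2) \<partial>P) \<le> ?g t1"
          using AE_component[OF N[of z], of z]
        proof eventually_elim
          fix t1 assume N1: "N z (t1 z)"
          define T where "T = resample S t t1"
          have Tz: "T z = t1 z" using z by (simp add: T_def resample_out)
          have Tx: "tau T x = t x" using x by (simp add: T_def tau_nonseed resample_in)
          have inSz: "tau (resample Sz T t2) u = tau T u" if "u \<in> Sz" for u t2 using that by (rule tau_resample_in)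
          have xz: "x \<in> Sz" "z \<in> Sz" using x by (auto simp: Sz_def)
          have cd: "z \<in> cand (resample Sz T t2) x \<longleftrightarrow> t1 z < t x \<and> (\<forall>u\<in>{u. d x u < d x z}. t x \<le> tau T u)" for t2
            unfolding cand_iff using inSz[OF xz(1)] inSz[OF xz(2)] inSz Tx Tz z tau_nonseed[of z T]
            by (auto simp: Sz_def)
          show "(\<integral>\<^sup>+t2. ?f (resample Sz (resample S t t1) t2) \<partial>P) \<le> ?g t1"
          proof (cases "t1 z < t x \<and> (\<forall>u\<in>{u. d x u < d x z}. t x \<le> tau T u)")
            case False
            then have "(\<integral>\<^sup>+t2. ?f (resample Sz T t2) \<partial>P) = (\<integral>\<^sup>+t2. 0 \<partial>P)"
              by (intro nn_integral_cong) (use cd in auto)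
            then show ?thesis unfolding T_def[symmetric] by simp
          next
            case ok: True
            have "(\<integral>\<^sup>+t2. ?f (resample Sz T t2) \<partial>P) \<le> (\<integral>\<^sup>+t2. H z (resample Sz T t2) \<partial>P)"
              by (intro nn_integral_mono) (auto split: split_indicator)
            also have "\<dots> \<le> B z (T z)" unfolding Sz_def
              by (rule HB[OF True]) (use ok N1 Tz in \<open>auto simp: T_def resample_in\<close>)
            also have "\<dots> = ?g t1"
            proof -
              have "t x \<le> tau t1 u" if "u \<in> A" for u
              proof -
                have "u \<notin> S" using that A(2) c(2) by blast
                then have "tau T u = tau t1 u" by (simp add: T_def with_seeds_def resample_def)
                then show ?thesis using ok A(3)[OF that] by auto
              qed
              then have "indicator {T. \<forall>u\<in>A. t x \<le> tau T u} t1 = (1 :: ennreal)"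
                by (intro indicator_simps(1)) blast
              then show ?thesis using ok Tz by simp
            qed
            finally show ?thesis unfolding T_def .
          qed
        qed
      qed
      also have "\<dots> \<le> (\<integral>\<^sup>+y. indicator {..<t x} y * B z y \<partial>\<mu>) * ennreal ((1 - F (t x)) ^ card A)"
        by (rule nn_late) (use A \<open>z \<notin> A\<close> x in auto)
      finally show ?thesis using True A(4) by simp
    qed simp
  qed
  finally show ?thesis .
qed

lemma emeasure_P_UNIV [simp]: "emeasure P UNIV = 1"
  by (metis P.emeasure_space_1 space_P)

section \<open>Numerical estimates\<close>

lemma exp_decay: "y > 0 \<Longrightarrow> exp (- y) \<le> 4 / y\<^sup>2" for y :: real
proof -
  assume y: "y > 0"
  have "y / 2 \<le> exp (y / 2)" using exp_ge_add_one_self[of "y / 2"] by linarith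
  then have "(y / 2)\<^sup>2 \<le> (exp (y / 2))\<^sup>2" using y by (intro power_mono) auto
  also have "(exp (y / 2))\<^sup>2 = exp y" by (simp add: power2_eq_square exp_add[symmetric])
  finally have "y\<^sup>2 / 4 \<le> exp y" by (simp add: power2_eq_square)
  then show ?thesis using y by (simp add: exp_minus field_simps)
qed

lemma power_le_exp: "0 \<le> p \<Longrightarrow> p \<le> 1 \<Longrightarrow> (1 - p) ^ n \<le> exp (- (real n * p))" for p :: real
proof -
  assume p: "0 \<le> p" "p \<le> 1"
  have "(1 - p) ^ n \<le> (exp (- p)) ^ n" using p exp_ge_add_one_self[of "- p"] by (intro power_mono) auto
  also have "\<dots> = exp (- (real n * p))" by (simp add: exp_of_nat_mult[symmetric])
  finally show ?thesis .
qed

lemma fresh_card_real: "\<not> n < 2 \<Longrightarrow> real (fresh_card n) = real K ^ n / real K ^ 2"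
proof -
  assume n: "\<not> n < 2"
  then have "n = (n - 2) + 2" by simp
  then have "real K ^ n = real K ^ (n - 2) * real K ^ 2" by (metis power_add)
  then show ?thesis using n K2 by (simp add: fresh_card_def)
qed

text \<open>The bound \<open>4 * K ^ 4\<close> comes from \<open>exp (- y) \<le> 4 / y\<^sup>2\<close> with
  \<open>y = p * K ^ n / K\<^sup>2\<close>.\<close>

lemma fresh_card_decay:
  assumes p: "0 < p" "p \<le> 1"
  shows "p * real K ^ n * (1 - p) ^ fresh_card n \<le> 4 * real K ^ 4 * min (p * real K ^ n) (1 / (p * real K ^ n))"
proof -
  let ?u = "p * real K ^ n"
  have K: "1 \<le> real K" "0 < real K" using K2 by auto
  have u: "0 < ?u" using p K by simp
  have K4: "1 \<le> 4 * real K ^ 4" using K one_le_power[of "real K" 4] by linarith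
  have pw: "(1 - p) ^ fresh_card n \<le> 1" using p by (intro power_le_one) auto
  have 1: "?u * (1 - p) ^ fresh_card n \<le> 4 * real K ^ 4 * ?u"
  proof -
    have "?u * (1 - p) ^ fresh_card n \<le> ?u * 1" using u pw by (intro mult_left_mono) auto
    also have "\<dots> \<le> 4 * real K ^ 4 * ?u" using K4 u mult_right_mono[of 1 "4 * real K ^ 4" ?u] by linarith
    finally show ?thesis .
  qed
  have 2: "(1 - p) ^ fresh_card n \<le> 4 * real K ^ 4 * (1 / ?u\<^sup>2)"
  proof (cases "n < 2")
    case True
    have "?u \<le> 1 * real K ^ 2" using p True K by (intro mult_mono power_increasing) auto
    then have "?u\<^sup>2 \<le> (real K ^ 2)\<^sup>2" using u by (intro power_mono) auto
    then have "?u\<^sup>2 \<le> real K ^ 4" by (simp add: power_mult[symmetric])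
    moreover have "0 \<le> real K ^ 4" by simp
    ultimately have "?u\<^sup>2 \<le> 4 * real K ^ 4" by linarith
    moreover have "0 < ?u\<^sup>2" using u by (rule zero_less_power)
    ultimately have "1 \<le> 4 * real K ^ 4 * (1 / ?u\<^sup>2)"
      by (metis le_divide_eq_1_pos mult.right_neutral times_divide_eq_right)
    then show ?thesis using pw by linarith
  next
    case False
    then have y: "real (fresh_card n) * p = ?u / real K ^ 2"
      using K by (simp add: fresh_card_real)
    have "(1 - p) ^ fresh_card n \<le> exp (- (?u / real K ^ 2))" using power_le_exp[of p "fresh_card n"] p y by simp
    also have "\<dots> \<le> 4 / (?u / real K ^ 2)\<^sup>2" using u K by (intro exp_decay) auto
    also have "\<dots> = 4 * real K ^ 4 * (1 / ?u\<^sup>2)"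
      by (simp add: power_divide power_mult[symmetric])
    finally show ?thesis .
  qed
  have "?u * (1 - p) ^ fresh_card n \<le> ?u * (4 * real K ^ 4 * (1 / ?u\<^sup>2))" using 2 u by (intro mult_left_mono) auto
  also have "\<dots> = 4 * real K ^ 4 * (1 / ?u)" using u by (simp add: power2_eq_square field_simps)
  finally show ?thesis using 1 by (auto simp: min_def)
qed

text \<open>The telescoping function \<open>f\<close> shows that a sequence that at least doubles at every step
  accumulates a bounded amount of \<open>min u (1 / u)\<close>.\<close>

lemma sum_min_bound:
  assumes "0 < p"
  shows "(\<Sum>n<m. min (p * real K ^ n) (1 / (p * real K ^ n))) \<le> 5"
proof -
  define f :: "real \<Rightarrow> real" where "f = (\<lambda>u. if u \<le> 1 then 2 * u else 5 - 2 / u)"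
  define u where "u = (\<lambda>n. p * real K ^ n)"
  have pos: "0 < u n" for n using assms K2 by (simp add: u_def)
  have dbl: "2 * u n \<le> u (Suc n)" for n using pos[of n] K2 mult_right_mono[of 2 "real K" "u n"] by (simp add: u_def algebra_simps)
  have step: "min x (1 / x) \<le> f y - f x" if x: "0 < x" "2 * x \<le> y" for x y
  proof -
    consider "y \<le> 1" | "x \<le> 1" "1 < y" | "1 < x" using that by linarith
    then show ?thesis
    proof cases
      case 1 then show ?thesis using x by (auto simp: f_def min_def)
    next
      case 2
      have "2 / y \<le> 2" using 2 by (simp add: field_simps)
      moreover have "min x (1 / x) \<le> x" by simp
      ultimately show ?thesis using 2 x by (simp add: f_def)
    next
      case 3
      have "2 / y \<le> 2 / (2 * x)" using x 3 by (intro divide_left_mono) auto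
      then have "2 / y \<le> 1 / x" by simp
      moreover have "min x (1 / x) \<le> 1 / x" "2 / x = 1 / x + 1 / x" by simp_all
      ultimately show ?thesis using 3 x by (simp add: f_def)
    qed
  qed
  have "(\<Sum>n<m. min (u n) (1 / u n)) \<le> f (u m) - f (u 0)"
  proof (induction m)
    case (Suc m) then show ?case using step[OF pos dbl, of m] by simp
  qed simp
  also have "\<dots> \<le> 5"
  proof -
    have "2 / x \<le> 2" if "1 < x" for x :: real using that by (simp add: field_simps)
    then have "0 \<le> f x \<and> f x \<le> 5" if "0 < x" for x
      using that by (cases "1 < x") (force simp: f_def)+
    then have "0 \<le> f (u 0)" "f (u m) \<le> 5" using pos by blast+
    then show ?thesis by linarith
  qed
  finally show ?thesis by (simp add: u_def)
qed

text \<open>Up to a constant, an upper bound for the expected number of candidates of a vertex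
  with \<open>F (t x) = p\<close>, when a candidate at distance \<open>n\<close> is weighted by \<open>b ^ n\<close>.\<close>

definition jump_sum :: "real \<Rightarrow> real \<Rightarrow> ennreal" where
  "jump_sum b p = (\<Sum>n. ennreal (p * (real K * b) ^ n * (1 - p) ^ fresh_card n))"

lemma jump_sum_1: assumes p: "0 < p" "p \<le> 1" shows "jump_sum 1 p \<le> ennreal (20 * real K ^ 4)"
  unfolding jump_sum_def
proof (rule suminf_le_const[OF summableI])
  fix m
  have "(\<Sum>n<m. ennreal (p * (real K * 1) ^ n * (1 - p) ^ fresh_card n)) = ennreal (\<Sum>n<m. p * real K ^ n * (1 - p) ^ fresh_card n)"
    using p by (subst sum_ennreal) auto
  also have "\<dots> \<le> ennreal (\<Sum>n<m. 4 * real K ^ 4 * min (p * real K ^ n) (1 / (p * real K ^ n)))"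
    by (intro ennreal_leI sum_mono fresh_card_decay p)
  also have "\<dots> \<le> ennreal (4 * real K ^ 4 * 5)"
    unfolding sum_distrib_left[symmetric] by (intro ennreal_leI mult_left_mono sum_min_bound p) auto
  finally show "(\<Sum>n<m. ennreal (p * (real K * 1) ^ n * (1 - p) ^ fresh_card n)) \<le> ennreal (20 * real K ^ 4)" by simp
qed

text \<open>With \<open>b < 1\<close> the long jumps have a small weight, and the short ones are unlikely for
  small \<open>p\<close>.\<close>

lemma jump_sum_small:
  assumes b: "0 < b" "b < 1" and e: "0 < e"
  obtains p0 where "0 < p0" "p0 \<le> 1" "\<And>p. 0 < p \<Longrightarrow> p \<le> p0 \<Longrightarrow> jump_sum b p \<le> ennreal e"
proof -
  have "(\<lambda>N. 20 * real K ^ 4 * b ^ N) \<longlonglongrightarrow> 20 * real K ^ 4 * 0"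
    by (intro tendsto_mult_left LIMSEQ_power_zero) (use b in simp)
  then have "eventually (\<lambda>N. 20 * real K ^ 4 * b ^ N < e / 2) sequentially"
    by (rule order_tendstoD) (use e in simp)
  then obtain N where N: "20 * real K ^ 4 * b ^ N < e / 2" by (meson eventually_sequentially order_refl)
  define S where "S = (\<Sum>n<N. real K ^ n)"
  have S: "0 \<le> S" by (simp add: S_def sum_nonneg)
  define p0 where "p0 = min 1 (e / (2 * (S + 1)))"
  have p0: "0 < p0" "p0 \<le> 1" using e S by (auto simp: p0_def)
  show thesis
  proof (rule that[OF p0])
    fix p assume p: "0 < p" "p \<le> p0"
    then have p1: "p \<le> 1" using p0 by simp
    have pS: "p * S \<le> e / 2"
    proof -
      have "p * S \<le> (e / (2 * (S + 1))) * (S + 1)" using p S e by (intro mult_mono) (auto simp: p0_def)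
      also have "\<dots> = e / 2" using S by (simp add: field_simps)
      finally show ?thesis .
    qed
    have tm: "p * (real K * b) ^ n * (1 - p) ^ fresh_card n \<le> (if n < N then p * real K ^ n else 0) +
        b ^ N * (4 * real K ^ 4 * min (p * real K ^ n) (1 / (p * real K ^ n)))" for n
    proof (cases "n < N")
      case True
      have "p * real K ^ n * (b ^ n * (1 - p) ^ fresh_card n) \<le> p * real K ^ n * 1"
        using p p1 b by (intro mult_left_mono mult_le_one power_le_one) auto
      moreover have "0 \<le> b ^ N * (4 * real K ^ 4 * min (p * real K ^ n) (1 / (p * real K ^ n)))" using b p by simp
      ultimately show ?thesis using True by (simp add: power_mult_distrib algebra_simps)
    next
      case False
      have "b ^ n * (p * real K ^ n * (1 - p) ^ fresh_card n) \<le> b ^ N * (4 * real K ^ 4 * min (p * real K ^ n) (1 / (p * real K ^ n)))"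
        using False b p p1 by (intro mult_mono power_decreasing fresh_card_decay) auto
      then show ?thesis using False by (simp add: power_mult_distrib algebra_simps)
    qed
    show "jump_sum b p \<le> ennreal e" unfolding jump_sum_def
    proof (rule suminf_le_const[OF summableI])
      fix m
      have "(\<Sum>n<m. ennreal (p * (real K * b) ^ n * (1 - p) ^ fresh_card n)) = ennreal (\<Sum>n<m. p * (real K * b) ^ n * (1 - p) ^ fresh_card n)"
        using p p1 b by (subst sum_ennreal) auto
      also have "\<dots> \<le> ennreal (\<Sum>n<m. (if n < N then p * real K ^ n else 0) +
          b ^ N * (4 * real K ^ 4 * min (p * real K ^ n) (1 / (p * real K ^ n))))"
        by (intro ennreal_leI sum_mono tm)
      also have "\<dots> = ennreal ((\<Sum>n<m. if n < N then p * real K ^ n else 0) +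
          b ^ N * (4 * real K ^ 4 * (\<Sum>n<m. min (p * real K ^ n) (1 / (p * real K ^ n)))))"
        by (simp add: sum.distrib sum_distrib_left)
      also have "\<dots> \<le> ennreal (p * S + b ^ N * (4 * real K ^ 4 * 5))"
      proof (intro ennreal_leI add_mono mult_left_mono sum_min_bound p)
        have "(\<Sum>n<m. if n < N then p * real K ^ n else 0) = (\<Sum>n\<in>{..<m} \<inter> {..<N}. p * real K ^ n)"
          by (simp add: sum.inter_restrict)
        also have "\<dots> \<le> (\<Sum>n<N. p * real K ^ n)" using p by (intro sum_mono2) auto
        finally show "(\<Sum>n<m. if n < N then p * real K ^ n else 0) \<le> p * S" by (simp add: S_def sum_distrib_left)
      qed (use b in auto)
      also have "\<dots> \<le> ennreal e" using N pS by (intro ennreal_leI) (simp add: algebra_simps)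
      finally show "(\<Sum>n<m. ennreal (p * (real K * b) ^ n * (1 - p) ^ fresh_card n)) \<le> ennreal e" .
    qed
  qed
qed

lemma sphere_series:
  assumes b: "0 < b" "b \<le> 1" "4 / 3 \<le> real K * b\<^sup>2" and p: "0 < p" "p \<le> 1"
  shows "(\<integral>\<^sup>+z. ennreal (b ^ d z a) * ennreal (p * (1 - p) ^ fresh_card (d x z)) \<partial>count_space UNIV)
    \<le> ennreal (4 * b ^ d x a) * jump_sum b p"
proof -
  let ?f = "\<lambda>z. ennreal (b ^ d z a) * ennreal (p * (1 - p) ^ fresh_card (d x z))"
  have "(\<integral>\<^sup>+z. ?f z \<partial>count_space UNIV) = (\<integral>\<^sup>+z. (\<Sum>n. ?f z * indicator (sph x n) z) \<partial>count_space UNIV)"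
  proof (intro nn_integral_cong)
    fix z
    have "(\<Sum>n. ?f z * indicator (sph x n) z) = (\<Sum>n\<in>{d x z}. ?f z * indicator (sph x n) z)"
      by (rule suminf_finite) (auto simp: sph_def)
    then show "?f z = (\<Sum>n. ?f z * indicator (sph x n) z)" by (simp add: sph_def)
  qed
  also have "\<dots> = (\<Sum>n. \<integral>\<^sup>+z. ?f z * indicator (sph x n) z \<partial>count_space UNIV)"
    by (rule nn_integral_suminf) simp
  also have "\<dots> \<le> (\<Sum>n. ennreal (4 * b ^ d x a) * ennreal (p * (real K * b) ^ n * (1 - p) ^ fresh_card n))"
  proof (intro suminf_le summableI)
    fix n
    have "(\<integral>\<^sup>+z. ?f z * indicator (sph x n) z \<partial>count_space UNIV) = (\<Sum>z\<in>sph x n. ?f z)"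
      by (subst nn_integral_count_space_indicator[symmetric]) (auto simp: nn_integral_count_space_finite)
    also have "\<dots> = (\<Sum>z\<in>sph x n. ennreal (b ^ d z a * (p * (1 - p) ^ fresh_card n)))"
      using b p by (intro sum.cong) (auto simp: sph_def ennreal_mult)
    also have "\<dots> = ennreal ((\<Sum>z\<in>sph x n. b ^ d z a) * (p * (1 - p) ^ fresh_card n))"
      using b p by (subst sum_ennreal) (auto simp: sum_distrib_right)
    also have "\<dots> \<le> ennreal (4 * K ^ n * b ^ (n + d x a) * (p * (1 - p) ^ fresh_card n))"
      using p by (intro ennreal_leI mult_right_mono sum_sph_bound[OF b]) auto
    also have "\<dots> = ennreal (4 * b ^ d x a) * ennreal (p * (real K * b) ^ n * (1 - p) ^ fresh_card n)"
      using b p by (subst ennreal_mult[symmetric]) (auto simp: power_add power_mult_distrib algebra_simps)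
    finally show "(\<integral>\<^sup>+z. ?f z * indicator (sph x n) z \<partial>count_space UNIV) \<le> \<dots>" .
  qed
  also have "\<dots> = ennreal (4 * b ^ d x a) * jump_sum b p" unfolding jump_sum_def by simp
  finally show ?thesis .
qed

text \<open>Among the factors on the left, \<open>c * p / (a + 1)\<close> is the integral over the new time of
  a weight of size \<open>c\<close> at the old time.\<close>

lemma contraction:
  assumes b: "0 < b" "b \<le> 1" "4 / 3 \<le> real K * b\<^sup>2" and p: "0 < p" "p \<le> 1" and a: "-1 < a" and c: "0 \<le> c"
    and s: "ennreal (4 / (a + 1)) * jump_sum b p \<le> ennreal (1 / 2)"
  shows "(\<integral>\<^sup>+z. ennreal (c / (a + 1) * p * b ^ d z q) * ennreal ((1 - p) ^ fresh_card (d x z)) \<partial>count_space UNIV)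
    \<le> ennreal (c * b ^ d x q / 2)"
proof -
  have "(\<integral>\<^sup>+z. ennreal (c / (a + 1) * p * b ^ d z q) * ennreal ((1 - p) ^ fresh_card (d x z)) \<partial>count_space UNIV)
    = (\<integral>\<^sup>+z. ennreal (c / (a + 1)) * (ennreal (b ^ d z q) * ennreal (p * (1 - p) ^ fresh_card (d x z))) \<partial>count_space UNIV)"
    using a b c p by (intro nn_integral_cong) (auto simp: ennreal_mult[symmetric] algebra_simps)
  also have "\<dots> = ennreal (c / (a + 1)) * (\<integral>\<^sup>+z. ennreal (b ^ d z q) * ennreal (p * (1 - p) ^ fresh_card (d x z)) \<partial>count_space UNIV)"
    by (rule nn_integral_cmult) simp
  also have "\<dots> \<le> ennreal (c / (a + 1)) * (ennreal (4 * b ^ d x q) * jump_sum b p)"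
    by (rule mult_left_mono[OF sphere_series[OF b p]]) simp
  also have "\<dots> = ennreal (c * b ^ d x q) * (ennreal (4 / (a + 1)) * jump_sum b p)"
  proof -
    have "ennreal (c / (a + 1)) * ennreal (4 * b ^ d x q) = ennreal (c * b ^ d x q) * ennreal (4 / (a + 1))"
      using a b c by (simp add: ennreal_mult[symmetric] algebra_simps)
    then show ?thesis by (simp add: mult.assoc[symmetric])
  qed
  also have "\<dots> \<le> ennreal (c * b ^ d x q) * ennreal (1 / 2)" by (intro mult_left_mono s) simp
  also have "\<dots> = ennreal (c * b ^ d x q / 2)" using b c by (subst ennreal_mult[symmetric]) auto
  finally show ?thesis .
qed

section \<open>Expected numbers of candidate paths\<close>

text \<open>The sum, over all paths of \<open>n\<close> successive candidates that start at \<open>x\<close>, then avoid the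
  seeds and only use steps allowed by \<open>ok\<close>, of the weight \<open>w0\<close> at the last vertex.\<close>

primrec cpaths :: "('v \<Rightarrow> 'v \<Rightarrow> bool) \<Rightarrow> ('v \<Rightarrow> ('v \<Rightarrow> real) \<Rightarrow> ennreal) \<Rightarrow> nat \<Rightarrow> 'v \<Rightarrow> ('v \<Rightarrow> real) \<Rightarrow> ennreal" where
  "cpaths ok w0 0 x t = w0 x t"
| "cpaths ok w0 (Suc n) x t =
     (\<integral>\<^sup>+z. indicator {z. z \<in> cand t x \<and> z \<notin> {r, s} \<and> ok x z} z * cpaths ok w0 n z t \<partial>count_space UNIV)"

lemma cand_sum_measurable:
  assumes [measurable]: "\<And>z. f z \<in> borel_measurable P"
  shows "(\<lambda>t. \<integral>\<^sup>+z. indicator {z. z \<in> cand t x \<and> Q z} z * f z t \<partial>count_space UNIV) \<in> borel_measurable P"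
proof (rule nn_count_measurable)
  fix z
  have "(\<lambda>t. indicator {z. z \<in> cand t x \<and> Q z} z :: ennreal) = (\<lambda>t. if z \<in> cand t x \<and> Q z then 1 else 0)" by auto
  then show "(\<lambda>t. indicator {z. z \<in> cand t x \<and> Q z} z * f z t) \<in> borel_measurable P" by simp
qed

lemma cpaths_measurable [measurable]:
  assumes "\<And>x. w0 x \<in> borel_measurable P" shows "cpaths ok w0 n x \<in> borel_measurable P"
proof (induction n arbitrary: x)
  case 0 then show ?case using assms by (simp cong: measurable_cong)
next
  case (Suc n) then show ?case using cand_sum_measurable[of "cpaths ok w0 n" x "\<lambda>z. z \<notin> {r, s} \<and> ok x z"] by simp
qed

text \<open>Each step of the exploration gains a factor \<open>1 / 2\<close> if the paths are weighted by
  \<open>F powr a * b ^ d x m\<close>, whatever the history \<open>D\<close>: the jump lengths are controlled by \<open>jump_sum\<close>,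
  and the time of the next vertex is uniform below the current one. The set \<open>A\<close> holds further
  known times, for instance those of a second path. It must leave some side of the current vertex
  free (\<open>side\<close>), and the vertices of \<open>A\<close> in the region \<open>Rg\<close> of the paths must be late, so that
  they are not candidates.\<close>

lemma cpaths_decay:
  assumes p0: "p0 \<le> 1" and b: "0 < b" "b \<le> 1" "4 / 3 \<le> real K * b\<^sup>2" and a: "-1 < a" and C: "0 \<le> C"
    and sg: "\<And>p. 0 < p \<Longrightarrow> p \<le> p0 \<Longrightarrow> ennreal (4 / (a + 1)) * jump_sum b p \<le> ennreal (1 / 2)"
    and w0 [measurable]: "\<And>x. w0 x \<in> borel_measurable P"
    and ok: "\<And>x z. x \<in> Rg \<Longrightarrow> ok x z \<Longrightarrow> z \<in> Rg"
    and side: "\<And>x. x \<in> Rg \<Longrightarrow> x \<notin> A \<Longrightarrow> \<exists>q. q \<noteq> x \<and> (\<forall>u\<in>A. \<not> bet u x q)"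
    and base: "\<And>x D t. x \<in> Rg \<Longrightarrow> x \<notin> A \<Longrightarrow> history D x \<Longrightarrow> x \<notin> {r, s} \<Longrightarrow> 0 < F (t x) \<Longrightarrow> F (t x) \<le> p0 \<Longrightarrow>
      (\<And>u. u \<in> D \<union> (A \<inter> Rg) \<Longrightarrow> t x \<le> tau t u) \<Longrightarrow>
      (\<integral>\<^sup>+t'. w0 x (resample (insert x (D \<union> A)) t t') \<partial>P) \<le> ennreal (C * F (t x) powr a * b ^ d x m)"
  shows "x \<in> Rg \<Longrightarrow> x \<notin> A \<Longrightarrow> history D x \<Longrightarrow> x \<notin> {r, s} \<Longrightarrow> 0 < F (t x) \<Longrightarrow> F (t x) \<le> p0 \<Longrightarrow>
      (\<And>u. u \<in> D \<union> (A \<inter> Rg) \<Longrightarrow> t x \<le> tau t u) \<Longrightarrow>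
      (\<integral>\<^sup>+t'. cpaths ok w0 n x (resample (insert x (D \<union> A)) t t') \<partial>P) \<le> ennreal ((1 / 2) ^ n * C * F (t x) powr a * b ^ d x m)"
proof (induction n arbitrary: x D t)
  case 0
  show ?case using base[of x D t] 0 by simp
next
  case (Suc n)
  note IH = Suc.IH and prem = Suc.prems
  define S where "S = insert x (D \<union> A)"
  define Al where "Al = {z. z \<notin> S \<and> z \<notin> {r, s} \<and> ok x z}"
  define p where "p = F (t x)"
  define c where "c = (1 / 2) ^ n * C"
  have c: "0 \<le> c" using C by (simp add: c_def)
  have p: "0 < p" "p \<le> 1" "p \<le> p0" using prem p0 by (auto simp: p_def)
  have tx: "0 < t x" using F_pos prem by blast
  obtain q where q: "q \<noteq> x" "\<forall>u\<in>A. \<not> bet u x q" using side prem by blast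
  obtain e where e: "E x e" "branch x e \<inter> D = {}" "\<And>u. u \<in> branch x e \<Longrightarrow> bet u x q"
    using fresh_branch[OF prem(3) q(1)] by blast
  have fresh: "branch x e \<inter> S = {}" using e q(2) by (auto simp: S_def branch_def)
  let ?B = "\<lambda>z y. ennreal (c * F y powr a * b ^ d z m)"
  have notS: "z \<notin> cand (resample S t t') x" if "z \<in> S" "ok x z" for z t'
  proof
    assume "z \<in> cand (resample S t t') x"
    then have lt: "tau t z < t x" using that prem(4)
      by (auto simp: cand_iff tau_resample_in S_def tau_nonseed)
    have "z \<in> Rg" using ok prem that by blast
    then have "t x \<le> tau t z" using that(1) prem(7)[of z] tau_nonseed[OF prem(4), of t] by (auto simp: S_def)
    then show False using lt by simp
  qed
  have "(\<integral>\<^sup>+t'. cpaths ok w0 (Suc n) x (resample S t t') \<partial>P) =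
     (\<integral>\<^sup>+t'. (\<integral>\<^sup>+z. indicator {z \<in> Al. z \<in> cand (resample S t t') x} z * cpaths ok w0 n z (resample S t t') \<partial>count_space UNIV) \<partial>P)"
    unfolding cpaths.simps
    by (intro nn_integral_cong arg_cong2[where f="(*)"] arg_cong2[where f=indicator] refl)
      (use notS in \<open>auto simp: Al_def\<close>)
  also have "\<dots> \<le> (\<integral>\<^sup>+z. indicator Al z * ((\<integral>\<^sup>+y. indicator {..<t x} y * ?B z y \<partial>\<mu>) * ennreal ((1 - F (t x)) ^ fresh_card (d x z))) \<partial>count_space UNIV)"
  proof (rule one_step[where N="\<lambda>_ y. 0 < F y"])
    show "AE y in \<mu>. 0 < F y" by (rule AE_F_pos)
    fix z T assume z: "z \<in> Al" and TS: "\<And>v. v \<in> S \<Longrightarrow> T v = t v" and T: "0 < F (T z)" "T z < t x"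
      "\<And>u. d x u < d x z \<Longrightarrow> t x \<le> tau T u"
    define D' where "D' = insert x D \<union> {u. d x u < d x z}"
    have zn: "z \<notin> D" "z \<noteq> x" "z \<notin> A" "z \<notin> {r, s}" "ok x z" using z by (auto simp: Al_def S_def)
    have e: "insert z (S \<union> {u. d x u < d x z}) = insert z (D' \<union> A)" by (auto simp: D'_def S_def)
    have tS: "tau T u = tau t u" if "u \<in> S" for u using TS[OF that] by (simp add: with_seeds_def)
    have "(\<integral>\<^sup>+t'. cpaths ok w0 n z (resample (insert z (D' \<union> A)) T t') \<partial>P) \<le> ennreal ((1 / 2) ^ n * C * F (T z) powr a * b ^ d z m)"
    proof (rule IH)
      show "z \<in> Rg" using ok prem zn by blast
      show "history D' z" unfolding D'_def by (rule history_jump) (use prem zn in auto)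
      show "F (T z) \<le> p0" using F_mono[of "T z" "t x"] T prem by simp
      fix u assume "u \<in> D' \<union> A \<inter> Rg"
      then consider "u = x" | "u \<in> D \<union> A \<inter> Rg" | "d x u < d x z" by (auto simp: D'_def)
      then show "T z \<le> tau T u"
      proof cases
        case 1 then show ?thesis using tS[of x] T prem(4) by (simp add: S_def tau_nonseed)
      next
        case 2 then show ?thesis using tS[of u] T prem(7)[of u] by (auto simp: S_def)
      next
        case 3 then show ?thesis using T by force
      qed
    qed (use zn T in auto)
    then show "(\<integral>\<^sup>+t'. cpaths ok w0 n z (resample (insert z (S \<union> {u. d x u < d x z})) T t') \<partial>P) \<le> ?B z (T z)"
      unfolding e c_def .
  qed (use prem(4) tx e fresh in \<open>auto simp: S_def Al_def\<close>)
  also have "\<dots> \<le> (\<integral>\<^sup>+z. ennreal ((c * p powr a) / (a + 1) * p * b ^ d z m) * ennreal ((1 - p) ^ fresh_card (d x z)) \<partial>count_space UNIV)"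
  proof (intro nn_integral_mono)
    fix z
    have "(\<integral>\<^sup>+y. indicator {..<t x} y * ?B z y \<partial>\<mu>) = (\<integral>\<^sup>+y. ennreal (c * b ^ d z m) * (indicator {..<t x} y * ennreal (F y powr a)) \<partial>\<mu>)"
      using c b by (intro nn_integral_cong) (auto simp: ennreal_mult[symmetric] algebra_simps split: split_indicator)
    also have "\<dots> = ennreal (c * b ^ d z m) * (\<integral>\<^sup>+y. indicator {..<t x} y * ennreal (F y powr a) \<partial>\<mu>)"
      by (rule nn_integral_cmult) simp
    also have "\<dots> \<le> ennreal (c * b ^ d z m) * ennreal (p powr (a + 1) / (a + 1))"
      unfolding p_def by (intro mult_left_mono nn_integral_F_powr a) simp
    also have "\<dots> = ennreal ((c * p powr a) / (a + 1) * p * b ^ d z m)"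
      using c b p a by (simp add: ennreal_mult[symmetric] powr_add algebra_simps)
    finally have "(\<integral>\<^sup>+y. indicator {..<t x} y * ?B z y \<partial>\<mu>) \<le> ennreal ((c * p powr a) / (a + 1) * p * b ^ d z m)" .
    then show "indicator Al z * ((\<integral>\<^sup>+y. indicator {..<t x} y * ?B z y \<partial>\<mu>) * ennreal ((1 - F (t x)) ^ fresh_card (d x z)))
      \<le> ennreal ((c * p powr a) / (a + 1) * p * b ^ d z m) * ennreal ((1 - p) ^ fresh_card (d x z))"
      unfolding p_def[symmetric] by (auto split: split_indicator intro: mult_right_mono)
  qed
  also have "\<dots> \<le> ennreal (c * p powr a * b ^ d x m / 2)"
    by (rule contraction) (use b p a c sg in auto)
  also have "\<dots> = ennreal ((1 / 2) ^ Suc n * C * F (t x) powr a * b ^ d x m)" by (simp add: c_def p_def algebra_simps)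
  finally show ?case unfolding S_def .
qed

lemma AE_geometric:
  fixes f :: "nat \<Rightarrow> ('v \<Rightarrow> real) \<Rightarrow> ennreal"
  assumes [measurable]: "\<And>n. f n \<in> borel_measurable P" and c: "0 \<le> c"
    and le: "\<And>n. (\<integral>\<^sup>+t. f n t \<partial>P) \<le> ennreal ((1 / 2) ^ n * c)"
  shows "AE t in P. (INF n. f n t) = 0"
proof -
  have "(\<integral>\<^sup>+t. (INF n. f n t) \<partial>P) \<le> ennreal ((1 / 2) ^ n * c)" for n
    by (rule order_trans[OF nn_integral_mono le[of n]]) (auto intro: INF_lower)
  moreover have "(\<lambda>n. ennreal ((1 / 2) ^ n * c)) \<longlonglongrightarrow> ennreal (0 * c)"
    by (intro tendsto_ennrealI tendsto_mult_right LIMSEQ_power_zero) simp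
  ultimately have "(\<integral>\<^sup>+t. (INF n. f n t) \<partial>P) \<le> 0"
    by (intro LIMSEQ_le_const) auto
  then show ?thesis by (subst (asm) le_zero_eq, subst (asm) nn_integral_0_iff_AE) auto
qed

section \<open>Ancestral times tend to zero\<close>

text \<open>An infinite sequence of successive candidates that meets no seed.\<close>

definition cand_ray :: "('v \<Rightarrow> real) \<Rightarrow> (nat \<Rightarrow> 'v) \<Rightarrow> bool" where
  "cand_ray t X \<longleftrightarrow> (\<forall>n. X n \<notin> {r, s} \<and> X (Suc n) \<in> cand t (X n))"

lemma cand_ray_Suc: "cand_ray t X \<Longrightarrow> cand_ray t (\<lambda>n. X (k + n))" by (simp add: cand_ray_def)

lemma cand_ray_time: "cand_ray t X \<Longrightarrow> t (X (Suc n)) < t (X n)"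
  unfolding cand_ray_def cand_iff by (metis tau_nonseed)

lemma cand_sum_ge:
  fixes f :: "'v \<Rightarrow> ennreal"
  assumes "z \<in> A"
  shows "f z \<le> (\<integral>\<^sup>+z. indicator A z * f z \<partial>count_space UNIV)"
proof -
  have "(\<integral>\<^sup>+y. f z * indicator {z} y \<partial>count_space UNIV) \<le> (\<integral>\<^sup>+z. indicator A z * f z \<partial>count_space UNIV)"
    by (intro nn_integral_mono) (use assms in \<open>auto split: split_indicator\<close>)
  then show ?thesis by (simp add: nn_integral_cmult_indicator)
qed

lemma cpaths_ge:
  assumes "cand_ray t X" "\<And>i. i < n \<Longrightarrow> ok (X i) (X (Suc i))"
  shows "w0 (X n) t \<le> cpaths ok w0 n (X 0) t"
  using assms
proof (induction n arbitrary: X)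
  case (Suc n)
  have "w0 (X (Suc n)) t \<le> cpaths ok w0 n (X (Suc 0)) t"
    using Suc.IH[of "\<lambda>n. X (Suc n)"] Suc.prems cand_ray_Suc[of t X 1] by simp
  also have "\<dots> \<le> cpaths ok w0 (Suc n) (X 0) t"
    unfolding cpaths.simps
    by (rule cand_sum_ge) (use Suc.prems in \<open>auto simp: cand_ray_def\<close>)
  finally show ?case .
qed simp

text \<open>With a large power \<open>a\<close> of \<open>F\<close> as weight, the expected number of candidate paths
  contracts at every step, since the time of the next vertex is uniform below the current one. A
  path on which \<open>F\<close> stays above \<open>q\<close> would contribute at least \<open>q powr a\<close> for every length.\<close>

lemma AE_times_vanish:
  "AE t in P. \<forall>X q. cand_ray t X \<longrightarrow> 0 < q \<longrightarrow> (\<exists>n. F (t (X n)) < q)"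
proof -
  \<comment> \<open>the power for which \<open>jump_sum_1\<close> makes the paths contract at all times, not only at small ones\<close>
  define a where "a = 160 * real K ^ 4"
  have a: "0 < a" using K2 by (simp add: a_def)
  define w0 where "w0 = (\<lambda>(x :: 'v) (t :: 'v \<Rightarrow> real). ennreal (F (t x) powr a))"
  have w0 [measurable]: "w0 x \<in> borel_measurable P" for x unfolding w0_def by measurable
  let ?c = "cpaths (\<lambda>_ _. True) w0"
  have sg: "ennreal (4 / (a + 1)) * jump_sum 1 p \<le> ennreal (1 / 2)" if p: "0 < p" "p \<le> 1" for p
  proof -
    have "ennreal (4 / (a + 1)) * jump_sum 1 p \<le> ennreal (4 / (a + 1)) * ennreal (20 * real K ^ 4)"
      by (intro mult_left_mono jump_sum_1 p) simp
    also have "\<dots> = ennreal (4 / (a + 1) * (20 * real K ^ 4))"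
      by (rule ennreal_mult[symmetric]) (use a in auto)
    also have "\<dots> \<le> ennreal (1 / 2)"
    proof (rule ennreal_leI)
      have e: "20 * real K ^ 4 = a / 8" by (simp add: a_def)
      have "4 / (a + 1) * (20 * real K ^ 4) = a / (a + 1) / 2" unfolding e using a by (simp add: field_simps)
      also have "a / (a + 1) \<le> 1" using a by simp
      finally show "4 / (a + 1) * (20 * real K ^ 4) \<le> 1 / 2" by simp
    qed
    finally show ?thesis .
  qed
  have dec: "(\<integral>\<^sup>+t'. ?c n x (resample {x} t t') \<partial>P) \<le> ennreal ((1 / 2) ^ n * F (t x) powr a)"
    if x: "x \<notin> {r, s}" "0 < F (t x)" for x n t
  proof -
    have "(\<integral>\<^sup>+t'. ?c n x (resample (insert x ({} \<union> {})) t t') \<partial>P) \<le> ennreal ((1 / 2) ^ n * 1 * F (t x) powr a * 1 ^ d x x)"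
    proof (rule cpaths_decay[where Rg=UNIV and ?p0.0=1])
      show "\<exists>q. q \<noteq> x \<and> (\<forall>u\<in>{}. \<not> bet u x q)" for x using history_empty[of x] unfolding history_def by simp
      show "(\<integral>\<^sup>+t'. w0 x (resample (insert x (D \<union> {})) t t') \<partial>P) \<le> ennreal (1 * F (t x) powr a * 1 ^ d x m)" for x D t m
        by (simp add: w0_def resample_in P.emeasure_space_1[simplified])
      show "4 / 3 \<le> real K * 1\<^sup>2" using K2 by simp
    qed (use a sg x history_empty in auto)
    then show ?thesis by simp
  qed
  have "AE t in P. x \<notin> {r, s} \<longrightarrow> (INF n. ?c n x t) = 0" for x
  proof (cases "x \<in> {r, s}")
    case False
    have m [measurable]: "?c n x \<in> borel_measurable P" for n by (rule cpaths_measurable[OF w0])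
    have "(\<integral>\<^sup>+t. (INF n. ?c n x t) \<partial>P) = (\<integral>\<^sup>+t. \<integral>\<^sup>+t'. (INF n. ?c n x (resample {x} t t')) \<partial>P \<partial>P)"
      by (rule nn_resample) measurable
    also have "\<dots> = (\<integral>\<^sup>+t. 0 \<partial>P)"
    proof (rule nn_integral_cong_AE)
      show "AE t in P. (\<integral>\<^sup>+t'. (INF n. ?c n x (resample {x} t t')) \<partial>P) = 0"
        using AE_component[OF AE_F_pos, of x]
      proof eventually_elim
        fix t assume "0 < F (t x)"
        then have "AE t' in P. (INF n. ?c n x (resample {x} t t')) = 0"
          by (intro AE_geometric[where c="F (t x) powr a"] dec False) auto
        then have "(\<integral>\<^sup>+t'. (INF n. ?c n x (resample {x} t t')) \<partial>P) = (\<integral>\<^sup>+t'. 0 \<partial>P)" by (rule nn_integral_cong_AE)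
        then show "(\<integral>\<^sup>+t'. (INF n. ?c n x (resample {x} t t')) \<partial>P) = 0" by simp
      qed
    qed
    finally have "(\<integral>\<^sup>+t. (INF n. ?c n x t) \<partial>P) = 0" by simp
    then have "AE t in P. (INF n. ?c n x t) = 0" by (subst (asm) nn_integral_0_iff_AE) auto
    then show ?thesis by eventually_elim simp
  qed simp
  then have "AE t in P. \<forall>x\<in>UNIV. x \<notin> {r, s} \<longrightarrow> (INF n. ?c n x t) = 0"
    by (subst AE_ball_countable[OF countable_UNIV]) simp
  then show ?thesis
  proof eventually_elim
    fix t assume z: "\<forall>x\<in>UNIV. x \<notin> {r, s} \<longrightarrow> (INF n. ?c n x t) = 0"
    show "\<forall>X q. cand_ray t X \<longrightarrow> 0 < q \<longrightarrow> (\<exists>n. F (t (X n)) < q)"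
    proof (intro allI impI, rule ccontr)
      fix X q assume X: "cand_ray t X" "0 < q" "\<nexists>n. F (t (X n)) < q"
      have "ennreal (q powr a) \<le> ?c n (X 0) t" for n
      proof -
        have "q powr a \<le> F (t (X n)) powr a" using X a by (intro powr_mono2) (auto simp: not_less)
        then have "ennreal (q powr a) \<le> w0 (X n) t" unfolding w0_def by (intro ennreal_leI)
        also have "\<dots> \<le> ?c n (X 0) t" by (rule cpaths_ge[OF X(1)]) simp
        finally show ?thesis .
      qed
      then have "ennreal (q powr a) \<le> (INF n. ?c n (X 0) t)" by (rule INF_greatest)
      also have "\<dots> = 0" using z X(1) unfolding cand_ray_def by blast
      finally show False using X(2) by simp
    qed
  qed
qed

section \<open>Escaping from a side of a vertex\<close>

text \<open>The event that the nearest earlier vertex is at least as far away as \<open>m\<close>.\<close>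

definition reach :: "'v \<Rightarrow> 'v \<Rightarrow> ('v \<Rightarrow> real) \<Rightarrow> ennreal" where
  "reach m y t = indicator {t. \<forall>u\<in>{u. d y u < d y m}. tau t y \<le> tau t u} t"

text \<open>The number of candidate paths from \<open>x\<close> that reach, by jumps that are too short to
  cross \<open>m\<close>, a vertex whose next jump may cross \<open>m\<close>.\<close>

definition esc :: "'v \<Rightarrow> 'v \<Rightarrow> ('v \<Rightarrow> real) \<Rightarrow> ennreal" where
  "esc m x t = (\<Sum>n. cpaths (\<lambda>y z. d y z < d y m) (reach m) n x t)"

lemma reach_measurable [measurable]: "reach m y \<in> borel_measurable P"
proof -
  have "Measurable.pred P (\<lambda>t. \<forall>u\<in>{u. d y u < d y m}. tau t y \<le> tau t u)"
    by (intro pred_intros_finite finite_lt_ball tau_le_pred)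
  then have "{t. \<forall>u\<in>{u. d y u < d y m}. tau t y \<le> tau t u} \<in> sets P" by (simp add: pred_def)
  then show ?thesis unfolding reach_def[abs_def] by simp
qed

lemma esc_measurable [measurable]: "esc m x \<in> borel_measurable P"
proof -
  have [measurable]: "cpaths (\<lambda>y z. d y z < d y m) (reach m) n x \<in> borel_measurable P" for n
    by (rule cpaths_measurable) simp
  show ?thesis unfolding esc_def[abs_def] by measurable
qed

text \<open>The left-hand side decays doubly exponentially in \<open>h\<close>, but only from \<open>K ^ h * p\<close> of
  order \<open>1\<close> on. The bound \<open>exp (- y) \<le> 1 / sqrt y\<close> keeps the dependence on \<open>p\<close> integrable at
  \<open>0\<close>, and \<open>1 / sqrt K \<le> 9 / 10\<close>.\<close>

lemma fresh_card_decay_half: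
  assumes p: "0 < p" "p \<le> 1"
  shows "(1 - p) ^ fresh_card h \<le> 2 * K * p powr (- 1 / 2) * (9 / 10) ^ h"
proof -
  have K: "2 \<le> real K" using K2 by simp
  have p1: "1 \<le> p powr (- 1 / 2)" using p powr_mono2'[of "- 1 / 2" p 1] by simp
  show ?thesis
  proof (cases "h < 2")
    case True
    have "1 * 1 * (9 / 10) ^ 1 \<le> real K * p powr (- 1 / 2) * (9 / 10) ^ h"
      using True K p1 by (intro mult_mono power_decreasing) auto
    then show ?thesis using True by (simp add: fresh_card_def)
  next
    case False
    define y where "y = real (fresh_card h) * p"
    have y: "y = p * (real K ^ h / real K ^ 2)" using False K by (simp add: y_def fresh_card_real)
    have y0: "0 < y" using y p K by simp
    have "(1 - p) ^ fresh_card h \<le> exp (- y)" using power_le_exp[of p "fresh_card h"] p by (simp add: y_def)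
    also have "\<dots> \<le> 1 / sqrt y"
    proof -
      have "y \<le> exp y" using exp_ge_add_one_self[of y] by linarith
      also have "\<dots> \<le> exp (2 * y)" using y0 by simp
      finally have "sqrt y \<le> sqrt (exp y ^ 2)" by (simp add: power2_eq_square exp_add[symmetric])
      then show ?thesis using y0 by (simp add: exp_minus field_simps)
    qed
    also have "\<dots> = real K * p powr (- 1 / 2) * (1 / sqrt (real K)) ^ h"
      using p K by (simp add: y real_sqrt_mult real_sqrt_divide real_sqrt_power powr_minus powr_half_sqrt field_simps)
    also have "\<dots> \<le> 2 * K * p powr (- 1 / 2) * (9 / 10) ^ h"
    proof (intro mult_mono power_mono)
      have "sqrt ((10 / 9)\<^sup>2) \<le> sqrt (real K)" using K by (intro real_sqrt_le_mono) (simp add: power2_eq_square)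
      then have "10 / 9 \<le> sqrt (real K)" by simp
      then have "1 / sqrt (real K) \<le> 1 / (10 / 9)" using K by (intro divide_left_mono) auto
      then show "1 / sqrt (real K) \<le> 9 / 10" by simp
    qed (use K in auto)
    finally show ?thesis .
  qed
qed

text \<open>Already for \<open>K = 2\<close> the two bases satisfy the condition of \<open>sum_sph_bound\<close>.\<close>

lemma base_bounds: "4 / 3 \<le> real K * (9 / 10)\<^sup>2" "4 / 3 \<le> real K * (19 / 20)\<^sup>2"
  using K2 by (simp_all add: power2_eq_square)

text \<open>For times with \<open>F\<close> at most \<open>p0\<close>, the weights with exponent \<open>a = - 1 / 2\<close> and the bases
  \<open>9 / 10\<close> (for one path) and \<open>19 / 20\<close> (for pairs of paths) contract; the number \<open>8\<close> is
  \<open>4 / (a + 1)\<close>.\<close>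

definition p0 :: real where
  "p0 = (SOME p0. 0 < p0 \<and> p0 \<le> 1 \<and> (\<forall>p b. 0 < p \<longrightarrow> p \<le> p0 \<longrightarrow> b \<in> {9 / 10, 19 / 20} \<longrightarrow>
     ennreal 8 * jump_sum b p \<le> ennreal (1 / 2)))"

lemma p0: "0 < p0" "p0 \<le> 1"
  and jump_sum_p0: "0 < p \<Longrightarrow> p \<le> p0 \<Longrightarrow> b \<in> {9 / 10, 19 / 20} \<Longrightarrow> ennreal 8 * jump_sum b p \<le> ennreal (1 / 2)"
proof -
  obtain p1 where p1: "0 < p1" "p1 \<le> 1" "\<And>p. 0 < p \<Longrightarrow> p \<le> p1 \<Longrightarrow> jump_sum (9 / 10) p \<le> ennreal (1 / 16)"
    by (rule jump_sum_small[of "9 / 10" "1 / 16"]) auto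
  obtain p2 where p2: "0 < p2" "p2 \<le> 1" "\<And>p. 0 < p \<Longrightarrow> p \<le> p2 \<Longrightarrow> jump_sum (19 / 20) p \<le> ennreal (1 / 16)"
    by (rule jump_sum_small[of "19 / 20" "1 / 16"]) auto
  have "ennreal 8 * jump_sum b p \<le> ennreal (1 / 2)" if "0 < p" "p \<le> min p1 p2" "b \<in> {9 / 10, 19 / 20}" for p b
  proof -
    have "jump_sum b p \<le> ennreal (1 / 16)"
    proof (cases "b = 9 / 10")
      case True
      show ?thesis unfolding True by (rule p1(3)) (use that in auto)
    next
      case False
      then have e: "b = 19 / 20" using that by blast
      show ?thesis unfolding e by (rule p2(3)) (use that in auto)
    qed
    then have "ennreal 8 * jump_sum b p \<le> ennreal 8 * ennreal (1 / 16)" by (rule mult_left_mono) simp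
    also have "\<dots> = ennreal (1 / 2)" by (subst ennreal_mult[symmetric]) auto
    finally show ?thesis .
  qed
  then have "\<exists>p0. 0 < p0 \<and> p0 \<le> 1 \<and> (\<forall>p b. 0 < p \<longrightarrow> p \<le> p0 \<longrightarrow> b \<in> {9 / 10, 19 / 20} \<longrightarrow>
     ennreal 8 * jump_sum b p \<le> ennreal (1 / 2))"
    using p1 p2 by (intro exI[of _ "min p1 p2"]) auto
  from someI_ex[OF this, folded p0_def]
  show "0 < p0" "p0 \<le> 1" "0 < p \<Longrightarrow> p \<le> p0 \<Longrightarrow> b \<in> {9 / 10, 19 / 20} \<Longrightarrow> ennreal 8 * jump_sum b p \<le> ennreal (1 / 2)"
    by auto
qed

text \<open>For a walker at \<open>x\<close> whose history is \<open>D\<close>, while a second walker waits beyond \<open>m\<close>, at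
  \<open>q\<close>, with history \<open>D'\<close>. As long as the first walker stays on its side of \<open>m\<close>, its current vertex
  \<open>y\<close> does not separate \<open>D'\<close> from \<open>q\<close>, because otherwise \<open>y\<close> itself would be in the star-shaped
  set \<open>D'\<close>; so one branch at \<open>y\<close> is free of both histories. The final long jump has probability at
  most \<open>2 * K * F (t y) powr (- 1 / 2) * (9 / 10) ^ d y m\<close>, which is the weight that contracts
  along the way.\<close>

lemma esc_bound:
  assumes x: "x \<noteq> m" "bet x m q" "m \<noteq> q" "history D x" "x \<notin> {r, s}" "0 < F (t x)" "F (t x) \<le> p0"
    and q: "history D' q" "x \<notin> D'"
    and late: "\<And>u. u \<in> D \<union> D' \<Longrightarrow> t x \<le> tau t u"
  shows "(\<integral>\<^sup>+t'. esc m x (resample (insert x (D \<union> insert q D')) t t') \<partial>P)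
    \<le> ennreal (4 * K * F (t x) powr (- 1 / 2) * (9 / 10) ^ d x m)"
proof -
  define A where "A = insert q D'"
  define Rg where "Rg = {y. y \<noteq> m \<and> bet y m q}"
  let ?ok = "\<lambda>y z. d y z < d y m"
  have side: "\<exists>q. q \<noteq> y \<and> (\<forall>u\<in>A. \<not> bet u y q)" if y: "y \<in> Rg" "y \<notin> A" for y
  proof (intro exI[of _ q] conjI ballI)
    show "q \<noteq> y" using y by (auto simp: A_def)
    fix u assume "u \<in> A"
    then consider "u = q" | "u \<in> D'" by (auto simp: A_def)
    then show "\<not> bet u y q"
    proof cases
      case 1 then show ?thesis using y bet_self[of q y] by (auto simp: A_def)
    next
      case 2
      show ?thesis
      proof
        assume "bet u y q"
        then have "y \<in> D'" using history_star[OF q(1) 2] y by (auto simp: A_def)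
        then show False using y by (simp add: A_def)
      qed
    qed
  qed
  have closed: "z \<in> Rg" if y: "y \<in> Rg" "?ok y z" for y z
  proof -
    have "\<not> bet y m z" using y by (auto simp: bet_def)
    then have "bet z m q" using tripod[of y m q z] y by (auto simp: Rg_def)
    moreover have "z \<noteq> m" using y by auto
    ultimately show ?thesis by (simp add: Rg_def)
  qed
  have qR: "q \<notin> Rg" using x(3) bet_self[of q m] by (auto simp: Rg_def)
  have "(\<integral>\<^sup>+t'. cpaths ?ok (reach m) n x (resample (insert x (D \<union> A)) t t') \<partial>P)
    \<le> ennreal ((1 / 2) ^ n * (2 * K) * F (t x) powr (- 1 / 2) * (9 / 10) ^ d x m)" for n
  proof (rule cpaths_decay[where Rg=Rg and ?p0.0=p0])
    show "ennreal (4 / (- 1 / 2 + 1)) * jump_sum (9 / 10) p \<le> ennreal (1 / 2)" if "0 < p" "p \<le> p0" for p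
      using jump_sum_p0[OF that, of "9 / 10"] by simp
    show "\<exists>q. q \<noteq> y \<and> (\<forall>u\<in>A. \<not> bet u y q)" if "y \<in> Rg" "y \<notin> A" for y using side that .
    fix y D1 t assume y: "y \<in> Rg" "y \<notin> A" "history D1 y" "y \<notin> {r, s}" "0 < F (t y)" "F (t y) \<le> p0"
      "\<And>u. u \<in> D1 \<union> A \<inter> Rg \<Longrightarrow> t y \<le> tau t u"
    obtain b where b: "b \<noteq> y" "\<And>u. u \<in> A \<Longrightarrow> \<not> bet u y b" using side[OF y(1,2)] by blast
    obtain e where e: "E y e" "branch y e \<inter> D1 = {}" "\<And>u. u \<in> branch y e \<Longrightarrow> bet u y b"
      using fresh_branch[OF y(3) b(1)] by blast
    obtain B where B: "finite B" "B \<subseteq> branch y e" "\<And>u. u \<in> B \<Longrightarrow> d y u < d y m" "card B = fresh_card (d y m)"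
      using ex_fresh_set[OF e(1)] by blast
    have nB: "u \<notin> insert y (D1 \<union> A)" if "u \<in> B" for u
    proof -
      have "u \<in> branch y e" using that B(2) by blast
      then have "u \<noteq> y" "u \<notin> D1" "bet u y b" using e(2) e(3)[of u] by (auto simp: branch_def)
      then show ?thesis using b(2)[of u] by auto
    qed
    have "(\<integral>\<^sup>+t'. reach m y (resample (insert y (D1 \<union> A)) t t') \<partial>P) \<le> (\<integral>\<^sup>+t'. indicator {T. \<forall>u\<in>B. t y \<le> tau T u} t' \<partial>P)"
    proof (intro nn_integral_mono)
      fix t'
      have "t y \<le> tau t' u" if r: "\<forall>u\<in>{u. d y u < d y m}. tau (resample (insert y (D1 \<union> A)) t t') y \<le> tau (resample (insert y (D1 \<union> A)) t t') u"
        and u: "u \<in> B" for u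
      proof -
        have "tau (resample (insert y (D1 \<union> A)) t t') y = t y" using y(4) by (simp add: tau_nonseed resample_in)
        moreover have "tau (resample (insert y (D1 \<union> A)) t t') u = tau t' u"
          using nB[OF u] by (simp add: with_seeds_def resample_def)
        ultimately show ?thesis using r B(3)[OF u] by auto
      qed
      then show "reach m y (resample (insert y (D1 \<union> A)) t t') \<le> indicator {T. \<forall>u\<in>B. t y \<le> tau T u} t'"
        unfolding reach_def by (auto simp: indicator_def)
    qed
    also have "\<dots> = emeasure P {T. \<forall>u\<in>B. t y \<le> tau T u}"
      using late_measurable[OF B(1)] by simp
    also have "\<dots> \<le> ennreal ((1 - F (t y)) ^ card B)"
      by (rule emeasure_late) (use B y F_pos in auto)
    also have "\<dots> \<le> ennreal (2 * K * F (t y) powr (- 1 / 2) * (9 / 10) ^ d y m)"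
      unfolding B(4) by (intro ennreal_leI fresh_card_decay_half) (use y p0 in auto)
    finally show "(\<integral>\<^sup>+t'. reach m y (resample (insert y (D1 \<union> A)) t t') \<partial>P) \<le> ennreal (2 * K * F (t y) powr (- 1 / 2) * (9 / 10) ^ d y m)" .
  next
    show "x \<notin> A" using q x by (auto simp: A_def bet_self)
    show "x \<in> Rg" using x by (simp add: Rg_def)
    show "z \<in> Rg" if "y \<in> Rg" "d y z < d y m" for y z by (rule closed[OF that])
    fix u assume "u \<in> D \<union> A \<inter> Rg" then show "t x \<le> tau t u" using late qR by (auto simp: A_def)
  qed (use p0 base_bounds x in auto)
  then have le: "(\<integral>\<^sup>+t'. cpaths ?ok (reach m) n x (resample (insert x (D \<union> A)) t t') \<partial>P)
    \<le> ennreal ((1 / 2) ^ n) * ennreal (2 * K * F (t x) powr (- 1 / 2) * (9 / 10) ^ d x m)" for n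
    by (simp add: ennreal_mult[symmetric] mult.assoc)
  have [measurable]: "cpaths ?ok (reach m) n x \<in> borel_measurable P" for n by (rule cpaths_measurable) simp
  have "(\<integral>\<^sup>+t'. esc m x (resample (insert x (D \<union> A)) t t') \<partial>P) = (\<Sum>n. \<integral>\<^sup>+t'. cpaths ?ok (reach m) n x (resample (insert x (D \<union> A)) t t') \<partial>P)"
    unfolding esc_def by (rule nn_integral_suminf) measurable
  also have "\<dots> \<le> (\<Sum>n. ennreal ((1 / 2) ^ n) * ennreal (2 * K * F (t x) powr (- 1 / 2) * (9 / 10) ^ d x m))"
    by (intro suminf_le summableI le)
  also have "\<dots> = (\<Sum>n. ennreal ((1 / 2) ^ n)) * ennreal (2 * K * F (t x) powr (- 1 / 2) * (9 / 10) ^ d x m)" by simp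
  also have "(\<Sum>n. ennreal ((1 / 2) ^ n)) = ennreal 2"
    using geometric_sums[of "1 / 2 :: real"] by (intro suminf_ennreal_eq) auto
  also have "ennreal 2 * ennreal (2 * K * F (t x) powr (- 1 / 2) * (9 / 10) ^ d x m) = ennreal (4 * K * F (t x) powr (- 1 / 2) * (9 / 10) ^ d x m)"
    by (subst ennreal_mult[symmetric]) auto
  finally show ?thesis unfolding A_def .
qed

section \<open>Pairs of candidate paths\<close>

text \<open>Two candidate paths are followed by always moving the vertex with the larger time,
  here the first one. In this order all explored times are at least as large as both current
  times, so that the surroundings of both current vertices contain a fresh branch. The recursion
  counts those continuations in which the paths do not meet.\<close>

primrec cpairs :: "('v \<Rightarrow> 'v \<Rightarrow> ('v \<Rightarrow> real) \<Rightarrow> ennreal) \<Rightarrow> nat \<Rightarrow> 'v \<Rightarrow> 'v \<Rightarrow> ('v \<Rightarrow> real) \<Rightarrow> ennreal" where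
  "cpairs w0 0 x q t = w0 x q t"
| "cpairs w0 (Suc n) x q t =
     (\<integral>\<^sup>+z. indicator {z. z \<in> cand t x \<and> z \<notin> {r, s} \<and> z \<noteq> q} z *
        (if t q < t z then cpairs w0 n z q t else cpairs w0 n q z t) \<partial>count_space UNIV)"

lemma time_less_pred [measurable]: "Measurable.pred P (\<lambda>t. t u < t v)"
  by (rule borel_measurable_pred_less) (rule comp_measurable)+

lemma cpairs_measurable [measurable]:
  assumes "\<And>x q. w0 x q \<in> borel_measurable P" shows "cpairs w0 n x q \<in> borel_measurable P"
proof (induction n arbitrary: x q)
  case 0 then show ?case using assms by (simp cong: measurable_cong)
next
  case (Suc n)
  then have [measurable]: "cpairs w0 n x q \<in> borel_measurable P" for x q .
  have "(\<lambda>t. if t q < t z then cpairs w0 n z q t else cpairs w0 n q z t) \<in> borel_measurable P" for z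
    by (rule measurable_If[OF _ _ time_less_pred[unfolded pred_def]]) measurable
  then show ?case
    using cand_sum_measurable[of "\<lambda>z t. if t q < t z then cpairs w0 n z q t else cpairs w0 n q z t" x "\<lambda>z. z \<notin> {r, s} \<and> z \<noteq> q"]
    by simp
qed

text \<open>The weight contains one term for each of the two times. When the first vertex moves,
  the integral over its new time costs a factor \<open>1 / (- 1 / 2 + 1) = 2\<close> in its own term and
  nothing in the other one, and the sum over its new position is small because both values of \<open>F\<close>
  are at most \<open>p0\<close>.\<close>

lemma cpairs_decay:
  assumes C: "0 \<le> C"
    and w0 [measurable]: "\<And>x q. w0 x q \<in> borel_measurable P"
    and base: "\<And>x q D D' t. x \<noteq> q \<Longrightarrow> x \<notin> {r, s} \<Longrightarrow> q \<notin> {r, s} \<Longrightarrow> history D x \<Longrightarrow> history D' q \<Longrightarrow> q \<notin> D \<Longrightarrow> x \<notin> D' \<Longrightarrow>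
      0 < F (t x) \<Longrightarrow> F (t x) \<le> p0 \<Longrightarrow> 0 < F (t q) \<Longrightarrow> F (t q) \<le> p0 \<Longrightarrow> t q < t x \<Longrightarrow>
      (\<And>u. u \<in> D \<union> D' \<Longrightarrow> t x \<le> tau t u) \<Longrightarrow>
      (\<integral>\<^sup>+t'. w0 x q (resample (insert x (insert q (D \<union> D'))) t t') \<partial>P)
        \<le> ennreal (C * (F (t x) powr (- 1 / 2) + F (t q) powr (- 1 / 2)) * (19 / 20) ^ d x q)"
  shows "x \<noteq> q \<Longrightarrow> x \<notin> {r, s} \<Longrightarrow> q \<notin> {r, s} \<Longrightarrow> history D x \<Longrightarrow> history D' q \<Longrightarrow> q \<notin> D \<Longrightarrow> x \<notin> D' \<Longrightarrow>
      0 < F (t x) \<Longrightarrow> F (t x) \<le> p0 \<Longrightarrow> 0 < F (t q) \<Longrightarrow> F (t q) \<le> p0 \<Longrightarrow> t q < t x \<Longrightarrow>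
      (\<And>u. u \<in> D \<union> D' \<Longrightarrow> t x \<le> tau t u) \<Longrightarrow>
      (\<integral>\<^sup>+t'. cpairs w0 n x q (resample (insert x (insert q (D \<union> D'))) t t') \<partial>P)
        \<le> ennreal ((1 / 2) ^ n * C * (F (t x) powr (- 1 / 2) + F (t q) powr (- 1 / 2)) * (19 / 20) ^ d x q)"
proof (induction n arbitrary: x q D D' t)
  case 0
  show ?case using base[of x q D D' t] 0 by simp
next
  case (Suc n)
  note IH = Suc.IH and prem = Suc.prems
  define S where "S = insert x (insert q (D \<union> D'))"
  define Al where "Al = {z. z \<notin> S \<and> z \<notin> {r, s}}"
  define p where "p = F (t x)"
  define p' where "p' = F (t q)"
  define c where "c = (1 / 2) ^ n * C"
  have c: "0 \<le> c" using C by (simp add: c_def)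
  have p: "0 < p" "p \<le> 1" "p \<le> p0" "0 < p'" using prem p0 by (auto simp: p_def p'_def)
  have tx: "0 < t x" using F_pos prem by blast
  have qx: "q \<noteq> x" using prem by simp
  obtain e where e: "E x e" "branch x e \<inter> D = {}" "\<And>u. u \<in> branch x e \<Longrightarrow> bet u x q"
    using fresh_branch[OF prem(4) qx] by blast
  have fresh: "branch x e \<inter> S = {}"
  proof (rule equals0I)
    fix u assume u: "u \<in> branch x e \<inter> S"
    then have b: "bet u x q" and ux: "u \<noteq> x" using e(3) by (auto simp: branch_def)
    have "u \<noteq> q" using b prem(1) bet_self[of q x] by auto
    then have "u \<in> D'" using u ux e(2) by (auto simp: S_def)
    then have "x \<in> D'" using history_star[OF prem(5) _ b] prem(1) by simp
    then show False using prem by simp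
  qed
  let ?H = "\<lambda>z t. if t q < t z then cpairs w0 n z q t else cpairs w0 n q z t"
  let ?B = "\<lambda>z y. ennreal (c * (F y powr (- 1 / 2) + p' powr (- 1 / 2)) * (19 / 20) ^ d z q)"
  have [measurable]: "?H z \<in> borel_measurable P" for z
    by (rule measurable_If[OF _ _ time_less_pred[unfolded pred_def]]) (rule cpairs_measurable[OF w0])+
  have notS: "z \<notin> cand (resample S t t') x" if "z \<in> S" "z \<noteq> q" for z t'
  proof
    assume "z \<in> cand (resample S t t') x"
    then have lt: "tau t z < t x" using that prem(2)
      by (auto simp: cand_iff tau_resample_in S_def tau_nonseed)
    have "t x \<le> tau t z" using that prem(13)[of z] tau_nonseed[OF prem(2), of t] by (auto simp: S_def)
    then show False using lt by simp
  qed
  have "(\<integral>\<^sup>+t'. cpairs w0 (Suc n) x q (resample S t t') \<partial>P) =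
     (\<integral>\<^sup>+t'. (\<integral>\<^sup>+z. indicator {z \<in> Al. z \<in> cand (resample S t t') x} z * ?H z (resample S t t') \<partial>count_space UNIV) \<partial>P)"
    unfolding cpairs.simps
    by (intro nn_integral_cong arg_cong2[where f="(*)"] arg_cong2[where f=indicator] refl)
      (use notS in \<open>auto simp: Al_def S_def\<close>)
  also have "\<dots> \<le> (\<integral>\<^sup>+z. indicator Al z * ((\<integral>\<^sup>+y. indicator {..<t x} y * ?B z y \<partial>\<mu>) * ennreal ((1 - F (t x)) ^ fresh_card (d x z))) \<partial>count_space UNIV)"
  proof (rule one_step[where N="\<lambda>_ y. 0 < F y \<and> y \<noteq> t q"])
    show "AE y in \<mu>. 0 < F y \<and> y \<noteq> t q" using AE_F_pos AE_neq[of "t q"] by eventually_elim simp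
    fix z T assume z: "z \<in> Al" and TS: "\<And>v. v \<in> S \<Longrightarrow> T v = t v" and T: "0 < F (T z) \<and> T z \<noteq> t q" "T z < t x"
      "\<And>u. d x u < d x z \<Longrightarrow> t x \<le> tau T u"
    define D1 where "D1 = insert x D \<union> {u. d x u < d x z}"
    have zn: "z \<notin> D" "z \<noteq> x" "z \<noteq> q" "z \<notin> D'" "z \<notin> {r, s}" using z by (auto simp: Al_def S_def)
    define U where "U = insert z (S \<union> {u. d x u < d x z})"
    have U1: "U = insert z (insert q (D1 \<union> D'))" and U2: "U = insert q (insert z (D' \<union> D1))"
      by (auto simp: U_def D1_def S_def)
    have tS: "tau T u = tau t u" if "u \<in> S" for u using TS[OF that] by (simp add: with_seeds_def)
    have Tq: "T q = t q" using TS[of q] by (simp add: S_def)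
    have q_not: "q \<notin> D1"
      using T(3)[of q] tS[of q] tau_nonseed[OF prem(3), of t] prem by (auto simp: D1_def S_def)
    have hz: "history D1 z" unfolding D1_def by (rule history_jump) (use prem zn in auto)
    have zD1: "z \<notin> D1" using hz by (simp add: history_def)
    have late: "t x \<le> tau T u" if "u \<in> D1 \<union> D'" for u
      using that tS[of u] T(3)[of u] prem(13)[of u] tau_nonseed[OF prem(2), of t]
      by (auto simp: D1_def S_def)
    have Fz: "F (T z) \<le> p0" using F_mono[of "T z" "t x"] T prem by simp
    show "(\<integral>\<^sup>+t'. ?H z (resample (insert z (S \<union> {u. d x u < d x z})) T t') \<partial>P) \<le> ?B z (T z)"
    proof (cases "t q < T z")
      case True
      have "(\<integral>\<^sup>+t'. ?H z (resample U T t') \<partial>P) = (\<integral>\<^sup>+t'. cpairs w0 n z q (resample (insert z (insert q (D1 \<union> D'))) T t') \<partial>P)"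
        by (intro nn_integral_cong) (use True Tq in \<open>simp add: U1 resample_in\<close>)
      also have "\<dots> \<le> ennreal ((1 / 2) ^ n * C * (F (T z) powr (- 1 / 2) + F (T q) powr (- 1 / 2)) * (19 / 20) ^ d z q)"
        by (rule IH) (use zn prem hz q_not T Fz Tq True late in \<open>force+\<close>)
      finally show ?thesis unfolding U_def c_def p'_def Tq .
    next
      case False
      then have lt: "T z < T q" using T Tq by simp
      have "(\<integral>\<^sup>+t'. ?H z (resample U T t') \<partial>P) = (\<integral>\<^sup>+t'. cpairs w0 n q z (resample (insert q (insert z (D' \<union> D1))) T t') \<partial>P)"
        by (intro nn_integral_cong) (use False Tq in \<open>simp add: U2 resample_in\<close>)
      also have "\<dots> \<le> ennreal ((1 / 2) ^ n * C * (F (T q) powr (- 1 / 2) + F (T z) powr (- 1 / 2)) * (19 / 20) ^ d q z)"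
        by (rule IH) (use zn prem hz q_not T Fz Tq lt late zD1 in \<open>force+\<close>)
      finally show ?thesis unfolding U_def c_def p'_def Tq by (simp add: add.commute d_sym[of q z])
    qed
  qed (use prem tx e fresh in \<open>auto simp: S_def Al_def\<close>)
  also have "\<dots> \<le> (\<integral>\<^sup>+z. ennreal ((c * (p powr (- 1 / 2) + p' powr (- 1 / 2))) / (- 1 / 2 + 1) * p * (19 / 20) ^ d z q) * ennreal ((1 - p) ^ fresh_card (d x z)) \<partial>count_space UNIV)"
  proof (intro nn_integral_mono)
    fix z
    have "(\<integral>\<^sup>+y. indicator {..<t x} y * ?B z y \<partial>\<mu>) = (\<integral>\<^sup>+y. ennreal (c * (19 / 20) ^ d z q) *
        (indicator {..<t x} y * ennreal (F y powr (- 1 / 2)) + indicator {..<t x} y * ennreal (p' powr (- 1 / 2))) \<partial>\<mu>)"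
      using c by (intro nn_integral_cong) (auto simp: ennreal_mult[symmetric] ennreal_plus[symmetric] algebra_simps simp del: ennreal_plus split: split_indicator)
    also have "\<dots> = ennreal (c * (19 / 20) ^ d z q) * ((\<integral>\<^sup>+y. indicator {..<t x} y * ennreal (F y powr (- 1 / 2)) \<partial>\<mu>) +
        (\<integral>\<^sup>+y. indicator {..<t x} y * ennreal (p' powr (- 1 / 2)) \<partial>\<mu>))"
      by (subst nn_integral_cmult) (auto simp: nn_integral_add)
    also have "(\<integral>\<^sup>+y. indicator {..<t x} y * ennreal (p' powr (- 1 / 2)) \<partial>\<mu>) = ennreal (p * p' powr (- 1 / 2))"
      using p by (subst nn_integral_multc) (auto simp: emeasure_lt p_def ennreal_mult)
    also have "ennreal (c * (19 / 20) ^ d z q) * ((\<integral>\<^sup>+y. indicator {..<t x} y * ennreal (F y powr (- 1 / 2)) \<partial>\<mu>) + ennreal (p * p' powr (- 1 / 2)))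
      \<le> ennreal (c * (19 / 20) ^ d z q) * (ennreal (p powr (- 1 / 2 + 1) / (- 1 / 2 + 1)) + ennreal (p * p' powr (- 1 / 2)))"
      unfolding p_def by (intro mult_left_mono add_right_mono nn_integral_F_powr) auto
    also have "\<dots> = ennreal (c * (19 / 20) ^ d z q * (p powr (- 1 / 2 + 1) / (- 1 / 2 + 1) + p * p' powr (- 1 / 2)))"
      using c p by (simp add: ennreal_mult[symmetric] ennreal_plus[symmetric] del: ennreal_plus)
    also have "\<dots> \<le> ennreal ((c * (p powr (- 1 / 2) + p' powr (- 1 / 2))) / (- 1 / 2 + 1) * p * (19 / 20) ^ d z q)"
    proof (rule ennreal_leI)
      have "p powr (- 1 / 2 + 1) = p powr (- 1 / 2) * p" using p by (simp only: powr_add) simp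
      then have e: "(c * (p powr (- 1 / 2) + p' powr (- 1 / 2))) / (- 1 / 2 + 1) * p * (19 / 20) ^ d z q
        - c * (19 / 20) ^ d z q * (p powr (- 1 / 2 + 1) / (- 1 / 2 + 1) + p * p' powr (- 1 / 2))
        = c * (19 / 20) ^ d z q * p * p' powr (- 1 / 2)"
        by (simp add: algebra_simps)
      have "0 \<le> c * (19 / 20) ^ d z q * p * p' powr (- 1 / 2)" using c p by simp
      then show "c * (19 / 20) ^ d z q * (p powr (- 1 / 2 + 1) / (- 1 / 2 + 1) + p * p' powr (- 1 / 2))
        \<le> (c * (p powr (- 1 / 2) + p' powr (- 1 / 2))) / (- 1 / 2 + 1) * p * (19 / 20) ^ d z q"
        using e by linarith
    qed
    finally have "(\<integral>\<^sup>+y. indicator {..<t x} y * ?B z y \<partial>\<mu>)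
      \<le> ennreal ((c * (p powr (- 1 / 2) + p' powr (- 1 / 2))) / (- 1 / 2 + 1) * p * (19 / 20) ^ d z q)" .
    then show "indicator Al z * ((\<integral>\<^sup>+y. indicator {..<t x} y * ?B z y \<partial>\<mu>) * ennreal ((1 - F (t x)) ^ fresh_card (d x z)))
      \<le> ennreal ((c * (p powr (- 1 / 2) + p' powr (- 1 / 2))) / (- 1 / 2 + 1) * p * (19 / 20) ^ d z q) * ennreal ((1 - p) ^ fresh_card (d x z))"
      unfolding p_def[symmetric] by (auto split: split_indicator intro: mult_right_mono)
  qed
  also have "\<dots> \<le> ennreal (c * (p powr (- 1 / 2) + p' powr (- 1 / 2)) * (19 / 20) ^ d x q / 2)"
    by (rule contraction) (use p c base_bounds jump_sum_p0[of p "19 / 20"] in auto)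
  also have "\<dots> = ennreal ((1 / 2) ^ Suc n * C * (F (t x) powr (- 1 / 2) + F (t q) powr (- 1 / 2)) * (19 / 20) ^ d x q)"
    by (simp add: c_def p_def p'_def mult.commute)
  finally show ?case unfolding S_def .
qed

definition mid :: "'v \<Rightarrow> 'v \<Rightarrow> 'v" where
  "mid x q = (SOME m. bet x m q \<and> d x m = d x q div 2)"

lemma mid: "bet x (mid x q) q" "d x (mid x q) = d x q div 2"
proof -
  have "\<exists>m. bet x m q \<and> d x m = d x q div 2" by (rule ex_between) simp
  from someI_ex[OF this] show "bet x (mid x q) q" "d x (mid x q) = d x q div 2"
    unfolding mid_def by auto
qed

text \<open>Counts the paths from \<open>x\<close> and from \<open>q\<close> that may cross the middle between \<open>x\<close> and \<open>q\<close>.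
  For neighbors the middle is one of them, and the value is set to \<open>1\<close>.\<close>

definition cross :: "'v \<Rightarrow> 'v \<Rightarrow> ('v \<Rightarrow> real) \<Rightarrow> ennreal" where
  "cross x q t = (if d x q < 2 then 1 else esc (mid x q) x t + esc (mid x q) q t)"

lemma cross_measurable [measurable]: "cross x q \<in> borel_measurable P"
  unfolding cross_def[abs_def] by measurable

text \<open>Passing from the distance to the middle to the whole distance replaces the base
  \<open>9 / 10\<close> by its square root, which is less than \<open>19 / 20\<close>; the factor \<open>2\<close> makes up for the
  rounding.\<close>

lemma half_power: "(9 / 10 :: real) ^ (n div 2) \<le> 2 * (19 / 20) ^ n"
proof -
  have "(9 / 10 :: real) ^ (n div 2) \<le> ((19 / 20)\<^sup>2) ^ (n div 2)" by (intro power_mono) (auto simp: power2_eq_square)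
  also have "\<dots> = (19 / 20) ^ (2 * (n div 2))" by (simp add: power_mult)
  also have "\<dots> \<le> (19 / 20) ^ (n - 1)" by (intro power_decreasing) auto
  also have "\<dots> \<le> 2 * (19 / 20) ^ n" by (cases n) auto
  finally show ?thesis .
qed

lemma cross_bound:
  assumes x: "x \<noteq> q" "x \<notin> {r, s}" "q \<notin> {r, s}" "history D x" "history D' q" "q \<notin> D" "x \<notin> D'"
      "0 < F (t x)" "F (t x) \<le> p0" "0 < F (t q)" "F (t q) \<le> p0" "t q < t x"
    and late: "\<And>u. u \<in> D \<union> D' \<Longrightarrow> t x \<le> tau t u"
  shows "(\<integral>\<^sup>+t'. cross x q (resample (insert x (insert q (D \<union> D'))) t t') \<partial>P)
    \<le> ennreal ((8 * K) * (F (t x) powr (- 1 / 2) + F (t q) powr (- 1 / 2)) * (19 / 20) ^ d x q)"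
proof (cases "d x q < 2")
  case True
  have ge: "1 \<le> y powr (- 1 / 2)" if "0 < y" "y \<le> p0" for y using that p0 powr_mono2'[of "- 1 / 2" y 1] by simp
  have "(1::real) \<le> 16 * 2 * (19 / 20) ^ 1" by simp
  also have "\<dots> \<le> (8 * K) * (F (t x) powr (- 1 / 2) + F (t q) powr (- 1 / 2)) * (19 / 20) ^ d x q"
    using K2 True ge[OF x(8,9)] ge[OF x(10,11)] by (intro mult_mono power_decreasing) auto
  finally show ?thesis using True by (simp add: cross_def)
next
  case False
  define m where "m = mid x q"
  define U where "U = insert x (insert q (D \<union> D'))"
  have m: "bet x m q" "d x m = d x q div 2" using mid by (auto simp: m_def)
  have dm: "d x m + d m q = d x q" using m by (simp add: bet_def)
  have ne: "x \<noteq> m" "m \<noteq> q" using m dm False by auto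
  have K: "0 \<le> 4 * real K" by simp
  have "(\<integral>\<^sup>+t'. esc m x (resample U t t') \<partial>P) \<le> ennreal (4 * K * F (t x) powr (- 1 / 2) * (9 / 10) ^ d x m)"
    using esc_bound[of x m q D t D'] m ne x late by (simp add: U_def insert_commute)
  also have "\<dots> \<le> ennreal (4 * K * F (t x) powr (- 1 / 2) * (2 * (19 / 20) ^ d x q))"
    unfolding m by (intro ennreal_leI mult_left_mono half_power) auto
  finally have 1: "(\<integral>\<^sup>+t'. esc m x (resample U t t') \<partial>P) \<le> ennreal (8 * K * F (t x) powr (- 1 / 2) * (19 / 20) ^ d x q)" by (simp add: mult_ac)
  have U2: "U = insert q (D' \<union> insert x D)" by (auto simp: U_def)
  have late': "\<And>u. u \<in> D' \<union> D \<Longrightarrow> t q \<le> tau t u" using late x(12) by (meson Un_iff less_imp_le order_trans)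
  have "(\<integral>\<^sup>+t'. esc m q (resample U t t') \<partial>P) \<le> ennreal (4 * K * F (t q) powr (- 1 / 2) * (9 / 10) ^ d q m)"
    unfolding U2 by (rule esc_bound) (use m(1) ne x late' in \<open>auto simp: bet_sym\<close>)
  also have "\<dots> \<le> ennreal (4 * K * F (t q) powr (- 1 / 2) * (2 * (19 / 20) ^ d x q))"
  proof (intro ennreal_leI mult_left_mono)
    have "(9 / 10 :: real) ^ d q m \<le> (9 / 10) ^ (d x q div 2)"
      using dm m(2) d_sym[of q m] by (intro power_decreasing) auto
    then show "(9 / 10 :: real) ^ d q m \<le> 2 * (19 / 20) ^ d x q" using half_power[of "d x q"] by linarith
  qed auto
  finally have 2: "(\<integral>\<^sup>+t'. esc m q (resample U t t') \<partial>P) \<le> ennreal (8 * K * F (t q) powr (- 1 / 2) * (19 / 20) ^ d x q)" by (simp add: mult_ac)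
  have "(\<integral>\<^sup>+t'. cross x q (resample U t t') \<partial>P) = (\<integral>\<^sup>+t'. esc m x (resample U t t') \<partial>P) + (\<integral>\<^sup>+t'. esc m q (resample U t t') \<partial>P)"
    using False by (simp add: cross_def m_def[symmetric] nn_integral_add)
  also have "\<dots> \<le> ennreal (8 * K * F (t x) powr (- 1 / 2) * (19 / 20) ^ d x q) + ennreal (8 * K * F (t q) powr (- 1 / 2) * (19 / 20) ^ d x q)"
    by (intro add_mono 1 2)
  also have "\<dots> = ennreal ((8 * K) * (F (t x) powr (- 1 / 2) + F (t q) powr (- 1 / 2)) * (19 / 20) ^ d x q)"
    by (simp add: ennreal_plus[symmetric] algebra_simps del: ennreal_plus)
  finally show ?thesis unfolding U_def .
qed

lemma AE_cpairs:
  assumes x: "x \<noteq> q" "x \<notin> {r, s}" "q \<notin> {r, s}"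
  shows "AE t in P. F (t x) \<le> p0 \<and> F (t q) \<le> p0 \<and> t q < t x \<longrightarrow> (INF n. cpairs cross n x q t) = 0"
proof -
  let ?Q = "\<lambda>t. 0 < F (t x) \<and> F (t x) \<le> p0 \<and> 0 < F (t q) \<and> F (t q) \<le> p0 \<and> t q < t x"
  let ?f = "\<lambda>t. (INF n. cpairs cross n x q t) * (if ?Q t then 1 else 0)"
  let ?S = "insert x (insert q ({} \<union> {}))"
  have m [measurable]: "cpairs cross n x q \<in> borel_measurable P" for n by (rule cpairs_measurable) simp
  have [measurable]: "Measurable.pred P ?Q" by measurable
  have f [measurable]: "?f \<in> borel_measurable P" by measurable
  have z: "(\<integral>\<^sup>+t'. ?f (resample ?S t t') \<partial>P) = 0" for t
  proof (cases "?Q t")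
    case False
    then have "(\<integral>\<^sup>+t'. ?f (resample ?S t t') \<partial>P) = (\<integral>\<^sup>+t'. 0 \<partial>P)"
      by (intro nn_integral_cong) (auto simp: resample_in)
    then show ?thesis by simp
  next
    case True
    have "AE t' in P. (INF n. cpairs cross n x q (resample ?S t t')) = 0"
    proof (rule AE_geometric[where c="8 * K * (F (t x) powr (- 1 / 2) + F (t q) powr (- 1 / 2)) * (19 / 20) ^ d x q"])
      fix n
      show "(\<integral>\<^sup>+t'. cpairs cross n x q (resample ?S t t') \<partial>P) \<le> ennreal ((1 / 2) ^ n * (8 * K * (F (t x) powr (- 1 / 2) + F (t q) powr (- 1 / 2)) * (19 / 20) ^ d x q))"
        using cpairs_decay[of "8 * K" cross x q "{}" "{}" t n] cross_bound x history_empty True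
        by (simp add: mult.assoc)
    qed auto
    then have "AE t' in P. ?f (resample ?S t t') = 0" by eventually_elim simp
    then have "(\<integral>\<^sup>+t'. ?f (resample ?S t t') \<partial>P) = (\<integral>\<^sup>+t'. 0 \<partial>P)" by (rule nn_integral_cong_AE)
    then show ?thesis by simp
  qed
  have "(\<integral>\<^sup>+t. ?f t \<partial>P) = (\<integral>\<^sup>+t. \<integral>\<^sup>+t'. ?f (resample ?S t t') \<partial>P \<partial>P)" by (rule nn_resample[OF f])
  also have "\<dots> = 0" unfolding z by simp
  finally have "AE t in P. ?f t = 0" by (subst (asm) nn_integral_0_iff_AE) auto
  then show ?thesis using AE_component[OF AE_F_pos, of x] AE_component[OF AE_F_pos, of q]
    by eventually_elim (auto split: if_splits)
qed

definition same_dir :: "(nat \<Rightarrow> 'v) \<Rightarrow> (nat \<Rightarrow> 'v) \<Rightarrow> bool" where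
  "same_dir X Y \<longleftrightarrow> (\<forall>k. \<exists>w. d r w = k \<and> eventually (\<lambda>n. bet r w (X n)) sequentially
     \<and> eventually (\<lambda>n. bet r w (Y n)) sequentially)"

text \<open>Since the count is below \<open>1\<close>, a vertex that the path has reached by jumps too short to
  cross \<open>m\<close> always has an earlier vertex closer than \<open>m\<close>; so the next jump is short too.\<close>

lemma no_escape:
  assumes X: "cand_ray t X" and m: "X 0 \<noteq> m" and e: "esc m (X 0) t < 1"
  shows "\<not> bet (X 0) m (X n)"
proof -
  let ?ok = "\<lambda>y z. d y z < d y m"
  have ok: "?ok (X n) (X (Suc n))" for n
  proof (induction n rule: less_induct)
    case (less n)
    have "reach m (X n) t \<le> cpaths ?ok (reach m) n (X 0) t" 
      by (rule cpaths_ge[where ok="?ok", OF X]) (rule less)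
    also have "\<dots> = (\<Sum>i\<in>{n}. cpaths ?ok (reach m) i (X 0) t)" by simp
    also have "\<dots> \<le> esc m (X 0) t" unfolding esc_def by (rule sum_le_suminf) auto
    finally have "reach m (X n) t \<noteq> 1" using e by auto
    then obtain u where u: "d (X n) u < d (X n) m" "\<not> tau t (X n) \<le> tau t u"
      unfolding reach_def by (auto simp: indicator_def split: if_splits)
    have "X (Suc n) \<in> cand t (X n)" using X by (simp add: cand_ray_def)
    then have "d (X n) (X (Suc n)) \<le> d (X n) u" using u(2) unfolding cand_iff by (auto simp: not_less[symmetric])
    then show ?case using u by simp
  qed
  show ?thesis
  proof (induction n)
    case 0 then show ?case using m bet_self by metis
  next
    case (Suc n)
    have "\<not> bet (X n) m (X (Suc n))" using ok[of n] by (auto simp: bet_def)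
    then show ?case using Suc same_branch_trans by blast
  qed
qed

lemma subtree_avoids: "bet v w y \<Longrightarrow> bet v w y' \<Longrightarrow> d v m < d v w \<Longrightarrow> \<not> bet y m y'"
proof
  assume a: "bet v w y" "bet v w y'" "d v m < d v w" "bet y m y'"
  have *: False if "bet v w z" "bet w m z" for z
    using that a(3) d_triangle[of v z m] unfolding bet_def by linarith
  from tripod[OF a(4), of w] show False
    using *[of y] *[of y'] a bet_sym by blast
qed

text \<open>The common direction puts both paths eventually into one subtree that does not contain
  the middle \<open>m\<close>; so one of the paths has crossed \<open>m\<close>.\<close>

lemma same_dir_cross:
  assumes X: "cand_ray t X" and Y: "cand_ray t Y" and ne: "X 0 \<noteq> Y 0" and sd: "same_dir X Y"
  shows "1 \<le> cross (X 0) (Y 0) t"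
proof (rule ccontr)
  assume "\<not> 1 \<le> cross (X 0) (Y 0) t"
  then have c: "cross (X 0) (Y 0) t < 1" by simp
  define m where "m = mid (X 0) (Y 0)"
  have far: "\<not> d (X 0) (Y 0) < 2" using c by (auto simp: cross_def)
  have m: "bet (X 0) m (Y 0)" "d (X 0) m = d (X 0) (Y 0) div 2" using mid by (auto simp: m_def)
  have mX: "X 0 \<noteq> m" using m far by auto
  have mY: "Y 0 \<noteq> m" using m far unfolding bet_def by auto
  have sum: "esc m (X 0) t + esc m (Y 0) t < 1" using c far by (simp add: cross_def m_def)
  have eX: "esc m (X 0) t < 1" by (rule le_less_trans[OF _ sum]) simp
  have eY: "esc m (Y 0) t < 1" by (rule le_less_trans[OF _ sum]) simp
  \<comment> \<open>one level farther from the root than \<open>m\<close>, so that the subtree below \<open>w\<close> does not contain \<open>m\<close>\<close>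
  obtain w where w: "d r w = Suc (d r m)" "eventually (\<lambda>n. bet r w (X n)) sequentially"
    "eventually (\<lambda>n. bet r w (Y n)) sequentially" using sd unfolding same_dir_def by blast
  obtain n where n: "bet r w (X n)" "bet r w (Y n)"
    using eventually_happens'[OF sequentially_bot eventually_conj[OF w(2,3)]] by blast
  have "\<not> bet (X n) m (Y n)" by (rule subtree_avoids[OF n]) (simp add: w(1))
  then have "\<not> bet (X 0) m (Y n)" using no_escape[OF X mX eX, of n] same_branch_trans by blast
  moreover have "\<not> bet (Y n) m (Y 0)" using no_escape[OF Y mY eY, of n] bet_sym by blast
  ultimately have "\<not> bet (X 0) m (Y 0)" using same_branch_trans by blast
  then show False using m by simp
qed

lemma same_dir_sym: "same_dir X Y \<longleftrightarrow> same_dir Y X"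
  unfolding same_dir_def by (simp add: conj_commute conj_left_commute)

lemma same_dir_shift: "same_dir X Y \<Longrightarrow> same_dir (\<lambda>n. X (i + n)) (\<lambda>n. Y (j + n))"
  unfolding same_dir_def
proof (intro allI)
  fix k assume "\<forall>k. \<exists>w. d r w = k \<and> eventually (\<lambda>n. bet r w (X n)) sequentially
     \<and> eventually (\<lambda>n. bet r w (Y n)) sequentially"
  then obtain w where w: "d r w = k" "eventually (\<lambda>n. bet r w (X n)) sequentially"
    "eventually (\<lambda>n. bet r w (Y n)) sequentially" by blast
  then show "\<exists>w. d r w = k \<and> eventually (\<lambda>n. bet r w (X (i + n))) sequentially
     \<and> eventually (\<lambda>n. bet r w (Y (j + n))) sequentially"
    using sequentially_offset[OF w(2), of i] sequentially_offset[OF w(3), of j]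
    by (intro exI[of _ w]) (simp add: add.commute)
qed

text \<open>After any number of steps, the current pair of vertices is again the start of two
  paths with a common direction, and so contributes at least \<open>1\<close>.\<close>

lemma cpairs_ge:
  assumes "inj t" "cand_ray t X" "cand_ray t Y" "\<And>i j. X i \<noteq> Y j" "same_dir X Y" "t (Y 0) < t (X 0)"
  shows "1 \<le> cpairs cross n (X 0) (Y 0) t"
  using assms(2-)
proof (induction n arbitrary: X Y)
  case 0
  then show ?case using same_dir_cross[of t X Y] by simp
next
  case (Suc n)
  define X' where "X' = (\<lambda>n. X (1 + n))"
  have X': "cand_ray t X'" "same_dir X' Y" "\<And>i j. X' i \<noteq> Y j"
    using cand_ray_Suc[of t X 1] same_dir_shift[of X Y 1 0] Suc.prems by (auto simp: X'_def)
  let ?g = "\<lambda>z. if t (Y 0) < t z then cpairs cross n z (Y 0) t else cpairs cross n (Y 0) z t"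
  have "1 \<le> ?g (X' 0)"
  proof (cases "t (Y 0) < t (X' 0)")
    case True
    then show ?thesis using Suc.IH[OF X'(1) Suc.prems(2) X'(3) X'(2) True] by simp
  next
    case False
    have "t (X' 0) \<noteq> t (Y 0)" using X'(3) assms(1) by (auto dest: injD)
    then have lt: "t (X' 0) < t (Y 0)" using False by simp
    have "1 \<le> cpairs cross n (Y 0) (X' 0) t"
      by (rule Suc.IH) (use X' Suc.prems lt same_dir_sym in \<open>auto dest: not_sym\<close>)
    then show ?thesis using False by simp
  qed
  also have "?g (X' 0) \<le> cpairs cross (Suc n) (X 0) (Y 0) t"
    unfolding cpairs.simps
    by (rule cand_sum_ge) (use Suc.prems in \<open>auto simp: cand_ray_def X'_def\<close>)
  finally show ?case .
qed

lemma AE_inj: "AE t in P. inj t"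
proof -
  have "AE t in P. v \<noteq> w \<longrightarrow> t v \<noteq> t w" for v w
  proof (cases "v = w")
    case False
    let ?f = "\<lambda>t. indicator {t. t v = t w} t :: ennreal"
    have [measurable]: "{t. t v = t w} \<in> sets P"
    proof -
      have "{t \<in> space P. t v = t w} \<in> sets P" by (rule borel_measurable_eq) (rule comp_measurable)+
      then show ?thesis by simp
    qed
    have "(\<integral>\<^sup>+t. ?f t \<partial>P) = (\<integral>\<^sup>+t. \<integral>\<^sup>+t'. ?f (resample {v} t t') \<partial>P \<partial>P)" by (rule nn_resample) measurable
    also have "\<dots> = (\<integral>\<^sup>+t. 0 \<partial>P)"
    proof (rule nn_integral_cong)
      fix t
      have "AE t' in P. ?f (resample {v} t t') = 0"
        using AE_component[OF AE_neq[of "t v"], of w]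
        by eventually_elim (use False in \<open>auto simp: resample_def\<close>)
      then have "(\<integral>\<^sup>+t'. ?f (resample {v} t t') \<partial>P) = (\<integral>\<^sup>+t'. 0 \<partial>P)" by (rule nn_integral_cong_AE)
      then show "(\<integral>\<^sup>+t'. ?f (resample {v} t t') \<partial>P) = 0" by simp
    qed
    also have "\<dots> = 0" by simp
    finally have z: "(\<integral>\<^sup>+t. ?f t \<partial>P) = 0" .
    have "?f \<in> borel_measurable P" by measurable
    from nn_integral_0_iff_AE[OF this] have "AE t in P. ?f t = 0" using z by (rule iffD1)
    then show ?thesis by eventually_elim (auto simp: indicator_def split: if_splits)
  qed simp
  then have "AE t in P. \<forall>v\<in>UNIV. \<forall>w\<in>UNIV. v \<noteq> w \<longrightarrow> t v \<noteq> t w"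
    unfolding AE_ball_countable[OF countable_UNIV] by blast
  then show ?thesis by eventually_elim (auto simp: inj_def)
qed

text \<open>The almost sure properties of the times from which everything else is deduced for
  fixed times. They concern all paths of candidates at once.\<close>

definition good :: "('v \<Rightarrow> real) \<Rightarrow> bool" where
  "good t \<longleftrightarrow> (\<forall>v. 0 < F (t v)) \<and> (\<forall>X q. cand_ray t X \<longrightarrow> 0 < q \<longrightarrow> (\<exists>n. F (t (X n)) < q)) \<and>
     (\<forall>X Y. cand_ray t X \<longrightarrow> cand_ray t Y \<longrightarrow> (\<forall>i j. X i \<noteq> Y j) \<longrightarrow> \<not> same_dir X Y)"

text \<open>Two disjoint paths with a common direction eventually have small times, and from there on
  they would contribute at least \<open>1\<close> to expectations that decay geometrically.\<close>

lemma AE_good: "AE t in P. good t"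
proof -
  have 1: "AE t in P. \<forall>v\<in>UNIV. 0 < F (t v)"
    by (subst AE_ball_countable[OF countable_UNIV]) (use AE_component[OF AE_F_pos] in auto)
  have "AE t in P. x \<noteq> q \<and> x \<notin> {r, s} \<and> q \<notin> {r, s} \<longrightarrow>
    F (t x) \<le> p0 \<and> F (t q) \<le> p0 \<and> t q < t x \<longrightarrow> (INF n. cpairs cross n x q t) = 0" for x q
  proof (cases "x \<noteq> q \<and> x \<notin> {r, s} \<and> q \<notin> {r, s}")
    case True then show ?thesis using AE_cpairs[of x q] by simp
  next
    case False then show ?thesis by (intro AE_I2) blast
  qed
  then have 2: "AE t in P. \<forall>x\<in>UNIV. \<forall>q\<in>UNIV. x \<noteq> q \<and> x \<notin> {r, s} \<and> q \<notin> {r, s} \<longrightarrow>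
    F (t x) \<le> p0 \<and> F (t q) \<le> p0 \<and> t q < t x \<longrightarrow> (INF n. cpairs cross n x q t) = 0"
    unfolding AE_ball_countable[OF countable_UNIV] by blast
  from 1 2 AE_times_vanish AE_inj show ?thesis
  proof eventually_elim
    fix t
    assume pos: "\<forall>v\<in>UNIV. 0 < F (t v)" and inj: "inj t"
      and pairs: "\<forall>x\<in>UNIV. \<forall>q\<in>UNIV. x \<noteq> q \<and> x \<notin> {r, s} \<and> q \<notin> {r, s} \<longrightarrow>
        F (t x) \<le> p0 \<and> F (t q) \<le> p0 \<and> t q < t x \<longrightarrow> (INF n. cpairs cross n x q t) = 0"
      and van: "\<forall>X q. cand_ray t X \<longrightarrow> 0 < q \<longrightarrow> (\<exists>n. F (t (X n)) < q)"
    have no: False if c: "cand_ray t X" "cand_ray t Y" "\<And>i j. X i \<noteq> Y j" "same_dir X Y"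
      "F (t (X 0)) < p0" "F (t (Y 0)) < p0" "t (Y 0) < t (X 0)" for X Y
    proof -
      have "1 \<le> (INF n. cpairs cross n (X 0) (Y 0) t)"
        by (rule INF_greatest) (rule cpairs_ge[OF inj c(1-4,7)])
      also have "\<dots> = 0" using pairs[rule_format, of "X 0" "Y 0"] c unfolding cand_ray_def by auto
      finally show False by simp
    qed
    have "\<not> same_dir X Y" if c: "cand_ray t X" "cand_ray t Y" "\<forall>i j. X i \<noteq> Y j" for X Y
    proof
      assume sd: "same_dir X Y"
      obtain i where i: "F (t (X i)) < p0" using van[rule_format, OF c(1) p0(1)] by auto
      obtain j where j: "F (t (Y j)) < p0" using van[rule_format, OF c(2) p0(1)] by auto
      define X' where "X' = (\<lambda>n. X (i + n))"
      define Y' where "Y' = (\<lambda>n. Y (j + n))"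
      have *: "cand_ray t X'" "cand_ray t Y'" "\<And>i j. X' i \<noteq> Y' j" "same_dir X' Y'" "F (t (X' 0)) < p0" "F (t (Y' 0)) < p0"
        using cand_ray_Suc[OF c(1)] cand_ray_Suc[OF c(2)] c(3) same_dir_shift[OF sd] i j by (simp_all add: X'_def Y'_def)
      have "t (X' 0) \<noteq> t (Y' 0)" using *(3)[of 0 0] inj by (auto dest: injD)
      then consider "t (Y' 0) < t (X' 0)" | "t (X' 0) < t (Y' 0)" by linarith
      then show False
      proof cases
        case 1 then show False by (rule no[OF *])
      next
        case 2
        have ne: "Y' i \<noteq> X' j" for i j using *(3)[of j i] by simp
        show False by (rule no[OF *(2,1) ne _ *(6,5) 2]) (use *(4) same_dir_sym in simp)
      qed
    qed
    then show "good t" unfolding good_def using pos van by simp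
  qed
qed

section \<open>Ancestral paths\<close>

definition candG :: "'v set \<Rightarrow> ('v \<Rightarrow> real) \<Rightarrow> 'v \<Rightarrow> 'v set" where
  "candG G t x = parent_candidates E G (tau t) x"

lemma cand_candG: "cand t x = candG UNIV t x" by (simp add: cand_def candG_def)

text \<open>The ancestral path, kept constant once it has reached a seed.\<close>

definition anc_path :: "('v \<Rightarrow> 'v) \<Rightarrow> 'v \<Rightarrow> nat \<Rightarrow> 'v" where
  "anc_path g v n = ((\<lambda>u. if u \<in> {r, s} then u else g u) ^^ n) v"

lemma anc_path_0 [simp]: "anc_path g v 0 = v" by (simp add: anc_path_def)

lemma anc_path_Suc: "anc_path g v (Suc n) = (if anc_path g v n \<in> {r, s} then anc_path g v n else g (anc_path g v n))"
  by (simp add: anc_path_def)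

lemma anc_path_add: "anc_path g v (m + n) = anc_path g (anc_path g v m) n"
  unfolding anc_path_def by (subst add.commute) (simp add: funpow_add)

lemma anc_path_seed: "v \<in> {r, s} \<Longrightarrow> anc_path g v n = v"
  by (induction n) (auto simp: anc_path_Suc)

lemma anc_path_step: "v \<notin> {r, s} \<Longrightarrow> anc_path g v (Suc n) = anc_path g (g v) n"
  using anc_path_add[of g v 1 n] by (simp add: anc_path_Suc[of g v 0])

lemma anc_path_seed_const: "anc_path g v m \<in> {r, s} \<Longrightarrow> m \<le> n \<Longrightarrow> anc_path g v n = anc_path g v m"
  using anc_path_add[of g v m "n - m"] anc_path_seed by simp

definition selects :: "'v set \<Rightarrow> ('v \<Rightarrow> real) \<Rightarrow> ('v \<Rightarrow> 'v) \<Rightarrow> bool" where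
  "selects G t g \<longleftrightarrow> (\<forall>y\<in>G - {r, s}. g y \<in> candG G t y)"

lemma candG_time: "z \<in> candG G t y \<Longrightarrow> tau t z < tau t y" and candG_G: "z \<in> candG G t y \<Longrightarrow> z \<in> G"
  by (auto simp: candG_def parent_candidates_def)

lemma candG_near: "z \<in> candG G t y \<Longrightarrow> u \<in> G \<Longrightarrow> tau t u < tau t y \<Longrightarrow> d y z \<le> d y u"
  by (auto simp: candG_def parent_candidates_def)

lemma selects_anc_path_G: "selects G t g \<Longrightarrow> v \<in> G \<Longrightarrow> anc_path g v n \<in> G"
proof (induction n)
  case (Suc n)
  then show ?case by (cases "anc_path g v n \<in> {r, s}") (auto simp: anc_path_Suc selects_def dest: candG_G)
qed simp

lemma tau_seed [simp]: "tau t r = 0" "tau t s = 0" by (simp_all add: with_seeds_def)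

section \<open>Trapping\<close>

text \<open>The radius \<open>2 * k\<close> contains every vertex whose distance from the level-\<open>k\<close> ancestor of
  \<open>y\<close> is not larger than that of \<open>r\<close>.\<close>

definition low :: "nat \<Rightarrow> ('v \<Rightarrow> real) \<Rightarrow> 'v \<Rightarrow> bool" where
  "low k t y \<longleftrightarrow> y \<notin> {r, s} \<and> (\<forall>u\<in>gball E r (2 * k) - {r, s}. t y < t u)"

lemma low_far: "low k t y \<Longrightarrow> 2 * k < d r y"
  by (rule ccontr) (auto simp: low_def gball_def)

definition tree_anc :: "nat \<Rightarrow> 'v \<Rightarrow> 'v" where
  "tree_anc k y = (SOME w. d r w = k \<and> bet r w y)"

lemma tree_anc: assumes "k \<le> d r y" shows "d r (tree_anc k y) = k" "bet r (tree_anc k y) y"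
proof -
  have "\<exists>w. d r w = k \<and> bet r w y" using ex_between[OF assms] by auto
  from someI_ex[OF this] show "d r (tree_anc k y) = k" "bet r (tree_anc k y) y" unfolding tree_anc_def by auto
qed

lemma tree_anc_eq: "bet r w y \<Longrightarrow> tree_anc (d r w) y = w"
proof -
  assume a: "bet r w y"
  then have "d r w \<le> d r y" by (simp add: bet_def)
  from tree_anc[OF this] show ?thesis using bet_antisym a by metis
qed

lemma low_tree_anc: "low k t y \<Longrightarrow> d r (tree_anc k y) = k \<and> bet r (tree_anc k y) y"
  using tree_anc[of k y] low_far[of k t y] by simp

text \<open>Below \<open>w\<close>, both seeds are reached through \<open>w\<close>. A candidate is at most as far away as
  either seed, which gives the last two claims. If it is not below \<open>w\<close> itself, then it is at most
  as far from \<open>w\<close> as \<open>r\<close>, and hence within distance \<open>2 * k\<close> of \<open>r\<close>, where only the seeds are early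
  enough.\<close>

lemma trap:
  assumes k: "d r s < k" and G: "r \<in> G" "s \<in> G" and y: "low k t y" "0 < t y"
    and w: "d r w = k" "bet r w y" and z: "z \<in> candG G t y"
  shows "z \<in> {r, s} \<or> (bet r w z \<and> low k t z)"
    and "z = r \<Longrightarrow> d w r \<le> d w s" and "z = s \<Longrightarrow> d w s \<le> d w r"
proof -
  have yn: "y \<notin> {r, s}" using y by (simp add: low_def)
  have ty: "tau t y = t y" by (rule tau_nonseed[OF yn])
  have out: "bet y w u" if "\<not> bet r w u" for u
    using tripod[OF w(2), of u] that bet_sym by blast
  have "\<not> bet r w s" using k w(1) by (auto simp: bet_def)
  then have ys: "d y s = d y w + d w s" using out by (simp add: bet_def)
  have yr: "d y r = d y w + d w r" using w(2) bet_sym[of r w y] by (simp add: bet_def)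
  have nr: "d y z \<le> d y r" and ns: "d y z \<le> d y s"
    using candG_near[OF z] G y ty by auto
  show "z = r \<Longrightarrow> d w r \<le> d w s" using ns ys yr by simp
  show "z = s \<Longrightarrow> d w s \<le> d w r" using nr ys yr by simp
  show "z \<in> {r, s} \<or> (bet r w z \<and> low k t z)"
  proof (cases "z \<in> {r, s}")
    case False
    have lt: "t z < t y" using candG_time[OF z] ty tau_nonseed[OF False, of t] by simp
    have "bet r w z"
    proof (rule ccontr)
      assume "\<not> bet r w z"
      then have "d y z = d y w + d w z" using out by (simp add: bet_def)
      then have "d w z \<le> k" using nr yr w(1) d_sym[of w r] by simp
      then have "z \<in> gball E r (2 * k)" using d_triangle[of r z w] w(1) by (simp add: gball_def)
      then have "t y < t z" using y(1) False by (auto simp: low_def)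
      then show False using lt by simp
    qed
    moreover have "t z < t u" if "u \<in> gball E r (2 * k) - {r, s}" for u
      using y(1) that lt unfolding low_def by (meson less_trans)
    ultimately show ?thesis using False by (simp add: low_def)
  qed simp
qed

lemma trapped_path:
  fixes t :: "'v \<Rightarrow> real"
  assumes k: "d r s < k" and G: "r \<in> G" "s \<in> G" and pos: "\<And>v. 0 < t v" and g: "selects G t g"
    and y: "y \<in> G" "low k t y"
  defines "w \<equiv> tree_anc k y"
  shows "(anc_path g y n \<notin> {r, s} \<longrightarrow> bet r w (anc_path g y n) \<and> low k t (anc_path g y n)) \<and>
    (anc_path g y n = r \<longrightarrow> d w r \<le> d w s) \<and> (anc_path g y n = s \<longrightarrow> d w s \<le> d w r)"
proof (induction n)
  case 0
  then show ?case using y low_tree_anc[OF y(2)] by (auto simp: w_def low_def)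
next
  case (Suc n)
  show ?case
  proof (cases "anc_path g y n \<in> {r, s}")
    case True then show ?thesis using Suc by (simp add: anc_path_Suc)
  next
    case False
    have "anc_path g y (Suc n) \<in> candG G t (anc_path g y n)"
      using False g selects_anc_path_G[OF g y(1), of n] by (simp add: anc_path_Suc selects_def)
    then show ?thesis
      using trap[OF k G, where t=t and y="anc_path g y n" and w=w and z="anc_path g y (Suc n)"] pos Suc False low_tree_anc[OF y(2)]
      unfolding w_def by blast
  qed
qed

section \<open>The first low vertex of an ancestral path\<close>

definition stopped :: "nat \<Rightarrow> ('v \<Rightarrow> real) \<Rightarrow> 'v \<Rightarrow> bool" where
  "stopped k t v \<longleftrightarrow> v \<in> {r, s} \<or> low k t v"

definition entry :: "nat \<Rightarrow> ('v \<Rightarrow> real) \<Rightarrow> ('v \<Rightarrow> 'v) \<Rightarrow> 'v \<Rightarrow> 'v" where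
  "entry k t g v = anc_path g v (LEAST n. stopped k t (anc_path g v n))"

lemma entry_stopped: "stopped k t v \<Longrightarrow> entry k t g v = v"
proof -
  assume "stopped k t v"
  then have "(LEAST n. stopped k t (anc_path g v n)) = 0" by (intro Least_eq_0) simp
  then show ?thesis by (simp add: entry_def)
qed

lemma entry_step:
  assumes "\<not> stopped k t v" "\<exists>n. stopped k t (anc_path g (g v) n)"
  shows "entry k t g v = entry k t g (g v)"
proof -
  have v: "v \<notin> {r, s}" using assms(1) by (auto simp: stopped_def)
  obtain n where n: "stopped k t (anc_path g v (Suc n))" using assms(2) anc_path_step[OF v] by metis
  have "(LEAST n. stopped k t (anc_path g v n)) = Suc (LEAST n. stopped k t (anc_path g v (Suc n)))"
    by (rule Least_Suc[where P="\<lambda>n. stopped k t (anc_path g v n)", OF n]) (use assms(1) in simp)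
  then show ?thesis unfolding entry_def by (simp add: anc_path_step[OF v])
qed

lemma entry_ex: "\<exists>n. stopped k t (anc_path g v n) \<Longrightarrow> stopped k t (entry k t g v) \<and> (\<exists>n. entry k t g v = anc_path g v n)"
  unfolding entry_def by (metis LeastI_ex)

text \<open>One step of the exploration of candidates up to the first stopped vertices.\<close>

definition expl :: "nat \<Rightarrow> ('v \<Rightarrow> real) \<Rightarrow> ('v \<times> 'v) set" where
  "expl k t = {(z, y). \<not> stopped k t y \<and> z \<in> cand t y}"

text \<open>Along an infinite sequence of candidates the times become smaller than those of the
  finitely many vertices around the seeds.\<close>

lemma wf_expl: assumes "good t" shows "wf (expl k t)"
  unfolding wf_iff_no_infinite_down_chain
proof
  assume "\<exists>f. \<forall>i. (f (Suc i), f i) \<in> expl k t"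
  then obtain f where f: "\<And>i. \<not> stopped k t (f i)" "\<And>i. f (Suc i) \<in> cand t (f i)" by (auto simp: expl_def)
  have "cand_ray t f" using f by (auto simp: cand_ray_def stopped_def)
  define A where "A = gball E r (2 * k) - {r, s}"
  have ne: "\<exists>u\<in>A. t u \<le> t (f i)" for i using f(1)[of i] by (auto simp: stopped_def low_def A_def not_less)
  have A: "finite A" "A \<noteq> {}" using ne by (auto simp: A_def)
  define m where "m = Min (t ` A)"
  have "m \<in> t ` A" using A by (simp add: m_def)
  then have "0 < F m" using assms by (auto simp: good_def)
  then obtain n where "F (t (f n)) < F m" using assms \<open>cand_ray t f\<close> unfolding good_def by blast
  then have "t (f n) < m" using F_mono[of m "t (f n)"] by linarith
  moreover obtain u where "u \<in> A" "t u \<le> t (f n)" using ne by blast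
  ultimately have "t u < m" by simp
  moreover have "m \<le> t u" using A \<open>u \<in> A\<close> by (simp add: m_def)
  ultimately show False by simp
qed

lemma finite_cand: "finite (candG G t y)"
proof (cases "candG G t y = {}")
  case False
  then obtain z where z: "z \<in> candG G t y" by blast
  have "candG G t y \<subseteq> gball E y (d y z)"
    using candG_near candG_G[OF z] candG_time[OF z] by (auto simp: gball_def)
  then show ?thesis by (rule finite_subset) simp
qed simp

definition explored :: "nat \<Rightarrow> ('v \<Rightarrow> real) \<Rightarrow> 'v \<Rightarrow> 'v set" where
  "explored k t v = {y. (y, v) \<in> (expl k t)\<^sup>*}"

lemma explored_self [simp]: "v \<in> explored k t v" by (simp add: explored_def)

lemma explored_trans: "y \<in> explored k t v \<Longrightarrow> z \<in> explored k t y \<Longrightarrow> z \<in> explored k t v"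
  unfolding explored_def by (auto intro: rtrancl_trans)

lemma explored_step: "\<not> stopped k t y \<Longrightarrow> z \<in> cand t y \<Longrightarrow> z \<in> explored k t y"
  unfolding explored_def expl_def by auto

text \<open>A finitely branching well-founded relation has finite trees of descendants.\<close>

lemma finite_explored: assumes "good t" shows "finite (explored k t v)"
  using wf_expl[OF assms, of k]
proof (induction v rule: wf_induct_rule)
  case (less v)
  let ?A = "{z. (z, v) \<in> expl k t}"
  have "finite ?A" using finite_cand[of UNIV t v] unfolding expl_def cand_candG by simp
  moreover have "explored k t v \<subseteq> insert v (\<Union>z\<in>?A. explored k t z)"
  proof
    fix y assume "y \<in> explored k t v"
    then have "(y, v) \<in> (expl k t)\<^sup>*" by (simp add: explored_def)
    then show "y \<in> insert v (\<Union>z\<in>?A. explored k t z)"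
      by (cases rule: rtranclE) (auto simp: explored_def)
  qed
  moreover have "finite (explored k t z)" if "z \<in> ?A" for z using less that by simp
  ultimately show ?case using finite_subset[of _ "insert v (\<Union>z\<in>?A. explored k t z)"] by blast
qed

text \<open>Well-founded induction along the exploration gives existence of an entry point
  together with its dependence on the parents of explored vertices only.\<close>

lemma entry_props:
  assumes t: "good t"
  shows "(\<forall>y\<in>explored k t v. \<not> stopped k t y \<longrightarrow> g y \<in> cand t y) \<Longrightarrow>
    (\<exists>n. stopped k t (anc_path g v n)) \<and>
    ((\<forall>y\<in>explored k t v. \<not> stopped k t y \<longrightarrow> g' y = g y) \<longrightarrow> entry k t g' v = entry k t g v)"
  using wf_expl[OF t, of k]
proof (induction v rule: wf_induct_rule)
  case (less v)
  show ?case
  proof (cases "stopped k t v")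
    case True
    then have "stopped k t (anc_path g v 0)" by simp
    then show ?thesis using entry_stopped[OF True] by metis
  next
    case False
    have v: "v \<notin> {r, s}" using False by (auto simp: stopped_def)
    have gv: "g v \<in> cand t v" using less.prems False by simp
    have sub: "y \<in> explored k t (g v) \<Longrightarrow> y \<in> explored k t v" for y
      using explored_trans explored_step[OF False gv] by blast
    have pr: "\<forall>y\<in>explored k t (g v). \<not> stopped k t y \<longrightarrow> g y \<in> cand t y" using less.prems sub by blast
    have IH: "\<exists>n. stopped k t (anc_path g (g v) n)"
      "(\<forall>y\<in>explored k t (g v). \<not> stopped k t y \<longrightarrow> g' y = g y) \<longrightarrow> entry k t g' (g v) = entry k t g (g v)"
      using less.IH[of "g v"] pr False gv unfolding expl_def by auto
    obtain n where n: "stopped k t (anc_path g (g v) n)" using IH by blast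
    then have ex: "\<exists>n. stopped k t (anc_path g v n)" using anc_path_step[OF v, of g n] by metis
    moreover have "entry k t g' v = entry k t g v" if a: "\<forall>y\<in>explored k t v. \<not> stopped k t y \<longrightarrow> g' y = g y"
    proof -
      have g': "g' v = g v" using a False by simp
      have a': "\<forall>y\<in>explored k t (g v). \<not> stopped k t y \<longrightarrow> g' y = g y" using a sub by blast
      have eq: "entry k t g' (g v) = entry k t g (g v)" using IH(2) a' by blast
      have "\<exists>n. stopped k t (anc_path g' (g v) n)"
      proof -
        have pr': "\<forall>y\<in>explored k t (g v). \<not> stopped k t y \<longrightarrow> g' y \<in> cand t y" using pr a' by simp
        have "\<exists>n. stopped k t (anc_path g' u n)" if "\<forall>y\<in>explored k t u. \<not> stopped k t y \<longrightarrow> g' y \<in> cand t y" for u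
          using wf_expl[OF t, of k] that
        proof (induction u rule: wf_induct_rule)
          case (less u)
          show ?case
          proof (cases "stopped k t u")
            case True then show ?thesis by (intro exI[of _ 0]) simp
          next
            case nst: False
            have gu: "g' u \<in> cand t u" using less.prems nst by simp
            have "\<forall>y\<in>explored k t (g' u). \<not> stopped k t y \<longrightarrow> g' y \<in> cand t y"
              using less.prems explored_trans explored_step[OF nst gu] by blast
            then obtain n where "stopped k t (anc_path g' (g' u) n)"
              using less.IH[of "g' u"] nst gu unfolding expl_def by auto
            moreover have "u \<notin> {r, s}" using nst by (auto simp: stopped_def)
            ultimately show ?thesis using anc_path_step[of u g' n] by metis
          qed
        qed
        then show ?thesis using pr' by blast
      qed
      then show ?thesis using entry_step[OF False, of g'] entry_step[OF False IH(1)] g' eq by simp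
    qed
    ultimately show ?thesis by blast
  qed
qed

text \<open>The seed \<open>r\<close> is early enough to be a parent, so the candidates are no farther from \<open>y\<close>
  than \<open>r\<close> is.\<close>

lemma candG_ball:
  assumes "2 * d r y \<le> l" "y \<notin> {r, s}" "0 < t y"
  shows "candG (gball E r l) t y = cand t y"
proof -
  let ?G = "gball E r l"
  have r: "tau t r < tau t y" using assms by (simp add: tau_nonseed)
  have rG: "r \<in> ?G" by (simp add: gball_def)
  have inG: "u \<in> ?G" if "d y u \<le> d y r" for u
    using that assms(1) d_triangle[of r u y] d_sym[of r y] by (simp add: gball_def)
  show ?thesis unfolding cand_candG
  proof (intro set_eqI iffI)
    fix z assume z: "z \<in> candG ?G t y"
    have zr: "d y z \<le> d y r" using candG_near[OF z rG r] .
    have "d y z \<le> d y u" if "tau t u < tau t y" for u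
    proof (cases "u \<in> ?G")
      case True then show ?thesis using candG_near[OF z _ that] by simp
    next
      case False then show ?thesis using inG[of u] zr by linarith
    qed
    then show "z \<in> candG UNIV t y" using candG_time[OF z] by (auto simp: candG_def parent_candidates_def)
  next
    fix z assume z: "z \<in> candG UNIV t y"
    have "z \<in> ?G" by (rule inG) (use candG_near[OF z _ r] in simp)
    then show "z \<in> candG ?G t y" using candG_time[OF z] candG_near[OF z] by (auto simp: candG_def parent_candidates_def)
  qed
qed

section \<open>Components and their directions\<close>

definition hits :: "('v \<Rightarrow> 'v) \<Rightarrow> 'v \<Rightarrow> 'v \<Rightarrow> bool" where "hits g v a \<longleftrightarrow> (\<exists>n. anc_path g v n = a)"

lemma graph_rtrancl:
  assumes "\<And>y. y \<in> G - {r, s} \<Longrightarrow> g y \<in> G" "v \<in> G"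
  shows "(v, u) \<in> (genealogical_graph r s G g)\<^sup>* \<longleftrightarrow> hits g v u"
proof
  assume "(v, u) \<in> (genealogical_graph r s G g)\<^sup>*"
  then show "hits g v u"
  proof (induction rule: rtrancl_induct)
    case base then show ?case by (auto simp: hits_def intro: exI[of _ 0])
  next
    case (step y z)
    then obtain n where n: "anc_path g v n = y" by (auto simp: hits_def)
    have "anc_path g v (Suc n) = z" using step(2) n by (auto simp: genealogical_graph_def anc_path_Suc)
    then show ?case by (auto simp: hits_def)
  qed
next
  assume "hits g v u"
  then obtain n where n: "anc_path g v n = u" by (auto simp: hits_def)
  have "(v, anc_path g v n) \<in> (genealogical_graph r s G g)\<^sup>* \<and> anc_path g v n \<in> G"
  proof (induction n)
    case (Suc n)
    show ?case
    proof (cases "anc_path g v n \<in> {r, s}")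
      case True then show ?thesis using Suc by (simp add: anc_path_Suc)
    next
      case False
      then have "(anc_path g v n, g (anc_path g v n)) \<in> genealogical_graph r s G g" using Suc by (auto simp: genealogical_graph_def)
      moreover have "g (anc_path g v n) \<in> G" using assms(1) Suc False by blast
      ultimately show ?thesis using Suc False by (auto simp: anc_path_Suc intro: rtrancl_into_rtrancl)
    qed
  qed (use assms(2) in simp)
  then show "(v, u) \<in> (genealogical_graph r s G g)\<^sup>*" using n by simp
qed

text \<open>Every vertex has at most one outgoing edge; a path in the undirected graph can
  therefore be replaced by two ancestral paths that meet.\<close>

lemma component_iff: "u \<in> component r s g v \<longleftrightarrow> (\<exists>m n. anc_path g v m = anc_path g u n)"
proof
  assume "u \<in> component r s g v"
  then have "(v, u) \<in> (genealogical_graph r s UNIV g \<union> (genealogical_graph r s UNIV g)\<inverse>)\<^sup>*"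
    by (simp add: component_def)
  then show "\<exists>m n. anc_path g v m = anc_path g u n"
  proof (induction rule: rtrancl_induct)
    case base then show ?case by blast
  next
    case (step y z)
    then obtain m n where mn: "anc_path g v m = anc_path g y n" by blast
    from step(2) consider "y \<notin> {r, s}" "z = g y" | "z \<notin> {r, s}" "y = g z" by (auto simp: genealogical_graph_def)
    then show ?case
    proof cases
      case 1
      have "anc_path g v (m + 1) = anc_path g y (n + 1)"
        using anc_path_add[of g v m 1] anc_path_add[of g y n 1] mn by simp
      then have "anc_path g v (m + 1) = anc_path g z n" using anc_path_step[OF 1(1), of g n] 1(2) by simp
      then show ?thesis by blast
    next
      case 2
      then have "anc_path g v m = anc_path g z (Suc n)" using mn anc_path_step[OF 2(1), of g n] by simp
      then show ?thesis by blast
    qed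
  qed
next
  assume "\<exists>m n. anc_path g v m = anc_path g u n"
  then obtain m n where mn: "anc_path g v m = anc_path g u n" by blast
  let ?R = "genealogical_graph r s UNIV g"
  have 1: "(v, anc_path g v m) \<in> ?R\<^sup>*" for v m using graph_rtrancl[of UNIV g v "anc_path g v m"] by (auto simp: hits_def)
  have "(v, anc_path g v m) \<in> (?R \<union> ?R\<inverse>)\<^sup>*" using 1[of v m] by (rule rtrancl_mono[THEN subsetD, rotated]) auto
  moreover have "(anc_path g u n, u) \<in> (?R \<union> ?R\<inverse>)\<^sup>*"
  proof -
    have "(anc_path g u n, u) \<in> (?R\<inverse>)\<^sup>*" using 1[of u n] by (simp add: rtrancl_converse)
    then show ?thesis by (rule rtrancl_mono[THEN subsetD, rotated]) auto
  qed
  ultimately show "u \<in> component r s g v" using mn by (auto simp: component_def intro: rtrancl_trans)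
qed

lemma seed_component: "a \<in> {r, s} \<Longrightarrow> a \<in> component r s g v \<longleftrightarrow> hits g v a"
  unfolding component_iff hits_def using anc_path_seed[of a g] by simp

lemma component_self: "v \<in> component r s g v" unfolding component_iff by blast

lemma component_eq: assumes "u \<in> component r s g v" shows "component r s g u = component r s g v"
proof -
  let ?R = "(genealogical_graph r s UNIV g \<union> (genealogical_graph r s UNIV g)\<inverse>)\<^sup>*"
  have sym: "sym ?R" by (intro sym_rtrancl) (auto simp: sym_def)
  have "(v, u) \<in> ?R" using assms by (simp add: component_def)
  moreover from this have "(u, v) \<in> ?R" using sym by (auto dest: symD)
  ultimately show ?thesis unfolding component_def by (auto intro: rtrancl_trans)
qed

definition free :: "('v \<Rightarrow> 'v) \<Rightarrow> 'v \<Rightarrow> bool" where "free g v \<longleftrightarrow> \<not> hits g v r \<and> \<not> hits g v s"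

lemma free_iff: "free g v \<longleftrightarrow> (\<forall>n. anc_path g v n \<notin> {r, s})" by (auto simp: free_def hits_def)

lemma free_funpow: "free g v \<Longrightarrow> (g ^^ n) v = anc_path g v n"
  by (induction n) (auto simp: free_iff anc_path_Suc)

lemma free_component: assumes "u \<in> component r s g v" "free g v" shows "free g u"
proof -
  have "a \<in> component r s g u \<longleftrightarrow> a \<in> component r s g v" for a using component_eq[OF assms(1)] by simp
  then have "hits g u a \<longleftrightarrow> hits g v a" if "a \<in> {r, s}" for a
    using seed_component[OF that, of g u] seed_component[OF that, of g v] by simp
  then show ?thesis using assms(2) by (simp add: free_def)
qed

lemma free_components_iff: "component r s g v \<in> free_components r s g \<longleftrightarrow> free g v"
  using seed_component[of r g v] seed_component[of s g v] by (auto simp: free_components_def free_def)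

definition below :: "('v \<Rightarrow> 'v) \<Rightarrow> 'v \<Rightarrow> 'v \<Rightarrow> bool" where
  "below g v w \<longleftrightarrow> (\<exists>m. \<forall>n\<ge>m. bet r w (anc_path g v n))"

lemma below_sequentially: "below g v w \<longleftrightarrow> eventually (\<lambda>n. bet r w (anc_path g v n)) sequentially"
  by (simp add: below_def eventually_sequentially)

lemma below_component: assumes "u \<in> component r s g v" "below g v w" shows "below g u w"
proof -
  obtain m n where mn: "anc_path g v m = anc_path g u n" using assms component_iff by blast
  obtain N where N: "\<And>i. i \<ge> N \<Longrightarrow> bet r w (anc_path g v i)" using assms by (auto simp: below_def)
  have "bet r w (anc_path g u i)" if i: "n + N \<le> i" for i
  proof -
    have "anc_path g u i = anc_path g (anc_path g u n) (i - n)" using anc_path_add[of g u n "i - n"] i by simp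
    also have "\<dots> = anc_path g v (m + (i - n))" unfolding mn[symmetric] by (simp add: anc_path_add)
    finally show ?thesis using N[of "m + (i - n)"] i by simp
  qed
  then show ?thesis by (auto simp: below_def)
qed

lemma below_unique: "below g v w \<Longrightarrow> below g v w' \<Longrightarrow> d r w = d r w' \<Longrightarrow> w = w'"
proof -
  assume "below g v w" "below g v w'" and e: "d r w = d r w'"
  then obtain m m' where "\<And>n. n \<ge> m \<Longrightarrow> bet r w (anc_path g v n)" "\<And>n. n \<ge> m' \<Longrightarrow> bet r w' (anc_path g v n)"
    by (auto simp: below_def)
  then have "bet r w (anc_path g v (max m m'))" "bet r w' (anc_path g v (max m m'))" by simp_all
  then show "w = w'" using bet_antisym e by blast
qed

lemma below_trans: "below g v w \<Longrightarrow> bet r u w \<Longrightarrow> below g v u"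
  unfolding below_def using bet_trans by blast

lemma below_nested: assumes "below g v w" "below g v u" "d r u \<le> d r w" shows "bet r u w"
proof -
  obtain y where y: "bet r y w" "d r y = d r u" using ex_between[OF assms(3)] by blast
  have "below g v y" using below_trans[OF assms(1) y(1)] .
  then have "y = u" using below_unique assms(2) y(2) by blast
  then show ?thesis using y by simp
qed

definition has_dir :: "('v \<Rightarrow> 'v) \<Rightarrow> 'v \<Rightarrow> bool" where
  "has_dir g v \<longleftrightarrow> (\<forall>k. \<exists>w. d r w = k \<and> below g v w)"

text \<open>Beyond distance \<open>d r s\<close> from the root, moving along a ray changes both distances to
  the seeds by the same amount; so the position of a direction can be read off at level
  \<open>Suc (d r s)\<close>.\<close>

definition rel_dir :: "(nat \<Rightarrow> nat \<Rightarrow> bool) \<Rightarrow> ('v \<Rightarrow> 'v) \<Rightarrow> 'v \<Rightarrow> 'v \<Rightarrow> 'v \<Rightarrow> bool" where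
  "rel_dir Q g v a b \<longleftrightarrow> has_dir g v \<and> (\<exists>w. d r w = Suc (d r s) \<and> below g v w \<and> Q (d w a) (d w b))"

lemma seed_dist:
  assumes "bet r u w" "d r s < d r u" "a \<in> {r, s}"
  shows "d w a = d w u + d u a"
proof (cases "a = r")
  case True then show ?thesis using assms(1) bet_sym[of r u w] by (simp add: bet_def)
next
  case False
  then have a: "a = s" using assms by simp
  have "\<not> bet r u s" using assms(2) by (auto simp: bet_def)
  then have "bet s u w" using tripod[OF assms(1), of s] by blast
  then show ?thesis using bet_sym[of s u w] a by (simp add: bet_def)
qed

lemma ray_levels: assumes "ray E r w" shows "d r (w k) = k \<and> bet r (w k) (w (Suc k))"
proof -
  have e: "E (w k) (w (Suc k))" for k using assms by (simp add: ray_def)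
  have "d r (w k) = k \<and> d r (w (Suc k)) = Suc k"
  proof (induction k)
    case 0 then show ?case using assms d_nbr[OF e[of 0]] by (simp add: ray_def)
  next
    case (Suc k)
    let ?x = "w (Suc k)"
    have n: "?x \<noteq> r" using Suc by auto
    have "w k = towards ?x r"
      by (rule towards_eqI) (use E_sym[OF e] Suc n d_sym[of _ r] in auto)
    moreover have "w (Suc (Suc k)) \<noteq> w k" using assms by (simp add: ray_def)
    ultimately have "d (w (Suc (Suc k))) r = Suc (d ?x r)" using nbr_away[OF e[of "Suc k"], of r] by simp
    then show ?case using Suc d_sym[of _ r] by simp
  qed
  then show ?thesis using d_nbr[OF e[of k]] by (simp add: bet_def)
qed

lemma ray_nested: assumes "ray E r w" "k \<le> k'" shows "bet r (w k) (w k')"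
  using assms(2)
proof (induction k' rule: dec_induct)
  case (step k')
  have "bet r (w k') (w (Suc k'))" using ray_levels[OF assms(1)] by simp
  then show ?case using bet_trans step by blast
qed simp

lemma is_direction_iff:
  assumes "free g v"
  shows "is_direction E r g (component r s g v) w \<longleftrightarrow> ray E r w \<and> (\<forall>k. below g v (w k))"
proof -
  have "eventually (\<lambda>n. (g ^^ n) u \<in> subtree E r (w k)) sequentially \<longleftrightarrow> below g u (w k)"
    if "u \<in> component r s g v" for u k
    using free_component[OF that assms] free_funpow[of g u] by (simp add: subtree_iff below_sequentially)
  then show ?thesis unfolding is_direction_def
    using below_component component_self by (metis (full_types))
qed

text \<open>The vertices below which the path eventually stays, one for every level, form a ray.\<close>

lemma ex_direction:
  assumes "free g v" "has_dir g v"
  obtains w where "is_direction E r g (component r s g v) w"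
proof -
  obtain w where w: "\<And>k. d r (w k) = k" "\<And>k. below g v (w k)" using assms(2) unfolding has_dir_def by metis
  have nest: "bet r (w k) (w k')" if "k \<le> k'" for k k' by (rule below_nested[OF w(2) w(2)]) (use that w in simp)
  have dk: "d (w k) (w (k + i)) = i" for k i using nest[of k "k + i"] w(1) by (simp add: bet_def)
  have "ray E r w" unfolding ray_def
  proof (intro conjI allI)
    show "w 0 = r" using w(1)[of 0] by simp
    fix k
    have "d (w k) (w (Suc k)) = 1" using dk[of k 1] by simp
    then show "E (w k) (w (Suc k))" using d_Suc[of "w k" "w (Suc k)" 0] by auto
    show "w (Suc (Suc k)) \<noteq> w k" using dk[of k 2] by auto
  qed
  then show thesis using that w is_direction_iff[OF assms(1)] by blast
qed

lemma rel_dir_iff: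
  assumes v: "free g v" and ab: "a \<in> {r, s}" "b \<in> {r, s}"
    and Q: "\<And>i m n. Q (i + m) (i + n) = Q m n"
  shows "(\<exists>w. is_direction E r g (component r s g v) w \<and> eventually (\<lambda>k. Q (d (w k) a) (d (w k) b)) sequentially)
    \<longleftrightarrow> rel_dir Q g v a b"
proof -
  let ?k = "Suc (d r s)"
  have ev: "eventually (\<lambda>k. Q (d (w k) a) (d (w k) b)) sequentially \<longleftrightarrow> Q (d (w ?k) a) (d (w ?k) b)"
    if "ray E r w" for w
  proof -
    have "Q (d (w k) a) (d (w k) b) = Q (d (w ?k) a) (d (w ?k) b)" if k: "?k \<le> k" for k
    proof -
      have n: "bet r (w ?k) (w k)" using ray_nested[OF \<open>ray E r w\<close> k] .
      have "d r s < d r (w ?k)" using ray_levels[OF \<open>ray E r w\<close>] by simp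
      then show ?thesis using seed_dist[OF n _ ab(1)] seed_dist[OF n _ ab(2)] Q by simp
    qed
    then have "eventually (\<lambda>k. Q (d (w k) a) (d (w k) b) = Q (d (w ?k) a) (d (w ?k) b)) sequentially"
      unfolding eventually_sequentially by blast
    then have "eventually (\<lambda>k. Q (d (w k) a) (d (w k) b)) sequentially
      \<longleftrightarrow> eventually (\<lambda>k. Q (d (w ?k) a) (d (w ?k) b)) (sequentially :: nat filter)"
      by (rule eventually_cong) simp
    then show ?thesis by simp
  qed
  show ?thesis
  proof
    assume "\<exists>w. is_direction E r g (component r s g v) w \<and> eventually (\<lambda>k. Q (d (w k) a) (d (w k) b)) sequentially"
    then obtain w where w: "ray E r w" "\<And>k. below g v (w k)" "Q (d (w ?k) a) (d (w ?k) b)"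
      using is_direction_iff[OF v] ev by blast
    then show "rel_dir Q g v a b" using ray_levels[OF w(1)] unfolding rel_dir_def has_dir_def by metis
  next
    assume rd: "rel_dir Q g v a b"
    then obtain w where w: "is_direction E r g (component r s g v) w"
      using ex_direction[OF v] unfolding rel_dir_def by blast
    then have ry: "ray E r w" and bw: "below g v (w ?k)" using is_direction_iff[OF v] by auto
    obtain u where u: "d r u = ?k" "below g v u" "Q (d u a) (d u b)" using rd unfolding rel_dir_def by blast
    have "u = w ?k" using below_unique[OF u(2) bw] u(1) ray_levels[OF ry, of ?k] by simp
    then show "\<exists>w. is_direction E r g (component r s g v) w \<and> eventually (\<lambda>k. Q (d (w k) a) (d (w k) b)) sequentially"
      using w ev[OF ry] u(3) by blast
  qed
qed

abbreviation closer :: "('v \<Rightarrow> 'v) \<Rightarrow> 'v \<Rightarrow> 'v \<Rightarrow> 'v \<Rightarrow> bool" where "closer \<equiv> rel_dir (<)"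
abbreviation tied :: "('v \<Rightarrow> 'v) \<Rightarrow> 'v \<Rightarrow> bool" where "tied g v \<equiv> rel_dir (=) g v r s"

lemma limit_coloring_eq:
  "limit_coloring E r s g X v =
    (if hits g v r then Blue else if hits g v s then Red
     else if closer g v r s then Blue else if closer g v s r then Red
     else if tied g v then (if X (component r s g v) then Blue else Red) else Red)"
proof (cases "free g v")
  case True
  have "dir_closer E r g (component r s g v) r s \<longleftrightarrow> closer g v r s"
    "dir_closer E r g (component r s g v) s r \<longleftrightarrow> closer g v s r"
    "dir_equidistant E r g (component r s g v) r s \<longleftrightarrow> tied g v"
    unfolding dir_closer_def dir_equidistant_def by (rule rel_dir_iff[OF True]; simp)+
  then show ?thesis
    using seed_component[of r g v] seed_component[of s g v] free_components_iff[of g v] True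
    by (simp add: limit_coloring_def Let_def tied_components_def)
next
  case False
  then show ?thesis
    using seed_component[of r g v] seed_component[of s g v]
    by (auto simp: limit_coloring_def Let_def free_def)
qed

lemma tied_components_iff: "C \<in> tied_components E r s g \<longleftrightarrow> (\<exists>v. C = component r s g v \<and> free g v \<and> tied g v)"
proof -
  have "dir_equidistant E r g (component r s g v) r s \<longleftrightarrow> tied g v" if "free g v" for v
    unfolding dir_equidistant_def by (rule rel_dir_iff[OF that]; simp)
  then show ?thesis
    unfolding tied_components_def using free_components_iff[of g] by (auto simp: free_components_def)
qed

section \<open>Exchanging the seeds below equidistant vertices\<close>

lemma hits_unique: "hits g v r \<Longrightarrow> hits g v s \<Longrightarrow> False"
proof -
  assume "hits g v r" "hits g v s"
  then obtain m n where "anc_path g v m = r" "anc_path g v n = s" by (auto simp: hits_def)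
  then have "anc_path g v (max m n) = r" "anc_path g v (max m n) = s"
    using anc_path_seed_const[of g v m "max m n"] anc_path_seed_const[of g v n "max m n"] by auto
  then show False using seeds_ne by simp
qed

lemma hits_anc_path: "a \<in> {r, s} \<Longrightarrow> hits g (anc_path g v n) a \<longleftrightarrow> hits g v a"
proof
  assume "hits g (anc_path g v n) a" then show "hits g v a" by (auto simp: hits_def anc_path_add[symmetric])
next
  assume a: "a \<in> {r, s}" "hits g v a"
  then obtain m where m: "anc_path g v m = a" by (auto simp: hits_def)
  then have "anc_path g (anc_path g v n) m = a" using anc_path_seed_const[of g v m "n + m"] a by (simp add: anc_path_add[symmetric])
  then show "hits g (anc_path g v n) a" by (auto simp: hits_def)
qed

lemma hits_finite:
  assumes "finite G" "selects G t g" "v \<in> G"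
  shows "hits g v r \<or> hits g v s"
proof (rule ccontr)
  assume "\<not> (hits g v r \<or> hits g v s)"
  then have ns: "anc_path g v n \<notin> {r, s}" for n by (auto simp: hits_def)
  have inG: "anc_path g v n \<in> G" for n using selects_anc_path_G assms by blast
  have lt: "tau t (anc_path g v (Suc n)) < tau t (anc_path g v n)" for n
  proof -
    have "anc_path g v (Suc n) \<in> candG G t (anc_path g v n)" using ns[of n] inG[of n] assms(2) by (simp add: anc_path_Suc selects_def)
    then show ?thesis by (rule candG_time)
  qed
  have dec: "tau t (anc_path g v n) < tau t (anc_path g v m)" if "m < n" for m n
    using that by (induction n rule: less_Suc_induct) (auto intro: lt less_trans)
  have "inj (anc_path g v)"
  proof (rule injI)
    fix m n assume "anc_path g v m = anc_path g v n"
    then show "m = n" using dec[of m n] dec[of n m] by (cases m n rule: linorder_cases) auto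
  qed
  then have "infinite (range (anc_path g v))" using range_inj_infinite by blast
  moreover have "range (anc_path g v) \<subseteq> G" using inG by auto
  ultimately show False using assms(1) finite_subset by blast
qed

definition flip :: "'v \<Rightarrow> 'v" where "flip x = (if x = r then s else if x = s then r else x)"

lemma flip_simps [simp]: "flip r = s" "flip s = r" "x \<notin> {r, s} \<Longrightarrow> flip x = x" "flip (flip x) = x"
  "flip x \<in> {r, s} \<longleftrightarrow> x \<in> {r, s}"
  using seeds_ne by (auto simp: flip_def)

text \<open>Exchange the seeds as parents of the low vertices that lie below the vertices of \<open>S\<close>.\<close>

definition exchange :: "'v set \<Rightarrow> nat \<Rightarrow> ('v \<Rightarrow> real) \<Rightarrow> 'v set \<Rightarrow> ('v \<Rightarrow> 'v) \<Rightarrow> 'v \<Rightarrow> 'v" where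
  "exchange G k t S g = (\<lambda>y\<in>G - {r, s}. if low k t y \<and> tree_anc k y \<in> S then flip (g y) else g y)"

text \<open>Before it reaches a seed, the path of \<open>y\<close> stays below the same vertex of level \<open>k\<close>, so
  the exchange only affects its last step.\<close>

lemma exchange_anc_path:
  assumes k: "d r s < k" and G: "r \<in> G" "s \<in> G" and pos: "\<And>v. 0 < t v" and g: "selects G t g"
    and y: "y \<in> G" "low k t y"
  shows "anc_path (exchange G k t S g) y n = (if tree_anc k y \<in> S then flip (anc_path g y n) else anc_path g y n)"
proof (induction n)
  case 0 then show ?case using y by (auto simp: low_def)
next
  case (Suc n)
  show ?case
  proof (cases "anc_path g y n \<in> {r, s}")
    case True
    then show ?thesis using Suc by (auto simp: anc_path_Suc)
  next
    case False
    have tr: "bet r (tree_anc k y) (anc_path g y n)" "low k t (anc_path g y n)"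
      using trapped_path[OF k G pos g y, of n] False by auto
    have "tree_anc k (anc_path g y n) = tree_anc k y" using tree_anc_eq[OF tr(1)] low_tree_anc[OF y(2)] by simp
    moreover have "anc_path g y n \<in> G" by (rule selects_anc_path_G[OF g y(1)])
    moreover have "anc_path (exchange G k t S g) y n = anc_path g y n" using Suc False by simp
    ultimately have "anc_path (exchange G k t S g) y (Suc n) = exchange G k t S g (anc_path g y n)"
      "exchange G k t S g (anc_path g y n) = (if tree_anc k y \<in> S then flip (g (anc_path g y n)) else g (anc_path g y n))"
      using False tr(2) by (simp_all add: anc_path_Suc exchange_def del: insert_iff)
    then show ?thesis using False by (simp add: anc_path_Suc)
  qed
qed

lemma exchange_hits:
  assumes "d r s < k" "r \<in> G" "s \<in> G" "\<And>v. 0 < t v" "selects G t g" "y \<in> G" "low k t y"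
  shows "hits (exchange G k t S g) y a \<longleftrightarrow> hits g y (if tree_anc k y \<in> S then flip a else a)"
proof -
  have "flip x = a \<longleftrightarrow> x = flip a" for x using seeds_ne by (auto simp: flip_def)
  then show ?thesis unfolding hits_def exchange_anc_path[OF assms] by simp
qed

text \<open>The vertices whose parents determine the entry point of \<open>v\<close>.\<close>

definition inner :: "nat \<Rightarrow> ('v \<Rightarrow> real) \<Rightarrow> 'v \<Rightarrow> 'v set" where
  "inner k t v = {y \<in> explored k t v. \<not> stopped k t y}"

text \<open>The exploration from \<open>v\<close> does not notice the difference between \<open>G\<close> and the whole
  tree.\<close>

definition wide :: "'v set \<Rightarrow> nat \<Rightarrow> ('v \<Rightarrow> real) \<Rightarrow> 'v \<Rightarrow> bool" where
  "wide G k t v \<longleftrightarrow> v \<in> G \<and> r \<in> G \<and> s \<in> G \<and> (\<forall>y\<in>inner k t v. y \<in> G \<and> candG G t y = cand t y)"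

lemma inner_nonseed: "y \<in> inner k t v \<Longrightarrow> y \<notin> {r, s} \<and> \<not> low k t y"
  by (auto simp: inner_def stopped_def)

lemma wide_UNIV: "wide UNIV k t v" by (simp add: wide_def cand_candG)

lemma wide_selects: "wide G k t v \<Longrightarrow> selects G t g \<Longrightarrow> \<forall>y\<in>explored k t v. \<not> stopped k t y \<longrightarrow> g y \<in> cand t y"
proof (intro ballI impI)
  fix y assume a: "wide G k t v" "selects G t g" "y \<in> explored k t v" "\<not> stopped k t y"
  then have "y \<in> inner k t v" by (simp add: inner_def)
  then have "y \<in> G - {r, s}" "candG G t y = cand t y" using a(1) inner_nonseed by (auto simp: wide_def)
  then show "g y \<in> cand t y" using a(2) unfolding selects_def by metis
qed

lemma entry_wide:
  assumes "good t" "wide G k t v" "selects G t g"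
  shows "stopped k t (entry k t g v)" "\<exists>n. entry k t g v = anc_path g v n" "entry k t g v \<in> G"
    "(\<And>y. y \<in> inner k t v \<Longrightarrow> g' y = g y) \<Longrightarrow> entry k t g' v = entry k t g v"
proof -
  note e = entry_props[OF assms(1) wide_selects[OF assms(2,3)]]
  show 1: "stopped k t (entry k t g v)" and 2: "\<exists>n. entry k t g v = anc_path g v n"
    using entry_ex[OF conjunct1[OF e]] by auto
  show "entry k t g v \<in> G" using 2 selects_anc_path_G[OF assms(3)] assms(2) unfolding wide_def by auto
  show "entry k t g' v = entry k t g v" if "\<And>y. y \<in> inner k t v \<Longrightarrow> g' y = g y"
    using conjunct2[OF e[of g']] that by (simp add: inner_def)
qed

text \<open>An exchange only changes parents of low vertices, which come after the entry point.\<close>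

lemma entry_exchange:
  assumes "good t" "wide G k t v" "selects G t g"
  shows "entry k t (exchange G k t S g) v = entry k t g v"
proof (rule entry_wide(4)[OF assms])
  fix y assume "y \<in> inner k t v"
  then show "exchange G k t S g y = g y" using inner_nonseed[of y k t v] assms(2) by (auto simp: exchange_def wide_def)
qed

section \<open>Colors and entry points\<close>

definition opp :: "color \<Rightarrow> color" where "opp c = (if c = Blue then Red else Blue)"

definition ball_color :: "('v \<Rightarrow> 'v) \<Rightarrow> 'v \<Rightarrow> color" where
  "ball_color g v = (if hits g v r then Blue else Red)"

lemma hits_entry:
  assumes "good t" "wide G k t v" "selects G t g" "a \<in> {r, s}"
  shows "hits g (entry k t g v) a \<longleftrightarrow> hits g v a"
  using entry_wide(2)[OF assms(1-3)] hits_anc_path[OF assms(4)] by auto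

lemma hits_seed_entry: "a \<in> {r, s} \<Longrightarrow> hits g a b \<longleftrightarrow> a = b"
  using anc_path_seed[of a g] by (auto simp: hits_def)

lemma trapped_hits:
  assumes "d r s < k" "r \<in> G" "s \<in> G" "\<And>v. 0 < t v" "selects G t g" "y \<in> G" "low k t y"
  shows "hits g y r \<Longrightarrow> d (tree_anc k y) r \<le> d (tree_anc k y) s" "hits g y s \<Longrightarrow> d (tree_anc k y) s \<le> d (tree_anc k y) r"
  using trapped_path[OF assms] by (auto simp: hits_def)

lemma good_pos: "good t \<Longrightarrow> 0 < t v" unfolding good_def using F_pos by blast

text \<open>What the colorings on a ball and on the whole tree have in common is how the color \<open>c\<close>
  of a vertex depends on its entry point \<open>e\<close>, as far as it is determined (\<open>forced\<close>), and how an
  exchange acts on it (\<open>turned\<close>).\<close>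

definition forced :: "nat \<Rightarrow> 'v \<Rightarrow> color \<Rightarrow> bool" where
  "forced k e c \<longleftrightarrow> (e = r \<longrightarrow> c = Blue) \<and> (e = s \<longrightarrow> c = Red) \<and>
    (e \<notin> {r, s} \<longrightarrow> (d (tree_anc k e) r < d (tree_anc k e) s \<longrightarrow> c = Blue) \<and> (d (tree_anc k e) s < d (tree_anc k e) r \<longrightarrow> c = Red))"

definition turned :: "nat \<Rightarrow> 'v set \<Rightarrow> 'v \<Rightarrow> color \<Rightarrow> color" where
  "turned k S e c = (if e \<notin> {r, s} \<and> tree_anc k e \<in> S then opp c else c)"

definition ties :: "nat \<Rightarrow> 'v set" where "ties k = {w. d r w = k \<and> d w r = d w s}"

lemma finite_ties: "finite (ties k)"
  by (rule finite_subset[OF _ finite_sph[of r k]]) (auto simp: ties_def sph_def)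

text \<open>On a finite set every path ends at a seed. After its entry point \<open>e\<close>, it stays below
  the ancestor of \<open>e\<close> of level \<open>k\<close> and can only end at a seed that is nearest to this ancestor.\<close>

lemma ball_color_props:
  assumes t: "good t" and k: "d r s < k" and G: "finite G" and v: "wide G k t v" and g: "selects G t g"
  shows "forced k (entry k t g v) (ball_color g v)"
    and "ball_color (exchange G k t S g) v = turned k S (entry k t g v) (ball_color g v)"
    and "wide G k t v' \<Longrightarrow> entry k t g v = entry k t g v' \<Longrightarrow> ball_color g v = ball_color g v'"
proof -
  let ?e = "entry k t g v"
  note rs = v[unfolded wide_def]
  note e = entry_wide(1-3)[OF t v g]
  have pos: "\<And>v. 0 < t v" using good_pos[OF t] .
  have h: "hits g v a \<longleftrightarrow> hits g ?e a" if "a \<in> {r, s}" for a using hits_entry[OF t v g that] by simp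
  have fin: "hits g ?e r \<or> hits g ?e s" by (rule hits_finite[OF G g e(3)])
  show "forced k ?e (ball_color g v)"
  proof (cases "?e \<in> {r, s}")
    case True
    then show ?thesis using h hits_seed_entry[OF True] seeds_ne by (auto simp: forced_def ball_color_def)
  next
    case False
    then have "low k t ?e" using e(1) by (auto simp: stopped_def)
    then show ?thesis
      using trapped_hits[OF k _ _ pos g e(3)] rs fin h False by (auto simp: forced_def ball_color_def)
  qed
  show "ball_color (exchange G k t S g) v = turned k S ?e (ball_color g v)"
  proof (cases "?e \<in> {r, s}")
    case True
    have es: "entry k t (exchange G k t S g) v = ?e" by (rule entry_exchange[OF t v g])
    have "exchange G k t S g y \<in> cand t y" if "y \<in> explored k t v" "\<not> stopped k t y" for y
    proof -
      have "y \<in> inner k t v" using that by (simp add: inner_def)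
      then have "exchange G k t S g y = g y" using inner_nonseed[of y k t v] v by (auto simp: exchange_def wide_def)
      then show ?thesis using wide_selects[OF v g] that by simp
    qed
    then have "\<exists>n. stopped k t (anc_path (exchange G k t S g) v n)" using entry_props[OF t, of k v "exchange G k t S g"] by blast
    then obtain n where "?e = anc_path (exchange G k t S g) v n" using entry_ex es by metis
    then have "hits (exchange G k t S g) v r \<longleftrightarrow> ?e = r"
      using hits_anc_path[of r "exchange G k t S g" v n] hits_seed_entry[OF True] by simp
    moreover have "hits g v r \<longleftrightarrow> ?e = r" using h hits_seed_entry[OF True] by simp
    ultimately show ?thesis using True by (simp add: ball_color_def turned_def)
  next
    case False
    then have l: "low k t ?e" using e(1) by (auto simp: stopped_def)
    have es: "entry k t (exchange G k t S g) v = ?e" by (rule entry_exchange[OF t v g])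
    have "exchange G k t S g y \<in> cand t y" if "y \<in> explored k t v" "\<not> stopped k t y" for y
    proof -
      have "y \<in> inner k t v" using that by (simp add: inner_def)
      then have "exchange G k t S g y = g y" using inner_nonseed[of y k t v] v by (auto simp: exchange_def wide_def)
      then show ?thesis using wide_selects[OF v g] that by simp
    qed
    then have "\<exists>n. stopped k t (anc_path (exchange G k t S g) v n)" using entry_props[OF t, of k v "exchange G k t S g"] by blast
    then obtain n where "?e = anc_path (exchange G k t S g) v n" using entry_ex es by metis
    then have "hits (exchange G k t S g) v r \<longleftrightarrow> hits (exchange G k t S g) ?e r" using hits_anc_path[of r "exchange G k t S g" v n] by simp
    also have "\<dots> \<longleftrightarrow> hits g ?e (if tree_anc k ?e \<in> S then s else r)"
      using exchange_hits[OF k _ _ pos g e(3) l, of S r] rs by simp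
    finally show ?thesis using h[of r] fin hits_unique[of g ?e] False by (auto simp: ball_color_def turned_def opp_def)
  qed
  show "ball_color g v = ball_color g v'" if "wide G k t v'" "?e = entry k t g v'"
    using h[of r] hits_entry[OF t that(1) g, of r] that(2) by (simp add: ball_color_def)
qed

section \<open>The coloring in infinite volume, driven by one coin for every vertex\<close>

text \<open>The coin of a component is that of its first vertex in a fixed enumeration.\<close>

definition rep :: "'v set \<Rightarrow> 'v" where
  "rep C = (SOME u. u \<in> C \<and> (\<forall>u'\<in>C. to_nat_on (UNIV :: 'v set) u \<le> to_nat_on (UNIV :: 'v set) u'))"

lemma rep: assumes "v \<in> C"
  shows "rep C \<in> C" "u' \<in> C \<Longrightarrow> to_nat_on (UNIV :: 'v set) (rep C) \<le> to_nat_on (UNIV :: 'v set) u'"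
proof -
  have "\<exists>u. u \<in> C \<and> (\<forall>u'\<in>C. to_nat_on (UNIV :: 'v set) u \<le> to_nat_on (UNIV :: 'v set) u')"
    using ex_has_least_nat[of "\<lambda>u. u \<in> C" v "to_nat_on UNIV"] assms by blast
  from someI_ex[OF this] show "rep C \<in> C" "u' \<in> C \<Longrightarrow> to_nat_on (UNIV :: 'v set) (rep C) \<le> to_nat_on (UNIV :: 'v set) u'"
    unfolding rep_def by auto
qed

lemma rep_eq_iff: "v \<in> C \<Longrightarrow> rep C = u \<longleftrightarrow> u \<in> C \<and> (\<forall>u'. to_nat_on (UNIV :: 'v set) u' < to_nat_on (UNIV :: 'v set) u \<longrightarrow> u' \<notin> C)"
proof
  assume "v \<in> C" "rep C = u"
  then show "u \<in> C \<and> (\<forall>u'. to_nat_on (UNIV :: 'v set) u' < to_nat_on (UNIV :: 'v set) u \<longrightarrow> u' \<notin> C)"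
    using rep[of v C] by (auto simp: not_less[symmetric])
next
  assume v: "v \<in> C" and u: "u \<in> C \<and> (\<forall>u'. to_nat_on (UNIV :: 'v set) u' < to_nat_on (UNIV :: 'v set) u \<longrightarrow> u' \<notin> C)"
  then have "to_nat_on (UNIV :: 'v set) (rep C) = to_nat_on (UNIV :: 'v set) u"
    using rep[OF v] by (metis antisym not_less)
  then show "rep C = u" using countable_UNIV by (simp add: inj_on_to_nat_on inj_on_eq_iff[OF inj_on_to_nat_on[OF countable_UNIV]])
qed

text \<open>The coloring in infinite volume as a function of the parent map and of one coin for
  every vertex. Unlike the set of tied components, the index set of these coins does not depend on
  the parent map.\<close>

definition limit_color :: "('v \<Rightarrow> 'v) \<Rightarrow> ('v \<Rightarrow> bool) \<Rightarrow> 'v \<Rightarrow> color" where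
  "limit_color g Y v = limit_coloring E r s g (\<lambda>C. Y (rep C)) v"

lemma limit_color_eq: "limit_color g Y v =
    (if hits g v r then Blue else if hits g v s then Red
     else if closer g v r s then Blue else if closer g v s r then Red
     else if tied g v then (if Y (rep (component r s g v)) then Blue else Red) else Red)"
  unfolding limit_color_def by (rule limit_coloring_eq)

text \<open>Turns the coins of all components with a direction below a vertex of \<open>S\<close>.\<close>

definition flip_coins :: "'v set \<Rightarrow> ('v \<Rightarrow> 'v) \<Rightarrow> ('v \<Rightarrow> bool) \<Rightarrow> 'v \<Rightarrow> bool" where
  "flip_coins S g Y = (\<lambda>y. if \<exists>w\<in>S. below g y w then \<not> Y y else Y y)"

lemma anc_path_component: "anc_path g v n \<in> component r s g v"
  unfolding component_iff using anc_path_0 by metis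

lemma rel_dir_cong: "below g v = below g' v' \<Longrightarrow> rel_dir Q g v a b = rel_dir Q g' v' a b"
  by (simp add: rel_dir_def has_dir_def)

lemma below_anc_path: "below g (anc_path g v n) = below g v"
proof
  fix w show "below g (anc_path g v n) w = below g v w"
    using below_component[of "anc_path g v n" g v w] below_component[of v g "anc_path g v n" w] anc_path_component[of g v n]
      component_eq[OF anc_path_component, of g v n] component_self[of v g] by auto
qed

lemma limit_color_anc_path: "limit_color g Y (anc_path g v n) = limit_color g Y v"
  unfolding limit_color_eq component_eq[OF anc_path_component]
  using hits_anc_path[of r g v n] hits_anc_path[of s g v n] rel_dir_cong[OF below_anc_path] by simp

text \<open>A free path never reaches a seed, so its entry point is low and the rest of the path
  is trapped.\<close>

lemma free_below:
  assumes t: "good t" and k: "d r s < k" and g: "selects UNIV t g" and v: "free g v"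
  shows "entry k t g v \<notin> {r, s}" "low k t (entry k t g v)" "below g v (tree_anc k (entry k t g v))"
proof -
  let ?e = "entry k t g v"
  note e = entry_wide(1,2)[OF t wide_UNIV g, of k v]
  obtain n where n: "?e = anc_path g v n" using e by blast
  show ns: "?e \<notin> {r, s}" using v n by (simp add: free_iff)
  then show l: "low k t ?e" using e by (simp add: stopped_def)
  have "bet r (tree_anc k ?e) (anc_path g ?e i)" for i
  proof -
    have "anc_path g ?e i \<notin> {r, s}" using v unfolding n anc_path_add[symmetric] by (simp add: free_iff)
    then show ?thesis using trapped_path[OF k UNIV_I UNIV_I good_pos[OF t] g UNIV_I l] by simp
  qed
  then have "below g ?e (tree_anc k ?e)" by (auto simp: below_def)
  then show "below g v (tree_anc k ?e)" using below_anc_path[of g v n] n by simp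
qed

lemma free_has_dir:
  assumes t: "good t" and g: "selects UNIV t g" and v: "free g v"
  shows "has_dir g v"
  unfolding has_dir_def
proof
  fix k
  define k' where "k' = max k (Suc (d r s))"
  have k': "d r s < k'" "k \<le> k'" by (auto simp: k'_def)
  let ?w = "tree_anc k' (entry k' t g v)"
  have w: "below g v ?w" "d r ?w = k'" using free_below[OF t k'(1) g v] low_tree_anc by auto
  then obtain u where "bet r u ?w" "d r u = k" using ex_between[of k r ?w] k' by auto
  then show "\<exists>w. d r w = k \<and> below g v w" using below_trans[OF w(1)] by blast
qed

lemma rel_dir_level:
  assumes "has_dir g v" "below g v w" "d r s < d r w" "a \<in> {r, s}" "b \<in> {r, s}" "\<And>i m n. Q (i + m) (i + n) = Q m n"
  shows "rel_dir Q g v a b \<longleftrightarrow> Q (d w a) (d w b)"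
proof -
  let ?k = "Suc (d r s)"
  obtain u where u: "d r u = ?k" "below g v u" using assms(1) unfolding has_dir_def by blast
  have n: "bet r u w" by (rule below_nested[OF assms(2) u(2)]) (use u assms(3) in simp)
  have "Q (d w a) (d w b) = Q (d u a) (d u b)"
    using seed_dist[OF n _ assms(4)] seed_dist[OF n _ assms(5)] u assms(6) by simp
  moreover have "rel_dir Q g v a b \<longleftrightarrow> Q (d u a) (d u b)"
    unfolding rel_dir_def using assms(1) u below_unique[OF _ u(2)] by metis
  ultimately show ?thesis by simp
qed

lemma exchange_free:
  assumes "free g v" shows "anc_path (exchange UNIV k t S g) v n = anc_path g v n" "free (exchange UNIV k t S g) v"
proof -
  have eq: "anc_path (exchange UNIV k t S g) v n = anc_path g v n" for n
  proof (induction n)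
    case (Suc n)
    have "anc_path g v n \<notin> {r, s}" "anc_path g v (Suc n) \<notin> {r, s}" using assms by (auto simp: free_iff)
    then show ?case using Suc by (auto simp: anc_path_Suc exchange_def)
  qed simp
  show "anc_path (exchange UNIV k t S g) v n = anc_path g v n" by (rule eq)
  show "free (exchange UNIV k t S g) v" using assms eq by (simp add: free_iff)
qed

lemma exchange_exchange: "y \<notin> {r, s} \<Longrightarrow> exchange UNIV k t S (exchange UNIV k t S g) y = g y"
  by (auto simp: exchange_def)

lemma anc_path_cong: "(\<And>y. y \<notin> {r, s} \<Longrightarrow> g y = g' y) \<Longrightarrow> anc_path g v n = anc_path g' v n"
  by (induction n) (auto simp: anc_path_Suc)

lemma exchange_component:
  assumes "free g v" shows "component r s (exchange UNIV k t S g) v = component r s g v"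
proof (intro set_eqI)
  fix u
  let ?g = "exchange UNIV k t S g"
  have twice: "anc_path (exchange UNIV k t S ?g) u n = anc_path g u n" for u n by (rule anc_path_cong) (rule exchange_exchange)
  show "u \<in> component r s ?g v \<longleftrightarrow> u \<in> component r s g v"
  proof
    assume u: "u \<in> component r s g v"
    have "anc_path ?g u n = anc_path g u n" for n by (rule exchange_free(1)[OF free_component[OF u assms]])
    then show "u \<in> component r s ?g v" using u exchange_free(1)[OF assms] unfolding component_iff by simp
  next
    assume u: "u \<in> component r s ?g v"
    have "anc_path (exchange UNIV k t S ?g) u n = anc_path ?g u n" for n
      by (rule exchange_free(1)[OF free_component[OF u exchange_free(2)[OF assms]]])
    then have "anc_path ?g u n = anc_path g u n" for n using twice by simp
    then show "u \<in> component r s g v" using u exchange_free(1)[OF assms] unfolding component_iff by simp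
  qed
qed

text \<open>A path that ends at a seed behaves as on a ball. A free path is not affected by the
  exchange, but after its entry point it stays below the ancestor \<open>w\<close> of this point at level \<open>k\<close>;
  so its direction is closer to the same seed as \<open>w\<close>, and its coin is turned if and only if
  \<open>w \<in> S\<close>.\<close>

lemma limit_color_props:
  assumes t: "good t" and k: "d r s < k" and g: "selects UNIV t g" and S: "S \<subseteq> ties k"
  shows "forced k (entry k t g v) (limit_color g Y v)"
    and "limit_color (exchange UNIV k t S g) (flip_coins S g Y) v = turned k S (entry k t g v) (limit_color g Y v)"
    and "entry k t g v = entry k t g v' \<Longrightarrow> limit_color g Y v = limit_color g Y v'"
proof -
  let ?e = "entry k t g v" and ?g = "exchange UNIV k t S g"
  let ?w = "tree_anc k ?e"
  note wd = wide_UNIV[of k t]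
  note e = entry_wide(1,2)[OF t wd g, of v]
  have pos: "\<And>v. 0 < t v" using good_pos[OF t] .
  have h: "hits g v a \<longleftrightarrow> hits g ?e a" if "a \<in> {r, s}" for a using hits_entry[OF t wd g that] by simp
  have hs: "hits ?g v a \<longleftrightarrow> hits ?g ?e a" if "a \<in> {r, s}" for a
  proof -
    have es: "entry k t ?g v = ?e" by (rule entry_exchange[OF t wd g])
    have "?g y \<in> cand t y" if "y \<in> explored k t v" "\<not> stopped k t y" for y
    proof -
      have "y \<in> inner k t v" using that by (simp add: inner_def)
      then have "?g y = g y" using inner_nonseed[of y k t v] by (auto simp: exchange_def)
      then show ?thesis using wide_selects[OF wd g] that by simp
    qed
    then have "\<exists>n. stopped k t (anc_path ?g v n)" using entry_props[OF t, of k v ?g] by blast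
    then obtain n where "?e = anc_path ?g v n" using entry_ex es by metis
    then show ?thesis using hits_anc_path[OF that, of ?g v n] by simp
  qed
  have dir: "rel_dir Q g v a b \<longleftrightarrow> Q (d ?w a) (d ?w b)"
    if "free g v" "a \<in> {r, s}" "b \<in> {r, s}" "\<And>i m n. Q (i + m) (i + n) = Q m n" for Q a b
    by (rule rel_dir_level[where Q=Q, OF free_has_dir[OF t g that(1)] free_below(3)[OF t k g that(1)] _ that(2,3) that(4)])
      (use low_tree_anc[OF free_below(2)[OF t k g that(1)]] k in simp)
  have closer: "closer g v a b \<longleftrightarrow> d ?w a < d ?w b" if "free g v" "a \<in> {r, s}" "b \<in> {r, s}" for a b
    by (rule dir[OF that]) simp
  have tied: "tied g v \<longleftrightarrow> d ?w r = d ?w s" if "free g v" by (rule dir[OF that]) simp_all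
  show "forced k ?e (limit_color g Y v)"
  proof (cases "?e \<in> {r, s}")
    case True
    then show ?thesis using h[of r] h[of s] hits_seed_entry[OF True] seeds_ne by (auto simp: forced_def limit_color_eq)
  next
    case False
    then have l: "low k t ?e" using e(1) by (auto simp: stopped_def)
    note th = trapped_hits[OF k UNIV_I UNIV_I pos g UNIV_I l]
    show ?thesis
    proof (cases "free g v")
      case True
      then show ?thesis using closer[OF True] False by (auto simp: forced_def limit_color_eq free_def)
    next
      case nf: False
      then show ?thesis using th h[of r] h[of s] hits_unique[of g v] False by (auto simp: forced_def limit_color_eq free_def)
    qed
  qed
  show "limit_color ?g (flip_coins S g Y) v = turned k S ?e (limit_color g Y v)"
  proof (cases "free g v")
    case True
    have pe: "anc_path ?g v n = anc_path g v n" for n by (rule exchange_free(1)[OF True])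
    have be: "below ?g v = below g v" using pe by (simp add: below_def fun_eq_iff)
    have fresh_card: "free ?g v" by (rule exchange_free(2)[OF True])
    have co: "component r s ?g v = component r s g v" by (rule exchange_component[OF True])
    have rc: "rep (component r s g v) \<in> component r s g v" by (rule rep(1)[OF component_self])
    have bw: "(\<exists>w\<in>S. below g (rep (component r s g v)) w) \<longleftrightarrow> ?w \<in> S"
    proof
      assume "\<exists>w\<in>S. below g (rep (component r s g v)) w"
      then obtain w where w: "w \<in> S" "below g (rep (component r s g v)) w" by blast
      have "below g v w"
        by (rule below_component[OF _ w(2)]) (simp add: component_eq[OF rc] component_self)
      moreover have "d r w = d r ?w" using w(1) S low_tree_anc[OF free_below(2)[OF t k g True]] by (auto simp: ties_def)
      ultimately have "w = ?w" using below_unique free_below(3)[OF t k g True] by blast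
      then show "?w \<in> S" using w by simp
    next
      assume "?w \<in> S"
      then show "\<exists>w\<in>S. below g (rep (component r s g v)) w"
        using below_component[OF rc free_below(3)[OF t k g True]] by blast
    qed
    have "limit_color ?g (flip_coins S g Y) v = (if d ?w r < d ?w s then Blue else if d ?w s < d ?w r then Red
       else if (if ?w \<in> S then \<not> Y (rep (component r s g v)) else Y (rep (component r s g v))) then Blue else Red)"
      using fresh_card rel_dir_cong[OF be, of "(<)"] rel_dir_cong[OF be, of "(=)"] closer[OF True] tied[OF True]
      by (simp add: limit_color_eq free_def co flip_coins_def bw)
    moreover have "limit_color g Y v = (if d ?w r < d ?w s then Blue else if d ?w s < d ?w r then Red
       else if Y (rep (component r s g v)) then Blue else Red)"
      using True closer[OF True] tied[OF True] by (simp add: limit_color_eq free_def)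
    moreover have "?w \<in> S \<Longrightarrow> d ?w r = d ?w s" using S by (auto simp: ties_def)
    moreover have "?e \<notin> {r, s}" by (rule free_below(1)[OF t k g True])
    ultimately show ?thesis by (auto simp: turned_def opp_def)
  next
    case nf: False
    show ?thesis
    proof (cases "?e \<in> {r, s}")
      case True
      have "limit_color g Y v = (if ?e = r then Blue else Red)" "limit_color ?g (flip_coins S g Y) v = (if ?e = r then Blue else Red)"
        using h[of r] h[of s] hs[of r] hs[of s] hits_seed_entry[OF True] True seeds_ne by (auto simp: limit_color_eq)
      then show ?thesis using True by (simp add: turned_def)
    next
      case False
      then have l: "low k t ?e" using e(1) by (auto simp: stopped_def)
      note sh = exchange_hits[OF k UNIV_I UNIV_I pos g UNIV_I l, of S]
      have "hits g ?e r \<or> hits g ?e s" using nf h by (auto simp: free_def)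
      then show ?thesis
        using sh[of r] sh[of s] h[of r] h[of s] hs[of r] hs[of s] hits_unique[of g ?e] False
        by (auto simp: limit_color_eq turned_def opp_def split: if_splits)
    qed
  qed
  show "limit_color g Y v = limit_color g Y v'" if "?e = entry k t g v'"
    using e(2) entry_wide(2)[OF t wd g, of v'] limit_color_anc_path that by metis
qed

section \<open>Separation of the entry points\<close>

definition clash :: "nat \<Rightarrow> 'v set \<Rightarrow> ('v \<Rightarrow> 'v) \<Rightarrow> bool" where
  "clash k B \<epsilon> \<longleftrightarrow> (\<exists>v\<in>B. \<exists>v'\<in>B. \<epsilon> v \<notin> {r, s} \<and> \<epsilon> v' \<notin> {r, s} \<and> \<epsilon> v \<noteq> \<epsilon> v' \<and> tree_anc k (\<epsilon> v) = tree_anc k (\<epsilon> v'))"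

definition bad :: "nat \<Rightarrow> ('v \<Rightarrow> real) \<Rightarrow> 'v set \<Rightarrow> ('v \<Rightarrow> 'v) \<Rightarrow> bool" where
  "bad k t B g \<longleftrightarrow> clash k B (\<lambda>v. entry k t g v)"

lemma entry_shift:
  assumes "good t" "selects UNIV t g" "\<And>i. i < m \<Longrightarrow> \<not> stopped k t (anc_path g v i)"
  shows "entry k t g v = entry k t g (anc_path g v m)"
  using assms(3)
proof (induction m)
  case (Suc m)
  have "\<exists>n. stopped k t (anc_path g (anc_path g v (Suc m)) n)"
    using entry_props[OF assms(1) wide_selects[OF wide_UNIV assms(2)], of k "anc_path g v (Suc m)"] by blast
  moreover have ns: "\<not> stopped k t (anc_path g v m)" using Suc.prems by simp
  moreover have "anc_path g v (Suc m) = g (anc_path g v m)" using ns by (auto simp: anc_path_Suc stopped_def)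
  ultimately have "entry k t g (anc_path g v m) = entry k t g (anc_path g v (Suc m))" using entry_step by metis
  then show ?case using Suc by simp
qed simp

lemma early_not_low:
  obtains M where "\<And>k i. M \<le> k \<Longrightarrow> i \<le> m \<Longrightarrow> \<not> low k t (anc_path g v i)"
proof
  fix k i assume k: "(\<Sum>i\<le>m. d r (anc_path g v i)) \<le> k" and i: "i \<le> m"
  have "d r (anc_path g v i) \<le> (\<Sum>i\<le>m. d r (anc_path g v i))" by (rule member_le_sum) (use i in auto)
  then show "\<not> low k t (anc_path g v i)" using low_far[of k t "anc_path g v i"] k by linarith
qed

lemma cand_ray_anc_path: assumes "selects UNIV t g" "free g v" shows "cand_ray t (anc_path g v)"
  unfolding cand_ray_def cand_candG
  using assms by (auto simp: free_iff anc_path_Suc selects_def)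

text \<open>As \<open>k\<close> grows, the entry point of a fixed vertex moves up its ancestral path. It
  becomes a seed if the path ends; two paths that meet get the same entry point, and two free
  paths that never meet have no common direction and hence get separated at some level.\<close>

lemma eventually_separated:
  assumes t: "good t" and g: "selects UNIV t g"
  shows "\<exists>k0. \<forall>k\<ge>k0. \<not> (entry k t g v \<notin> {r, s} \<and> entry k t g v' \<notin> {r, s} \<and>
     entry k t g v \<noteq> entry k t g v' \<and> tree_anc k (entry k t g v) = tree_anc k (entry k t g v'))"
proof -
  have seed: "\<exists>k0. \<forall>k\<ge>k0. entry k t g u \<in> {r, s}" if nf: "\<not> free g u" for u
  proof -
    obtain m where m: "anc_path g u m \<in> {r, s}" using nf unfolding free_iff by blast
    obtain M where M: "\<And>k i. M \<le> k \<Longrightarrow> i \<le> m \<Longrightarrow> \<not> low k t (anc_path g u i)" using early_not_low by blast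
    have "entry k t g u \<in> {r, s}" if "M \<le> k" for k
    proof -
      obtain n where n: "entry k t g u = anc_path g u n" "stopped k t (entry k t g u)"
        using entry_wide(1,2)[OF t wide_UNIV g, of k u] by blast
      show ?thesis
      proof (cases "n \<le> m")
        case True then show ?thesis using n M[OF that True] by (simp add: stopped_def)
      next
        case False then show ?thesis using n m anc_path_seed_const[OF m, of n] by simp
      qed
    qed
    then show ?thesis by blast
  qed
  consider "\<not> free g v" | "\<not> free g v'" | "free g v" "free g v'" "v' \<in> component r s g v"
    | "free g v" "free g v'" "v' \<notin> component r s g v" by blast
  then show ?thesis
  proof cases
    case 1 then show ?thesis using seed[of v] by metis
  next
    case 2 then show ?thesis using seed[of v'] by metis
  next
    case 3
    obtain m n where mn: "anc_path g v m = anc_path g v' n" using 3(3) component_iff by blast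
    obtain M where M: "\<And>k i. M \<le> k \<Longrightarrow> i \<le> m \<Longrightarrow> \<not> low k t (anc_path g v i)" using early_not_low by blast
    obtain M' where M': "\<And>k i. M' \<le> k \<Longrightarrow> i \<le> n \<Longrightarrow> \<not> low k t (anc_path g v' i)" using early_not_low by blast
    have "entry k t g v = entry k t g v'" if "max M M' \<le> k" for k
    proof -
      have "entry k t g v = entry k t g (anc_path g v m)"
        by (rule entry_shift[OF t g]) (use M[of k] that 3(1) in \<open>simp add: stopped_def free_iff\<close>)
      moreover have "entry k t g v' = entry k t g (anc_path g v' n)"
        by (rule entry_shift[OF t g]) (use M'[of k] that 3(2) in \<open>simp add: stopped_def free_iff\<close>)
      ultimately show ?thesis using mn by simp
    qed
    then show ?thesis by metis
  next
    case 4
    have "\<forall>i j. anc_path g v i \<noteq> anc_path g v' j" using 4(3) component_iff by blast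
    then have "\<not> same_dir (anc_path g v) (anc_path g v')"
      using t cand_ray_anc_path[OF g 4(1)] cand_ray_anc_path[OF g 4(2)] unfolding good_def by simp
    then obtain k0 where k0: "\<And>w. d r w = k0 \<Longrightarrow> \<not> (below g v w \<and> below g v' w)"
      unfolding same_dir_def below_sequentially by blast
    have "tree_anc k (entry k t g v) \<noteq> tree_anc k (entry k t g v')" if k: "max k0 (Suc (d r s)) \<le> k" for k
    proof
      let ?w = "tree_anc k (entry k t g v)"
      assume eq: "?w = tree_anc k (entry k t g v')"
      have ks: "d r s < k" using k by simp
      have b: "below g v ?w" "below g v' ?w"
        using free_below(3)[OF t ks g 4(1)] free_below(3)[OF t ks g 4(2), folded eq] by simp_all
      have "d r ?w = k" using low_tree_anc[OF free_below(2)[OF t ks g 4(1)]] by simp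
      then obtain u where u: "bet r u ?w" "d r u = k0" using ex_between[of k0 r ?w] k by auto
      show False using k0[OF u(2)] below_trans[OF b(1) u(1)] below_trans[OF b(2) u(1)] by simp
    qed
    then show ?thesis by metis
  qed
qed

lemma eventually_not_bad:
  assumes t: "good t" and g: "selects UNIV t g" and B: "finite B"
  shows "\<exists>k0. \<forall>k\<ge>k0. \<not> bad k t B g"
proof -
  obtain f where f: "\<And>v v' k. f v v' \<le> k \<Longrightarrow> \<not> (entry k t g v \<notin> {r, s} \<and> entry k t g v' \<notin> {r, s} \<and>
     entry k t g v \<noteq> entry k t g v' \<and> tree_anc k (entry k t g v) = tree_anc k (entry k t g v'))"
    using eventually_separated[OF t g] by metis
  define k0 where "k0 = (\<Sum>v\<in>B. \<Sum>v'\<in>B. f v v')"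
  have "\<not> bad k t B g" if "k0 \<le> k" for k
  proof
    assume "bad k t B g"
    then obtain v v' where v: "v \<in> B" "v' \<in> B" "entry k t g v \<notin> {r, s} \<and> entry k t g v' \<notin> {r, s} \<and>
     entry k t g v \<noteq> entry k t g v' \<and> tree_anc k (entry k t g v) = tree_anc k (entry k t g v')"
      unfolding bad_def clash_def by blast
    have "f v v' \<le> (\<Sum>v'\<in>B. f v v')" by (rule member_le_sum) (use v B in auto)
    also have "\<dots> \<le> k0" unfolding k0_def by (rule member_le_sum[of v B "\<lambda>v. \<Sum>v'\<in>B. f v v'"]) (use v B in auto)
    finally show False using f[of v v' k] v(3) that by simp
  qed
  then show ?thesis by blast
qed

section \<open>Averaging over exchanges of the seeds\<close>

lemma measurable_countI:
  assumes "countable A" "\<And>x. x \<in> space M \<Longrightarrow> f x \<in> A" "\<And>a. a \<in> A \<Longrightarrow> {x \<in> space M. f x = a} \<in> sets M"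
  shows "f \<in> M \<rightarrow>\<^sub>M count_space A"
proof (rule measurableI)
  fix X assume "X \<in> sets (count_space A)"
  then have X: "X \<subseteq> A" by simp
  then have "countable X" using assms(1) countable_subset by blast
  have "f -` X \<inter> space M = (\<Union>a\<in>X. {x \<in> space M. f x = a})" by auto
  also have "\<dots> \<in> sets M"
    by (rule sets.countable_UN'[OF \<open>countable X\<close>]) (use X assms(3) in auto)
  finally show "f -` X \<inter> space M \<in> sets M" .
qed (use assms(2) in simp)

lemma pred_comp: "f \<in> M \<rightarrow>\<^sub>M count_space A \<Longrightarrow> Measurable.pred M (\<lambda>x. Q (f x))"
  by (rule measurable_compose[of f M "count_space A"]) simp_all

lemma family_measurable:
  fixes f :: "'v \<Rightarrow> 'w \<Rightarrow> 'v \<times> color"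
  assumes "finite B" "\<And>v. v \<in> B \<Longrightarrow> f v \<in> M \<rightarrow>\<^sub>M count_space UNIV"
  shows "(\<lambda>\<omega>. \<lambda>v\<in>B. f v \<omega>) \<in> M \<rightarrow>\<^sub>M count_space (Pi\<^sub>E B (\<lambda>_. UNIV))"
proof (rule measurable_countI)
  have "countable (UNIV :: color set)"
    by (rule countable_subset[of _ "{Blue, Red}"]) (auto intro: color.exhaust)
  then have "countable (UNIV :: ('v \<times> color) set)"
    unfolding UNIV_Times_UNIV[symmetric] using countable_UNIV by (intro countable_SIGMA) auto
  then show "countable (Pi\<^sub>E B (\<lambda>_. UNIV :: ('v \<times> color) set))" by (intro countable_PiE assms(1)) auto
  fix a assume a: "a \<in> Pi\<^sub>E B (\<lambda>_. UNIV :: ('v \<times> color) set)"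
  have "{\<omega> \<in> space M. (\<lambda>v\<in>B. f v \<omega>) = a} = {\<omega> \<in> space M. \<forall>v\<in>B. f v \<omega> = a v}"
    using a by (auto simp: fun_eq_iff PiE_iff extensional_def)
  also have "\<dots> \<in> sets M"
  proof -
    have "Measurable.pred M (\<lambda>\<omega>. f v \<omega> = a v)" if "v \<in> B" for v
      by (rule pred_comp[OF assms(2)[OF that], where Q="\<lambda>x. x = a v"])
    then have "Measurable.pred M (\<lambda>\<omega>. \<forall>v\<in>B. f v \<omega> = a v)" by (intro pred_intros_finite assms(1))
    then show ?thesis by (simp add: pred_def)
  qed
  finally show "{\<omega> \<in> space M. (\<lambda>v\<in>B. f v \<omega>) = a} \<in> sets M" .
qed auto

lemma clash_cong: "(\<And>v. v \<in> B \<Longrightarrow> \<epsilon> v = \<epsilon>' v) \<Longrightarrow> clash k B \<epsilon> = clash k B \<epsilon>'"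
  by (simp add: clash_def)

text \<open>The color of a vertex with entry point \<open>e\<close>, when \<open>S\<close> is the set of equidistant
  vertices that are painted blue.\<close>

definition paint :: "nat \<Rightarrow> 'v set \<Rightarrow> 'v \<Rightarrow> color" where
  "paint k S e = (if e = r then Blue else if e = s then Red
     else if d (tree_anc k e) r < d (tree_anc k e) s then Blue else if d (tree_anc k e) s < d (tree_anc k e) r then Red
     else if tree_anc k e \<in> S then Blue else Red)"

text \<open>Without a clash, this number divided by \<open>2 ^ card (ties k)\<close> is the probability that
  fair coins for the equidistant vertices produce the coloring \<open>c\<close> of \<open>B\<close>.\<close>

definition share :: "nat \<Rightarrow> 'v set \<Rightarrow> ('v \<Rightarrow> color) \<Rightarrow> ('v \<Rightarrow> 'v) \<Rightarrow> nat" where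
  "share k B c \<epsilon> = (if clash k B \<epsilon> then 0 else card {S \<in> Pow (ties k). \<forall>v\<in>B. paint k S (\<epsilon> v) = c v})"

lemma share_cong: "(\<And>v. v \<in> B \<Longrightarrow> \<epsilon> v = \<epsilon>' v) \<Longrightarrow> share k B c \<epsilon> = share k B c \<epsilon>'"
  using clash_cong[of B \<epsilon> \<epsilon>' k] by (simp add: share_def)

text \<open>Taking the symmetric difference with the set \<open>\<kappa>\<close> of equidistant vertices that
  carry a blue entry point turns the sets of exchanged vertices into the sets of vertices painted
  blue. The absence of clashes makes \<open>\<kappa>\<close> determine the colors.\<close>

lemma card_share:
  assumes nb: "\<not> clash k B \<epsilon>"
    and lev: "\<And>v. v \<in> B \<Longrightarrow> \<epsilon> v \<notin> {r, s} \<Longrightarrow> d r (tree_anc k (\<epsilon> v)) = k"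
    and fo: "\<And>v. v \<in> B \<Longrightarrow> forced k (\<epsilon> v) (\<gamma> v)"
    and co: "\<And>v v'. v \<in> B \<Longrightarrow> v' \<in> B \<Longrightarrow> \<epsilon> v = \<epsilon> v' \<Longrightarrow> \<gamma> v = \<gamma> v'"
  shows "card {S \<in> Pow (ties k). \<forall>v\<in>B. turned k S (\<epsilon> v) (\<gamma> v) = c v} = share k B c \<epsilon>"
proof -
  define \<kappa> where "\<kappa> = {w \<in> ties k. \<exists>v\<in>B. \<epsilon> v \<notin> {r, s} \<and> tree_anc k (\<epsilon> v) = w \<and> \<gamma> v = Blue}"
  let ?h = "\<lambda>S. (\<kappa> - S) \<union> (S - \<kappa>)"
  have sub: "\<kappa> \<subseteq> ties k" by (auto simp: \<kappa>_def)
  have hh: "?h (?h S) = S" for S by auto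
  have hP: "?h S \<in> Pow (ties k)" if "S \<in> Pow (ties k)" for S using sub that by auto
  have eq: "turned k S (\<epsilon> v) (\<gamma> v) = paint k (?h S) (\<epsilon> v)" if S: "S \<in> Pow (ties k)" and v: "v \<in> B" for S v
  proof (cases "\<epsilon> v \<in> {r, s}")
    case True
    then show ?thesis using fo[OF v] seeds_ne by (auto simp: turned_def paint_def forced_def)
  next
    case False
    let ?w = "tree_anc k (\<epsilon> v)"
    consider "d ?w r < d ?w s" | "d ?w s < d ?w r" | "d ?w r = d ?w s" by linarith
    then show ?thesis
    proof cases
      case 1
      then have "?w \<notin> S" using S by (auto simp: ties_def)
      then show ?thesis using 1 False fo[OF v] by (auto simp: turned_def paint_def forced_def)
    next
      case 2
      then have "?w \<notin> S" using S by (auto simp: ties_def)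
      then show ?thesis using 2 False fo[OF v] by (auto simp: turned_def paint_def forced_def)
    next
      case 3
      then have wt: "?w \<in> ties k" using lev[OF v False] by (simp add: ties_def)
      have "?w \<in> \<kappa> \<longleftrightarrow> \<gamma> v = Blue"
      proof
        assume "?w \<in> \<kappa>"
        then obtain v' where v': "v' \<in> B" "\<epsilon> v' \<notin> {r, s}" "tree_anc k (\<epsilon> v') = ?w" "\<gamma> v' = Blue"
          by (auto simp: \<kappa>_def)
        then have "\<epsilon> v = \<epsilon> v'" using nb v False unfolding clash_def by metis
        then show "\<gamma> v = Blue" using co[OF v v'(1)] v'(4) by simp
      next
        assume "\<gamma> v = Blue" then show "?w \<in> \<kappa>" using v False wt by (auto simp: \<kappa>_def)
      qed
      then show ?thesis using 3 False by (cases "\<gamma> v") (auto simp: turned_def paint_def opp_def)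
    qed
  qed
  have "bij_betw ?h {S \<in> Pow (ties k). \<forall>v\<in>B. turned k S (\<epsilon> v) (\<gamma> v) = c v} {S \<in> Pow (ties k). \<forall>v\<in>B. paint k S (\<epsilon> v) = c v}"
  proof (rule bij_betw_byWitness[where f'="?h"])
    show "\<forall>S\<in>{S \<in> Pow (ties k). \<forall>v\<in>B. turned k S (\<epsilon> v) (\<gamma> v) = c v}. ?h (?h S) = S" using hh by blast
    show "\<forall>S\<in>{S \<in> Pow (ties k). \<forall>v\<in>B. paint k S (\<epsilon> v) = c v}. ?h (?h S) = S" using hh by blast
    show "?h ` {S \<in> Pow (ties k). \<forall>v\<in>B. turned k S (\<epsilon> v) (\<gamma> v) = c v} \<subseteq> {S \<in> Pow (ties k). \<forall>v\<in>B. paint k S (\<epsilon> v) = c v}"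
    proof (rule image_subsetI)
      fix S assume S: "S \<in> {S \<in> Pow (ties k). \<forall>v\<in>B. turned k S (\<epsilon> v) (\<gamma> v) = c v}"
      then have "\<forall>v\<in>B. paint k (?h S) (\<epsilon> v) = c v" using eq[of S] by simp
      then show "?h S \<in> {S \<in> Pow (ties k). \<forall>v\<in>B. paint k S (\<epsilon> v) = c v}" using hP[of S] S by simp
    qed
    show "?h ` {S \<in> Pow (ties k). \<forall>v\<in>B. paint k S (\<epsilon> v) = c v} \<subseteq> {S \<in> Pow (ties k). \<forall>v\<in>B. turned k S (\<epsilon> v) (\<gamma> v) = c v}"
    proof (rule image_subsetI)
      fix S assume S: "S \<in> {S \<in> Pow (ties k). \<forall>v\<in>B. paint k S (\<epsilon> v) = c v}"
      then have P: "?h S \<in> Pow (ties k)" using hP[of S] by simp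
      have "\<forall>v\<in>B. turned k (?h S) (\<epsilon> v) (\<gamma> v) = c v" using eq[OF P] S hh[of S] by simp
      then show "?h S \<in> {S \<in> Pow (ties k). \<forall>v\<in>B. turned k S (\<epsilon> v) (\<gamma> v) = c v}" using P by simp
    qed
  qed
  then show ?thesis unfolding share_def using nb by (simp add: bij_betw_same_card)
qed

text \<open>Applying a uniformly chosen exchange \<open>\<Phi> S\<close> to a random coloring does not change
  its law. Afterwards, the colors of the entry points at equal distance from the seeds are
  independent fair coins, given the entry points.\<close>

lemma average:
  fixes M :: "'w measure"
  assumes M: "prob_space M" and B: "finite B"
    and e [measurable]: "\<And>v. v \<in> B \<Longrightarrow> (\<lambda>\<omega>. e v \<omega>) \<in> M \<rightarrow>\<^sub>M count_space UNIV"
    and col: "\<And>v. v \<in> B \<Longrightarrow> (\<lambda>\<omega>. col \<omega> v) \<in> M \<rightarrow>\<^sub>M count_space UNIV"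
    and \<Phi>: "\<And>S. S \<subseteq> ties k \<Longrightarrow> \<Phi> S \<in> M \<rightarrow>\<^sub>M M" "\<And>S. S \<subseteq> ties k \<Longrightarrow> distr M M (\<Phi> S) = M"
    and ae: "AE \<omega> in M. \<forall>v\<in>B. (e v \<omega> \<notin> {r, s} \<longrightarrow> d r (tree_anc k (e v \<omega>)) = k) \<and> forced k (e v \<omega>) (col \<omega> v) \<and>
       (\<forall>v'\<in>B. e v \<omega> = e v' \<omega> \<longrightarrow> col \<omega> v = col \<omega> v')"
    and ae2: "\<And>S. S \<subseteq> ties k \<Longrightarrow> AE \<omega> in M. \<forall>v\<in>B. e v (\<Phi> S \<omega>) = e v \<omega> \<and> col (\<Phi> S \<omega>) v = turned k S (e v \<omega>) (col \<omega> v)"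
  shows "2 ^ card (ties k) * emeasure M {\<omega> \<in> space M. \<not> clash k B (\<lambda>v. e v \<omega>) \<and> (\<forall>v\<in>B. col \<omega> v = c v)}
    = (\<integral>\<^sup>+\<omega>. of_nat (share k B c (\<lambda>v. e v \<omega>)) \<partial>M)"
proof -
  interpret prob_space M by (rule M)
  define A where "A = {\<omega> \<in> space M. \<not> clash k B (\<lambda>v. e v \<omega>) \<and> (\<forall>v\<in>B. col \<omega> v = c v)}"
  define G where "G = (\<lambda>S \<omega>. \<not> clash k B (\<lambda>v. e v \<omega>) \<and> (\<forall>v\<in>B. turned k S (e v \<omega>) (col \<omega> v) = c v))"
  have pair: "(\<lambda>\<omega>. (e v \<omega>, col \<omega> v)) \<in> M \<rightarrow>\<^sub>M count_space UNIV" if v: "v \<in> B" for v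
  proof (rule measurable_countI)
    have "countable (UNIV :: color set)"
      by (rule countable_subset[of _ "{Blue, Red}"]) (auto intro: color.exhaust)
    then show "countable (UNIV :: ('v \<times> color) set)"
      unfolding UNIV_Times_UNIV[symmetric] using countable_UNIV by (intro countable_SIGMA) auto
    fix a :: "'v \<times> color"
    have "{\<omega> \<in> space M. (e v \<omega>, col \<omega> v) = a} = {\<omega> \<in> space M. e v \<omega> = fst a} \<inter> {\<omega> \<in> space M. col \<omega> v = snd a}" by auto
    also have "\<dots> \<in> sets M"
      using pred_comp[OF e[OF v], of "\<lambda>x. x = fst a"] pred_comp[OF col[OF v], of "\<lambda>x. x = snd a"]
      by (simp add: pred_def)
    finally show "{\<omega> \<in> space M. (e v \<omega>, col \<omega> v) = a} \<in> sets M" .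
  qed simp
  note fam = family_measurable[where f="\<lambda>v \<omega>. (e v \<omega>, col \<omega> v)", OF B pair]
  have G_meas: "Measurable.pred M (G S)" for S
  proof -
    let ?Q = "\<lambda>x. \<not> clash k B (\<lambda>v. fst (x v)) \<and> (\<forall>v\<in>B. turned k S (fst (x v)) (snd (x v)) = c v)"
    have "G S = (\<lambda>\<omega>. ?Q (\<lambda>v\<in>B. (e v \<omega>, col \<omega> v)))"
    proof
      fix \<omega>
      show "G S \<omega> = ?Q (\<lambda>v\<in>B. (e v \<omega>, col \<omega> v))"
        unfolding G_def using clash_cong[of B "\<lambda>v. e v \<omega>" "\<lambda>v. fst ((\<lambda>v\<in>B. (e v \<omega>, col \<omega> v)) v)" k] by simp
    qed
    then show ?thesis using pred_comp[OF fam, where Q="?Q"] by (simp only:)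
  qed
  have A_meas: "A \<in> sets M"
  proof -
    let ?Q = "\<lambda>x. \<not> clash k B (\<lambda>v. fst (x v)) \<and> (\<forall>v\<in>B. snd (x v) = c v)"
    have "(\<lambda>\<omega>. \<not> clash k B (\<lambda>v. e v \<omega>) \<and> (\<forall>v\<in>B. col \<omega> v = c v)) = (\<lambda>\<omega>. ?Q (\<lambda>v\<in>B. (e v \<omega>, col \<omega> v)))"
    proof
      fix \<omega>
      show "(\<not> clash k B (\<lambda>v. e v \<omega>) \<and> (\<forall>v\<in>B. col \<omega> v = c v)) = ?Q (\<lambda>v\<in>B. (e v \<omega>, col \<omega> v))"
        using clash_cong[of B "\<lambda>v. e v \<omega>" "\<lambda>v. fst ((\<lambda>v\<in>B. (e v \<omega>, col \<omega> v)) v)" k] by simp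
    qed
    then have "Measurable.pred M (\<lambda>\<omega>. \<not> clash k B (\<lambda>v. e v \<omega>) \<and> (\<forall>v\<in>B. col \<omega> v = c v))"
      using pred_comp[OF fam, where Q="?Q"] by (simp only:)
    then show ?thesis by (simp add: A_def pred_def)
  qed
  have one: "emeasure M A = (\<integral>\<^sup>+\<omega>. (if G S \<omega> then 1 else 0) \<partial>M)" if S: "S \<subseteq> ties k" for S
  proof -
    have "emeasure M A = emeasure (distr M M (\<Phi> S)) A" using \<Phi>(2)[OF S] by simp
    also have "\<dots> = emeasure M (\<Phi> S -` A \<inter> space M)" by (rule emeasure_distr[OF \<Phi>(1)[OF S] A_meas])
    also have "\<dots> = emeasure M {\<omega> \<in> space M. G S \<omega>}"
    proof (rule emeasure_eq_AE)
      show "AE \<omega> in M. \<omega> \<in> \<Phi> S -` A \<inter> space M \<longleftrightarrow> \<omega> \<in> {\<omega> \<in> space M. G S \<omega>}"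
        using ae2[OF S] AE_space
      proof eventually_elim
        fix \<omega> assume a: "\<forall>v\<in>B. e v (\<Phi> S \<omega>) = e v \<omega> \<and> col (\<Phi> S \<omega>) v = turned k S (e v \<omega>) (col \<omega> v)" and "\<omega> \<in> space M"
        have "\<Phi> S \<omega> \<in> space M" using \<Phi>(1)[OF S] \<open>\<omega> \<in> space M\<close> by (rule measurable_space)
        moreover have "clash k B (\<lambda>v. e v (\<Phi> S \<omega>)) = clash k B (\<lambda>v. e v \<omega>)" by (rule clash_cong) (use a in simp)
        ultimately show "\<omega> \<in> \<Phi> S -` A \<inter> space M \<longleftrightarrow> \<omega> \<in> {\<omega> \<in> space M. G S \<omega>}"
          using a \<open>\<omega> \<in> space M\<close> by (simp add: A_def G_def)
      qed
      show "\<Phi> S -` A \<inter> space M \<in> sets M" using \<Phi>(1)[OF S] A_meas by (rule measurable_sets)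
      show "{\<omega> \<in> space M. G S \<omega>} \<in> sets M" using G_meas[of S] by (simp add: pred_def)
    qed
    also have "\<dots> = (\<integral>\<^sup>+\<omega>. indicator {\<omega> \<in> space M. G S \<omega>} \<omega> \<partial>M)"
      using G_meas[of S] by (intro nn_integral_indicator[symmetric]) (simp add: pred_def)
    also have "\<dots> = (\<integral>\<^sup>+\<omega>. (if G S \<omega> then 1 else 0) \<partial>M)"
      by (intro nn_integral_cong) (simp add: indicator_def)
    finally show ?thesis .
  qed
  have "2 ^ card (ties k) * emeasure M A = (\<Sum>S\<in>Pow (ties k). emeasure M A)"
    using finite_ties by (simp add: card_Pow)
  also have "\<dots> = (\<Sum>S\<in>Pow (ties k). \<integral>\<^sup>+\<omega>. (if G S \<omega> then 1 else 0) \<partial>M)"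
    by (intro sum.cong one) auto
  also have "\<dots> = (\<integral>\<^sup>+\<omega>. (\<Sum>S\<in>Pow (ties k). (if G S \<omega> then 1 else 0)) \<partial>M)"
    by (rule nn_integral_sum[symmetric]) (use G_meas in measurable)
  also have "\<dots> = (\<integral>\<^sup>+\<omega>. of_nat (share k B c (\<lambda>v. e v \<omega>)) \<partial>M)"
  proof (rule nn_integral_cong_AE)
    show "AE \<omega> in M. (\<Sum>S\<in>Pow (ties k). (if G S \<omega> then 1 else 0)) = (of_nat (share k B c (\<lambda>v. e v \<omega>)) :: ennreal)"
      using ae
    proof eventually_elim
      fix \<omega> assume a: "\<forall>v\<in>B. (e v \<omega> \<notin> {r, s} \<longrightarrow> d r (tree_anc k (e v \<omega>)) = k) \<and> forced k (e v \<omega>) (col \<omega> v) \<and>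
       (\<forall>v'\<in>B. e v \<omega> = e v' \<omega> \<longrightarrow> col \<omega> v = col \<omega> v')"
      have "(\<Sum>S\<in>Pow (ties k). (if G S \<omega> then 1 else 0)) = (of_nat (card {S \<in> Pow (ties k). G S \<omega>}) :: ennreal)"
        using finite_ties[of k] by (simp add: sum.If_cases Int_def)
      also have "card {S \<in> Pow (ties k). G S \<omega>} = share k B c (\<lambda>v. e v \<omega>)"
      proof (cases "clash k B (\<lambda>v. e v \<omega>)")
        case True then show ?thesis by (simp add: G_def share_def)
      next
        case False
        have "card {S \<in> Pow (ties k). \<forall>v\<in>B. turned k S (e v \<omega>) (col \<omega> v) = c v} = share k B c (\<lambda>v. e v \<omega>)"
        proof (rule card_share[OF False])
          show "d r (tree_anc k (e v \<omega>)) = k" if "v \<in> B" "e v \<omega> \<notin> {r, s}" for v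
            using bspec[OF a that(1)] that(2) by (simp del: insert_iff)
          show "forced k (e v \<omega>) (col \<omega> v)" if "v \<in> B" for v using bspec[OF a that] by simp
          show "col \<omega> v = col \<omega> v'" if "v \<in> B" "v' \<in> B" "e v \<omega> = e v' \<omega>" for v v'
            using bspec[OF a that(1)] that(2,3) by simp
        qed
        then show ?thesis using False by (simp add: G_def)
      qed
      finally show "(\<Sum>S\<in>Pow (ties k). (if G S \<omega> then 1 else 0)) = (of_nat (share k B c (\<lambda>v. e v \<omega>)) :: ennreal)" .
    qed
  qed
  finally show ?thesis unfolding A_def .
qed

section \<open>The law of the parent map for given times\<close>

abbreviation CS :: "'v set \<Rightarrow> ('v \<Rightarrow> 'v) measure" where "CS I \<equiv> PiM I (\<lambda>_. count_space UNIV)"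

abbreviation QG :: "'v set \<Rightarrow> ('v \<Rightarrow> real) \<Rightarrow> ('v \<Rightarrow> 'v) measure" where
  "QG G t \<equiv> parent_kernel E r s G t"

lemma QG_eq: "QG G t = PiM (G - {r, s}) (\<lambda>v. measure_pmf (pmf_of_set (candG G t v)))"
  by (simp add: parent_kernel_def candG_def)

lemma sets_pmf_PiM: "sets (PiM I (\<lambda>v. measure_pmf (p v))) = sets (CS I)"
  by (rule sets_PiM_cong) auto

lemma sets_QG [simp, measurable_cong]: "sets (QG G t) = sets (CS (G - {r, s}))"
  unfolding QG_eq by (rule sets_pmf_PiM)

lemma space_QG: "space (QG G t) = Pi\<^sub>E (G - {r, s}) (\<lambda>_. UNIV)"
  using sets_eq_imp_space_eq[OF sets_QG] by (simp add: space_PiM)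

lemma prob_QG: "prob_space (QG G t)"
  unfolding QG_eq by (intro prob_space_PiM measure_pmf.prob_space_axioms)

lemma app_measurable: "(\<lambda>g. g u) \<in> CS I \<rightarrow>\<^sub>M count_space UNIV"
proof (cases "u \<in> I")
  case True then show ?thesis by (rule measurable_component_singleton)
next
  case False
  have "(\<lambda>g. g u) \<in> CS I \<rightarrow>\<^sub>M count_space UNIV \<longleftrightarrow> (\<lambda>g. undefined :: 'v) \<in> CS I \<rightarrow>\<^sub>M count_space UNIV"
    by (rule measurable_cong) (use False in \<open>auto simp: space_PiM PiE_def extensional_def\<close>)
  then show ?thesis by simp
qed

lemma app_measurable2: "(\<lambda>g. g (f g)) \<in> CS I \<rightarrow>\<^sub>M count_space UNIV" if "f \<in> CS I \<rightarrow>\<^sub>M count_space UNIV"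
  by (rule measurable_compose_countable'[OF app_measurable that countable_UNIV])

lemma anc_path_measurable: "(\<lambda>g. anc_path g v n) \<in> CS I \<rightarrow>\<^sub>M count_space UNIV"
proof (induction n)
  case 0 then show ?case by simp
next
  case (Suc n)
  have "Measurable.pred (CS I) (\<lambda>g. anc_path g v n \<in> {r, s})" by (rule pred_comp[OF Suc])
  then show ?case unfolding anc_path_Suc using Suc app_measurable2[OF Suc] by (intro measurable_If) (auto simp: pred_def)
qed

lemma entry_measurable: "(\<lambda>g. entry k t g v) \<in> CS I \<rightarrow>\<^sub>M count_space UNIV"
  unfolding entry_def
proof (rule measurable_compose_countable'[where f="\<lambda>n g. anc_path g v n" and I=UNIV])
  show "(\<lambda>g. LEAST n. stopped k t (anc_path g v n)) \<in> CS I \<rightarrow>\<^sub>M count_space UNIV"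
    by (rule measurable_Least) (rule pred_comp[OF anc_path_measurable])
qed (auto intro: anc_path_measurable)

lemma hits_measurable: "Measurable.pred (CS I) (\<lambda>g. hits g v a)"
  unfolding hits_def by (intro pred_intros_countable pred_comp[OF anc_path_measurable])

lemma ball_color_measurable: "(\<lambda>g. ball_color g v) \<in> CS I \<rightarrow>\<^sub>M count_space UNIV"
  unfolding ball_color_def using hits_measurable[where I=I and v=v and a=r] by (intro measurable_If) (auto simp: pred_def)

lemma cand_nonempty:
  assumes "good t" "r \<in> G" "v \<notin> {r, s}" shows "candG G t v \<noteq> {}"
proof -
  have "r \<in> G \<and> tau t r < tau t v" using assms good_pos[OF assms(1), of v] by (simp add: tau_nonseed)
  then obtain z where "z \<in> G \<and> tau t z < tau t v" "\<And>u. u \<in> G \<and> tau t u < tau t v \<Longrightarrow> d v z \<le> d v u"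
    using ex_has_least_nat[of "\<lambda>z. z \<in> G \<and> tau t z < tau t v" r "d v"] by blast
  then have "z \<in> candG G t v" by (auto simp: candG_def parent_candidates_def)
  then show ?thesis by blast
qed

lemma set_pmf_kern:
  assumes "good t" "r \<in> G" "v \<notin> {r, s}"
  shows "set_pmf (pmf_of_set (candG G t v)) = candG G t v"
  by (rule set_pmf_of_set[OF cand_nonempty[OF assms] finite_cand])

lemma AE_selects: assumes "good t" "r \<in> G" shows "AE g in QG G t. selects G t g"
proof -
  have "AE g in QG G t. g v \<in> candG G t v" if v: "v \<in> G - {r, s}" for v
    unfolding QG_eq
  proof (rule AE_PiM_component[of "G - {r, s}" "\<lambda>v. measure_pmf (pmf_of_set (candG G t v))" v "\<lambda>x. x \<in> candG G t v"])
    show "AE x in measure_pmf (pmf_of_set (candG G t v)). x \<in> candG G t v"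
      using set_pmf_kern[OF assms] v by (simp add: AE_measure_pmf_iff)
  qed (use v measure_pmf.prob_space_axioms in auto)
  moreover have "countable (G - {r, s})" by (rule countable_subset[OF subset_UNIV countable_UNIV])
  ultimately have "AE g in QG G t. \<forall>v\<in>G - {r, s}. g v \<in> candG G t v"
    by (simp add: AE_ball_countable)
  then show ?thesis by (simp add: selects_def)
qed

lemma distr_coordinates:
  fixes p :: "'v \<Rightarrow> 'b pmf"
  assumes f: "\<And>i. i \<in> I \<Longrightarrow> map_pmf (f i) (p i) = p i"
  shows "distr (PiM I (\<lambda>i. measure_pmf (p i))) (PiM I (\<lambda>i. measure_pmf (p i))) (\<lambda>g. \<lambda>i\<in>I. f i (g i)) = PiM I (\<lambda>i. measure_pmf (p i))"
    (is "distr ?M ?M ?f = ?M")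
proof (rule measure_eqI_PiM_infinite[symmetric, where M="\<lambda>i. measure_pmf (p i)" and I=I])
  have [measurable]: "?f \<in> ?M \<rightarrow>\<^sub>M ?M"
    by (rule measurable_restrict) (auto intro!: measurable_compose[OF measurable_component_singleton])
  interpret prob_space ?M by (intro prob_space_PiM measure_pmf.prob_space_axioms)
  show "finite_measure ?M" by unfold_locales
  fix A J assume J: "finite J" "J \<subseteq> I" and A: "\<And>i. i \<in> J \<Longrightarrow> A i \<in> sets (measure_pmf (p i))"
  have C: "prod_emb I (\<lambda>i. measure_pmf (p i)) J (Pi\<^sub>E J A) \<in> sets ?M" by (rule sets_PiM_I) (use J A in auto)
  have e: "emeasure (measure_pmf (p i)) (f i -` A i) = emeasure (measure_pmf (p i)) (A i)" if "i \<in> J" for i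
  proof -
    have "emeasure (measure_pmf (p i)) (f i -` A i) = emeasure (measure_pmf (map_pmf (f i) (p i))) (A i)" by simp
    also have "map_pmf (f i) (p i) = p i" by (rule f) (use J that in auto)
    finally show ?thesis .
  qed
  have "emeasure (distr ?M ?M ?f) (prod_emb I (\<lambda>i. measure_pmf (p i)) J (Pi\<^sub>E J A)) =
    emeasure ?M (prod_emb I (\<lambda>i. measure_pmf (p i)) J (\<Pi>\<^sub>E i\<in>J. f i -` A i))"
  proof (subst emeasure_distr[OF _ C])
    have iff: "g \<in> prod_emb I (\<lambda>i. measure_pmf (p i)) J (Pi\<^sub>E J B) \<longleftrightarrow> g \<in> extensional I \<and> (\<forall>i\<in>J. g i \<in> B i)" for g B
      using J(2) by (auto simp: prod_emb_def PiE_iff)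
    have "(\<forall>i\<in>J. (\<lambda>i\<in>I. f i (g i)) i \<in> A i) \<longleftrightarrow> (\<forall>i\<in>J. f i (g i) \<in> A i)" for g
      using J(2) by (intro ball_cong) auto
    then have "?f -` prod_emb I (\<lambda>i. measure_pmf (p i)) J (Pi\<^sub>E J A) \<inter> space ?M =
      prod_emb I (\<lambda>i. measure_pmf (p i)) J (\<Pi>\<^sub>E i\<in>J. f i -` A i)"
      unfolding set_eq_iff Int_iff vimage_eq iff by (auto simp: space_PiM PiE_iff)
    then show "emeasure ?M (?f -` prod_emb I (\<lambda>i. measure_pmf (p i)) J (Pi\<^sub>E J A) \<inter> space ?M) =
      emeasure ?M (prod_emb I (\<lambda>i. measure_pmf (p i)) J (\<Pi>\<^sub>E i\<in>J. f i -` A i))" by simp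
  qed measurable
  also have "\<dots> = (\<Prod>i\<in>J. emeasure (measure_pmf (p i)) (f i -` A i))"
    by (rule emeasure_PiM_emb) (use J measure_pmf.prob_space_axioms in auto)
  also have "\<dots> = (\<Prod>i\<in>J. emeasure (measure_pmf (p i)) (A i))" by (rule prod.cong) (use e in auto)
  also have "\<dots> = emeasure ?M (prod_emb I (\<lambda>i. measure_pmf (p i)) J (Pi\<^sub>E J A))"
    by (rule emeasure_PiM_emb[symmetric]) (use J measure_pmf.prob_space_axioms in auto)
  finally show "emeasure ?M (prod_emb I (\<lambda>i. measure_pmf (p i)) J (Pi\<^sub>E J A)) = emeasure (distr ?M ?M ?f) (prod_emb I (\<lambda>i. measure_pmf (p i)) J (Pi\<^sub>E J A))" by simp
qed auto

text \<open>Below an equidistant vertex both seeds are equally far away, so either both of them or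
  none is a candidate, and exchanging them permutes the candidates, whose law is uniform.\<close>

lemma distr_exchange:
  assumes t: "good t" and k: "d r s < k" and G: "r \<in> G" "s \<in> G" and S: "S \<subseteq> ties k"
  shows "distr (QG G t) (QG G t) (exchange G k t S) = QG G t"
proof -
  let ?f = "\<lambda>y z. if low k t y \<and> tree_anc k y \<in> S then flip z else z"
  have m: "map_pmf (?f y) (pmf_of_set (candG G t y)) = pmf_of_set (candG G t y)" if y: "y \<in> G - {r, s}" for y
  proof (cases "low k t y \<and> tree_anc k y \<in> S")
    case True
    let ?C = "candG G t y"
    have w: "d r (tree_anc k y) = k" "bet r (tree_anc k y) y" "d (tree_anc k y) r = d (tree_anc k y) s"
      using low_tree_anc[of k t y] True S by (auto simp: ties_def)
    have eq: "d y r = d y s"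
      using seed_dist[OF w(2), of r] seed_dist[OF w(2), of s] k w by simp
    have pos: "0 < t y" by (rule good_pos[OF t])
    have rs: "r \<in> ?C \<longleftrightarrow> s \<in> ?C"
      using eq G by (auto simp: candG_def parent_candidates_def)
    have im: "flip ` ?C = ?C"
    proof (rule set_eqI)
      fix z
      have "z \<in> flip ` ?C \<longleftrightarrow> flip z \<in> ?C"
        by (auto intro: rev_image_eqI[of "flip z"])
      also have "\<dots> \<longleftrightarrow> z \<in> ?C" using rs by (auto simp: flip_def)
      finally show "z \<in> flip ` ?C \<longleftrightarrow> z \<in> ?C" .
    qed
    have inj: "inj flip" by (rule inj_on_inverseI[where g=flip]) simp
    have "map_pmf flip (pmf_of_set ?C) = pmf_of_set (flip ` ?C)"
      by (rule map_pmf_of_set_inj) (use inj cand_nonempty[OF t G(1)] y finite_cand in \<open>auto intro: inj_on_subset\<close>)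
    then show ?thesis using True im by simp
  next
    case False
    then have "?f y = (\<lambda>z. z)" by (intro ext) auto
    then show ?thesis by (simp add: pmf.map_ident)
  qed
  have "distr (QG G t) (QG G t) (\<lambda>g. \<lambda>y\<in>G - {r, s}. ?f y (g y)) = QG G t"
    unfolding QG_eq by (rule distr_coordinates) (rule m)
  moreover have "exchange G k t S = (\<lambda>g. \<lambda>y\<in>G - {r, s}. ?f y (g y))"
    by (auto simp: exchange_def fun_eq_iff)
  ultimately show ?thesis by simp
qed

lemma exchange_measurable: "exchange G k t S \<in> CS (G - {r, s}) \<rightarrow>\<^sub>M CS (G - {r, s})"
  unfolding exchange_def[abs_def]
proof (rule measurable_restrict)
  fix y
  have "(\<lambda>g. g y) \<in> CS (G - {r, s}) \<rightarrow>\<^sub>M count_space UNIV" by (rule app_measurable)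
  then show "(\<lambda>g. if low k t y \<and> tree_anc k y \<in> S then flip (g y) else g y) \<in> CS (G - {r, s}) \<rightarrow>\<^sub>M count_space UNIV"
    by (cases "low k t y \<and> tree_anc k y \<in> S") (auto intro: measurable_compose)
qed

section \<open>The law of the entry points\<close>

lemma entry_fun_measurable:
  fixes H :: "('v \<Rightarrow> 'v) \<Rightarrow> ennreal"
  assumes B: "finite B" and H: "\<And>\<epsilon> \<epsilon>'. (\<And>v. v \<in> B \<Longrightarrow> \<epsilon> v = \<epsilon>' v) \<Longrightarrow> H \<epsilon> = H \<epsilon>'"
  shows "(\<lambda>g. H (\<lambda>v. entry k t g v)) \<in> borel_measurable (CS I)"
proof -
  let ?f = "\<lambda>v g. (entry k t g v, Blue)"
  have f: "?f v \<in> CS I \<rightarrow>\<^sub>M count_space UNIV" for v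
    by (rule measurable_compose[OF entry_measurable]) simp
  have "(\<lambda>x. H (\<lambda>v. fst (x v))) \<in> count_space (Pi\<^sub>E B (\<lambda>_. UNIV :: ('v \<times> color) set)) \<rightarrow>\<^sub>M borel" by simp
  from measurable_compose[OF family_measurable[where f="?f", OF B f] this]
  have "(\<lambda>g. H (\<lambda>v. fst ((\<lambda>v\<in>B. ?f v g) v))) \<in> borel_measurable (CS I)" .
  moreover have "H (\<lambda>v. fst ((\<lambda>v\<in>B. ?f v g) v)) = H (\<lambda>v. entry k t g v)" for g by (rule H) simp
  ultimately show ?thesis by simp
qed

text \<open>The entry points only depend on the parents of finitely many vertices, whose
  candidates agree in a wide set and in the whole tree.\<close>

lemma same_entries:
  fixes H :: "('v \<Rightarrow> 'v) \<Rightarrow> ennreal"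
  assumes t: "good t" and B: "finite B" and wd: "\<And>v. v \<in> B \<Longrightarrow> wide G k t v" and r: "r \<in> G"
    and H: "\<And>\<epsilon> \<epsilon>'. (\<And>v. v \<in> B \<Longrightarrow> \<epsilon> v = \<epsilon>' v) \<Longrightarrow> H \<epsilon> = H \<epsilon>'"
  shows "(\<integral>\<^sup>+g. H (\<lambda>v. entry k t g v) \<partial>QG G t) = (\<integral>\<^sup>+g. H (\<lambda>v. entry k t g v) \<partial>QG UNIV t)"
proof -
  define W where "W = (\<Union>v\<in>B. inner k t v)"
  have W: "finite W"
    unfolding W_def by (intro finite_UN_I B finite_subset[OF _ finite_explored[OF t]]) (auto simp: inner_def)
  have main: "(\<integral>\<^sup>+g. H (\<lambda>v. entry k t g v) \<partial>QG G' t)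
    = (\<integral>\<^sup>+g. H (\<lambda>v. entry k t g v) \<partial>PiM W (\<lambda>v. measure_pmf (pmf_of_set (cand t v))))"
    if wd': "\<And>v. v \<in> B \<Longrightarrow> wide G' k t v" and r': "r \<in> G'" for G'
  proof -
    let ?M = "\<lambda>v. measure_pmf (pmf_of_set (candG G' t v))"
    have WG: "W \<subseteq> G' - {r, s}" using wd' inner_nonseed unfolding W_def wide_def by blast
    have kern: "PiM W ?M = PiM W (\<lambda>v. measure_pmf (pmf_of_set (cand t v)))"
    proof (rule PiM_cong[OF refl])
      fix v assume "v \<in> W"
      then have "candG G' t v = cand t v" using wd' unfolding W_def wide_def by blast
      then show "?M v = measure_pmf (pmf_of_set (cand t v))" by simp
    qed
    have dist: "distr (QG G' t) (PiM W ?M) (\<lambda>g. \<lambda>v\<in>W. g v) = PiM W ?M"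
      unfolding QG_eq using distr_PiM_reindex[of "G' - {r, s}" ?M "\<lambda>v. v" W] WG measure_pmf.prob_space_axioms by auto
    have rm: "(\<lambda>g. \<lambda>v\<in>W. g v) \<in> QG G' t \<rightarrow>\<^sub>M PiM W ?M"
    proof -
      have "(\<lambda>g. \<lambda>v\<in>W. g v) \<in> CS (G' - {r, s}) \<rightarrow>\<^sub>M CS W"
        by (rule measurable_restrict) (rule app_measurable)
      then show ?thesis by (simp only: measurable_cong_sets[OF sets_QG[of G' t] sets_pmf_PiM])
    qed
    have "(\<integral>\<^sup>+g. H (\<lambda>v. entry k t g v) \<partial>QG G' t) = (\<integral>\<^sup>+g. H (\<lambda>v. entry k t (\<lambda>v\<in>W. g v) v) \<partial>QG G' t)"
    proof (rule nn_integral_cong_AE)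
      show "AE g in QG G' t. H (\<lambda>v. entry k t g v) = H (\<lambda>v. entry k t (\<lambda>v\<in>W. g v) v)"
        using AE_selects[OF t r']
      proof eventually_elim
        fix g assume g: "selects G' t g"
        show "H (\<lambda>v. entry k t g v) = H (\<lambda>v. entry k t (\<lambda>v\<in>W. g v) v)"
        proof (rule H)
          fix v assume v: "v \<in> B"
          have "entry k t (\<lambda>v\<in>W. g v) v = entry k t g v"
            by (rule entry_wide(4)[OF t wd'[OF v] g]) (use v in \<open>auto simp: W_def\<close>)
          then show "entry k t g v = entry k t (\<lambda>v\<in>W. g v) v" by simp
        qed
      qed
    qed
    also have "\<dots> = (\<integral>\<^sup>+g. H (\<lambda>v. entry k t g v) \<partial>distr (QG G' t) (PiM W ?M) (\<lambda>g. \<lambda>v\<in>W. g v))"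
    proof (rule nn_integral_distr[symmetric, OF rm])
      show "(\<lambda>g. H (\<lambda>v. entry k t g v)) \<in> borel_measurable (distr (QG G' t) (PiM W ?M) (\<lambda>g. \<lambda>v\<in>W. g v))"
      proof -
        have "(\<lambda>g. H (\<lambda>v. entry k t g v)) \<in> borel_measurable (CS W)"
          by (rule entry_fun_measurable[OF B]) (fact H)
        then show ?thesis by (simp only: measurable_distr_eq1 measurable_cong_sets[OF sets_pmf_PiM refl])
      qed
    qed
    finally show ?thesis unfolding dist unfolding kern .
  qed
  show ?thesis using main[OF wd r] main[OF wide_UNIV UNIV_I] by simp
qed

section \<open>Coins\<close>

text \<open>For given times, \<open>M2 t\<close> is the joint law of the parent map and the coins. It varies
  with the times, but its sigma-algebra is always that of \<open>C2\<close>, where measurability is proved once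
  and for all.\<close>

abbreviation coin :: "bool pmf" where "coin \<equiv> bernoulli_pmf (1 / 2)"
abbreviation YY :: "('v \<Rightarrow> bool) measure" where "YY \<equiv> PiM UNIV (\<lambda>_. measure_pmf coin)"
abbreviation M2 :: "('v \<Rightarrow> real) \<Rightarrow> (('v \<Rightarrow> 'v) \<times> ('v \<Rightarrow> bool)) measure" where "M2 t \<equiv> QG UNIV t \<Otimes>\<^sub>M YY"
abbreviation CY :: "('v \<Rightarrow> bool) measure" where "CY \<equiv> PiM UNIV (\<lambda>_. count_space UNIV)"
abbreviation C2 :: "(('v \<Rightarrow> 'v) \<times> ('v \<Rightarrow> bool)) measure" where "C2 \<equiv> CS (UNIV - {r, s}) \<Otimes>\<^sub>M CY"

lemma sets_YY [simp, measurable_cong]: "sets YY = sets CY" by (rule sets_PiM_cong) auto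

lemma sets_M2: "sets (M2 t) = sets C2" by (rule sets_pair_measure_cong) simp_all

lemma prob_YY: "prob_space YY" by (intro prob_space_PiM measure_pmf.prob_space_axioms)

lemma prob_M2: "prob_space (M2 t)" by (rule prob_space_pair[OF prob_QG prob_YY])

lemma pred_ex_vertex:
  assumes "\<And>w :: 'v. Measurable.pred M (Q w)" shows "Measurable.pred M (\<lambda>x. \<exists>w. Q w x)"
proof -
  have "{x \<in> space M. \<exists>w. Q w x} = (\<Union>w\<in>UNIV. {x \<in> space M. Q w x})" by auto
  also have "\<dots> \<in> sets M" by (rule sets.countable_UN'[OF countable_UNIV]) (use assms in \<open>auto simp: pred_def\<close>)
  finally show ?thesis by (simp add: pred_def)
qed

lemma pred_all_vertex:
  assumes "\<And>w :: 'v. Measurable.pred M (Q w)" shows "Measurable.pred M (\<lambda>x. \<forall>w. Q w x)"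
proof -
  have "Measurable.pred M (\<lambda>x. \<not> (\<exists>w. \<not> Q w x))" by (intro pred_intros_logic pred_ex_vertex assms)
  then show ?thesis by simp
qed

lemma pred_eq2:
  assumes "f \<in> M \<rightarrow>\<^sub>M count_space (UNIV :: 'v set)" "g \<in> M \<rightarrow>\<^sub>M count_space UNIV"
  shows "Measurable.pred M (\<lambda>x. f x = g x)"
proof -
  have "Measurable.pred M (\<lambda>x. \<exists>a. f x = a \<and> g x = a)"
    by (intro pred_ex_vertex pred_intros_logic pred_comp[OF assms(1), where Q="\<lambda>x. x = _"] pred_comp[OF assms(2), where Q="\<lambda>x. x = _"])
  moreover have "(\<exists>a. f x = a \<and> g x = a) \<longleftrightarrow> f x = g x" for x by auto
  ultimately show ?thesis by simp
qed

lemma below_measurable: "Measurable.pred (CS I) (\<lambda>g. below g v w)"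
  unfolding below_def
  by (intro pred_intros_countable pred_intros_logic pred_comp[OF anc_path_measurable, where Q="\<lambda>x. bet r w x"]) simp_all

lemma rel_dir_measurable: "Measurable.pred (CS I) (\<lambda>g. rel_dir Q g v a b)"
  unfolding rel_dir_def has_dir_def
  by (intro pred_intros_logic pred_intros_countable pred_ex_vertex below_measurable) simp_all

lemma component_measurable: "Measurable.pred (CS I) (\<lambda>g. u \<in> component r s g v)"
  unfolding component_iff by (intro pred_intros_countable pred_eq2 anc_path_measurable)

lemma rep_measurable: "(\<lambda>g. rep (component r s g v)) \<in> CS I \<rightarrow>\<^sub>M count_space UNIV"
proof (rule measurable_countI[OF countable_UNIV])
  fix u
  have "Measurable.pred (CS I) (\<lambda>g. u \<in> component r s g v \<and>
     (\<forall>u'. to_nat_on (UNIV :: 'v set) u' < to_nat_on (UNIV :: 'v set) u \<longrightarrow> u' \<notin> component r s g v))"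
    by (intro pred_intros_logic pred_all_vertex component_measurable) simp_all
  then show "{g \<in> space (CS I). rep (component r s g v) = u} \<in> sets (CS I)"
    unfolding rep_eq_iff[OF component_self] by (simp add: pred_def)
qed simp

lemma fst_C2: "f \<in> CS (UNIV - {r, s}) \<rightarrow>\<^sub>M N \<Longrightarrow> (\<lambda>x. f (fst x)) \<in> C2 \<rightarrow>\<^sub>M N"
  by (rule measurable_compose[OF measurable_fst])

lemma coin_measurable: "f \<in> C2 \<rightarrow>\<^sub>M count_space UNIV \<Longrightarrow> Measurable.pred C2 (\<lambda>x. snd x (f x))"
proof (rule measurable_compose_countable'[where f="\<lambda>v x. snd x v" and I=UNIV])
  show "(\<lambda>x. snd x v) \<in> C2 \<rightarrow>\<^sub>M count_space UNIV" for v
    by (rule measurable_compose[OF measurable_snd]) (rule measurable_component_singleton, simp)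
qed (auto simp: countable_UNIV)

lemma limit_color_measurable: "(\<lambda>x. limit_color (fst x) (snd x) v) \<in> C2 \<rightarrow>\<^sub>M count_space UNIV"
  unfolding limit_color_eq
  using fst_C2[OF hits_measurable, of v r] fst_C2[OF hits_measurable, of v s]
    fst_C2[OF rel_dir_measurable, of "(<)" v r s] fst_C2[OF rel_dir_measurable, of "(<)" v s r]
    fst_C2[OF rel_dir_measurable, of "(=)" v r s] coin_measurable[OF fst_C2[OF rep_measurable, of v]]
  by (intro measurable_If) (simp_all add: pred_def)

lemma map_Not_coin: "map_pmf Not coin = coin"
proof (rule pmf_eqI)
  fix b
  have "pmf (map_pmf Not coin) (\<not> (\<not> b)) = pmf coin (\<not> b)" by (rule pmf_map_inj') (simp add: inj_def)
  then show "pmf (map_pmf Not coin) b = pmf coin b" by (cases b) simp_all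
qed

lemma distr_flip_coins: "distr YY YY (flip_coins S g) = YY"
proof -
  let ?f = "\<lambda>y b. if \<exists>w\<in>S. below g y w then \<not> b else b"
  have m: "map_pmf (?f y) coin = coin" for y
  proof (cases "\<exists>w\<in>S. below g y w")
    case True
    then have "?f y = Not" by (intro ext) auto
    then show ?thesis by (simp add: map_Not_coin)
  next
    case False
    then have "?f y = (\<lambda>b. b)" by (intro ext) auto
    then show ?thesis by (simp add: pmf.map_ident)
  qed
  have "distr YY YY (\<lambda>Y. \<lambda>y\<in>UNIV. ?f y (Y y)) = YY"
    by (rule distr_coordinates) (rule m)
  moreover have "flip_coins S g = (\<lambda>Y. \<lambda>y\<in>UNIV. ?f y (Y y))" by (auto simp: flip_coins_def fun_eq_iff)
  ultimately show ?thesis by simp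
qed

definition exchange2 :: "nat \<Rightarrow> ('v \<Rightarrow> real) \<Rightarrow> 'v set \<Rightarrow> ('v \<Rightarrow> 'v) \<times> ('v \<Rightarrow> bool) \<Rightarrow> ('v \<Rightarrow> 'v) \<times> ('v \<Rightarrow> bool)" where
  "exchange2 k t S x = (exchange UNIV k t S (fst x), flip_coins S (fst x) (snd x))"

lemma flip_coins_measurable2: "finite S \<Longrightarrow> (\<lambda>x. flip_coins S (fst x) (snd x)) \<in> C2 \<rightarrow>\<^sub>M CY"
  unfolding flip_coins_def
proof (rule measurable_PiM_single')
  fix y assume S: "finite S"
  have b: "Measurable.pred C2 (\<lambda>x. \<exists>w\<in>S. below (fst x) y w)"
    by (intro pred_intros_finite S fst_C2[OF below_measurable])
  have "Measurable.pred C2 (\<lambda>x. snd x y)" by (rule coin_measurable) simp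
  then show "(\<lambda>x. if \<exists>w\<in>S. below (fst x) y w then \<not> snd x y else snd x y) \<in> C2 \<rightarrow>\<^sub>M count_space UNIV"
    using b by (intro measurable_If pred_intros_logic) (simp_all add: pred_def)
qed (auto simp: space_pair_measure)

lemma exchange2_measurable: "finite S \<Longrightarrow> exchange2 k t S \<in> C2 \<rightarrow>\<^sub>M C2"
  unfolding exchange2_def[abs_def]
  by (intro measurable_Pair fst_C2[OF exchange_measurable] flip_coins_measurable2)

text \<open>For fixed parents the coins keep their law when some of them are turned, and then the
  exchange preserves the law of the parents.\<close>

lemma distr_exchange2:
  assumes t: "good t" and k: "d r s < k" and S: "S \<subseteq> ties k"
  shows "distr (M2 t) (M2 t) (exchange2 k t S) = M2 t"
proof (rule measure_eqI)
  interpret Y: prob_space YY by (rule prob_YY)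
  have fS: "finite S" using S finite_ties finite_subset by blast
  have tm: "exchange2 k t S \<in> M2 t \<rightarrow>\<^sub>M M2 t"
    using exchange2_measurable[OF fS] measurable_cong_sets[OF sets_M2 sets_M2] by blast
  fix A assume "A \<in> sets (distr (M2 t) (M2 t) (exchange2 k t S))"
  then have A: "A \<in> sets (M2 t)" by simp
  have ind: "indicator A \<in> borel_measurable (M2 t)" using A by simp
  have "emeasure (distr (M2 t) (M2 t) (exchange2 k t S)) A = (\<integral>\<^sup>+x. indicator A x \<partial>distr (M2 t) (M2 t) (exchange2 k t S))"
    using A by simp
  also have "\<dots> = (\<integral>\<^sup>+x. indicator A (exchange2 k t S x) \<partial>M2 t)"
    by (rule nn_integral_distr[OF tm]) (use ind in simp)
  also have "\<dots> = (\<integral>\<^sup>+g. \<integral>\<^sup>+Y. indicator A (exchange2 k t S (g, Y)) \<partial>YY \<partial>QG UNIV t)"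
    by (rule Y.nn_integral_fst[symmetric]) (rule measurable_compose[OF tm ind])
  also have "\<dots> = (\<integral>\<^sup>+g. \<integral>\<^sup>+Y. indicator A (exchange UNIV k t S g, Y) \<partial>YY \<partial>QG UNIV t)"
  proof (rule nn_integral_cong)
    fix g assume g: "g \<in> space (QG UNIV t)"
    have sg: "exchange UNIV k t S g \<in> space (QG UNIV t)" by (simp add: space_QG exchange_def)
    have fm: "flip_coins S g \<in> YY \<rightarrow>\<^sub>M YY"
    proof -
      have "(\<lambda>Y. flip_coins S (fst (g, Y)) (snd (g, Y))) \<in> CY \<rightarrow>\<^sub>M CY"
        by (rule measurable_compose[OF measurable_Pair1' flip_coins_measurable2[OF fS]])
          (use g in \<open>simp add: space_QG space_PiM\<close>)
      then show ?thesis using measurable_cong_sets[OF sets_YY sets_YY] by simp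
    qed
    have im: "(\<lambda>Y. indicator A (exchange UNIV k t S g, Y) :: ennreal) \<in> borel_measurable YY"
      by (rule measurable_compose[OF measurable_Pair1'[OF sg] ind])
    have "(\<integral>\<^sup>+Y. indicator A (exchange UNIV k t S g, Y) \<partial>YY) = (\<integral>\<^sup>+Y. indicator A (exchange UNIV k t S g, Y) \<partial>distr YY YY (flip_coins S g))"
      by (simp add: distr_flip_coins)
    also have "\<dots> = (\<integral>\<^sup>+Y. indicator A (exchange UNIV k t S g, flip_coins S g Y) \<partial>YY)"
      by (rule nn_integral_distr[OF fm]) (use im in simp)
    finally show "(\<integral>\<^sup>+Y. indicator A (exchange2 k t S (g, Y)) \<partial>YY) = (\<integral>\<^sup>+Y. indicator A (exchange UNIV k t S g, Y) \<partial>YY)"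
      by (simp add: exchange2_def)
  qed
  also have "\<dots> = (\<integral>\<^sup>+g. \<integral>\<^sup>+Y. indicator A (g, Y) \<partial>YY \<partial>distr (QG UNIV t) (QG UNIV t) (exchange UNIV k t S))"
  proof (rule nn_integral_distr[symmetric])
    show "exchange UNIV k t S \<in> QG UNIV t \<rightarrow>\<^sub>M QG UNIV t"
      using exchange_measurable[of UNIV k t S] measurable_cong_sets[OF sets_QG sets_QG] by blast
    have "(\<lambda>g. \<integral>\<^sup>+Y. indicator A (g, Y) \<partial>YY) \<in> borel_measurable (QG UNIV t)"
      by (rule Y.borel_measurable_nn_integral_fst[OF ind])
    then show "(\<lambda>g. \<integral>\<^sup>+Y. indicator A (g, Y) \<partial>YY) \<in> borel_measurable (distr (QG UNIV t) (QG UNIV t) (exchange UNIV k t S))" by simp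
  qed
  also have "\<dots> = (\<integral>\<^sup>+g. \<integral>\<^sup>+Y. indicator A (g, Y) \<partial>YY \<partial>QG UNIV t)"
    using distr_exchange[OF t k UNIV_I UNIV_I S] by simp
  also have "\<dots> = emeasure (M2 t) A"
    by (subst Y.nn_integral_fst[OF ind]) (use A in simp)
  finally show "emeasure (distr (M2 t) (M2 t) (exchange2 k t S)) A = emeasure (M2 t) A" .
qed simp

section \<open>Convergence for given times\<close>

text \<open>The conditional probability, given the times, that the coloring on \<open>G\<close> agrees with \<open>c\<close>
  on \<open>B\<close>; \<open>limit_prob\<close> is its counterpart on the whole tree.\<close>

definition ball_prob :: "'v set \<Rightarrow> 'v set \<Rightarrow> ('v \<Rightarrow> color) \<Rightarrow> ('v \<Rightarrow> real) \<Rightarrow> ennreal" where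
  "ball_prob B G c t = emeasure (QG G t) {g \<in> space (QG G t). \<forall>v\<in>B. ball_color g v = c v}"

definition limit_prob :: "'v set \<Rightarrow> ('v \<Rightarrow> color) \<Rightarrow> ('v \<Rightarrow> real) \<Rightarrow> ennreal" where
  "limit_prob B c t = emeasure (M2 t) {x \<in> space (M2 t). \<forall>v\<in>B. limit_color (fst x) (snd x) v = c v}"

lemma entry_level:
  assumes "good t" "wide G k t v" "selects G t g" "entry k t g v \<notin> {r, s}"
  shows "d r (tree_anc k (entry k t g v)) = k"
proof -
  have "low k t (entry k t g v)" using entry_wide(1)[OF assms(1-3)] assms(4) by (simp add: stopped_def)
  then show ?thesis using low_tree_anc by blast
qed

lemma fin_average:
  assumes t: "good t" and k: "d r s < k" and B: "finite B" and G: "finite G" "r \<in> G" "s \<in> G"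
    and wd: "\<And>v. v \<in> B \<Longrightarrow> wide G k t v"
  shows "2 ^ card (ties k) * emeasure (QG G t) {g \<in> space (QG G t). \<not> bad k t B g \<and> (\<forall>v\<in>B. ball_color g v = c v)}
    = (\<integral>\<^sup>+g. of_nat (share k B c (\<lambda>v. entry k t g v)) \<partial>QG G t)"
  unfolding bad_def
proof (rule average[where \<Phi>="exchange G k t" and e="\<lambda>v g. entry k t g v" and col=ball_color, OF prob_QG B])
  note cs = measurable_cong_sets[OF sets_QG refl]
  show "(\<lambda>g. entry k t g v) \<in> QG G t \<rightarrow>\<^sub>M count_space UNIV" for v using entry_measurable cs by blast
  show "(\<lambda>g. ball_color g v) \<in> QG G t \<rightarrow>\<^sub>M count_space UNIV" for v using ball_color_measurable cs by blast
  show "exchange G k t S \<in> QG G t \<rightarrow>\<^sub>M QG G t" for S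
    using exchange_measurable[of G k t S] measurable_cong_sets[OF sets_QG sets_QG] by blast
  show "distr (QG G t) (QG G t) (exchange G k t S) = QG G t" if "S \<subseteq> ties k" for S by (rule distr_exchange[OF t k G(2,3) that])
  show "AE g in QG G t. \<forall>v\<in>B. (entry k t g v \<notin> {r, s} \<longrightarrow> d r (tree_anc k (entry k t g v)) = k) \<and> forced k (entry k t g v) (ball_color g v) \<and>
       (\<forall>v'\<in>B. entry k t g v = entry k t g v' \<longrightarrow> ball_color g v = ball_color g v')"
    using AE_selects[OF t G(2)]
  proof eventually_elim
    fix g assume g: "selects G t g"
    show "\<forall>v\<in>B. (entry k t g v \<notin> {r, s} \<longrightarrow> d r (tree_anc k (entry k t g v)) = k) \<and> forced k (entry k t g v) (ball_color g v) \<and>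
       (\<forall>v'\<in>B. entry k t g v = entry k t g v' \<longrightarrow> ball_color g v = ball_color g v')"
    proof (intro ballI conjI impI)
      fix v assume v: "v \<in> B"
      note p = ball_color_props[OF t k G(1) wd[OF v] g]
      show "forced k (entry k t g v) (ball_color g v)" by (rule p(1))
      show "d r (tree_anc k (entry k t g v)) = k" if "entry k t g v \<notin> {r, s}" by (rule entry_level[OF t wd[OF v] g that])
      show "ball_color g v = ball_color g v'" if "v' \<in> B" "entry k t g v = entry k t g v'" for v' by (rule p(3)[OF wd[OF that(1)] that(2)])
    qed
  qed
  show "AE g in QG G t. \<forall>v\<in>B. entry k t (exchange G k t S g) v = entry k t g v \<and> ball_color (exchange G k t S g) v = turned k S (entry k t g v) (ball_color g v)" for S
    using AE_selects[OF t G(2)]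
  proof eventually_elim
    fix g assume g: "selects G t g"
    show "\<forall>v\<in>B. entry k t (exchange G k t S g) v = entry k t g v \<and> ball_color (exchange G k t S g) v = turned k S (entry k t g v) (ball_color g v)"
      using entry_exchange[OF t wd g] ball_color_props(2)[OF t k G(1) wd g] by simp
  qed
qed

lemma AE_selects_pair: assumes "good t" shows "AE x in M2 t. selects UNIV t (fst x)"
proof -
  interpret Y: prob_space YY by (rule prob_YY)
  interpret Q: prob_space "QG UNIV t" by (rule prob_QG)
  interpret PP: pair_prob_space "QG UNIV t" YY ..
  have "AE x in distr (M2 t) (QG UNIV t) fst. selects UNIV t x"
    unfolding Y.distr_pair_fst by (rule AE_selects[OF assms UNIV_I])
  then show ?thesis by (rule AE_distrD[OF measurable_fst])
qed

lemma inf_average: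
  assumes t: "good t" and k: "d r s < k" and B: "finite B"
  shows "2 ^ card (ties k) * emeasure (M2 t) {x \<in> space (M2 t). \<not> bad k t B (fst x) \<and> (\<forall>v\<in>B. limit_color (fst x) (snd x) v = c v)}
    = (\<integral>\<^sup>+x. of_nat (share k B c (\<lambda>v. entry k t (fst x) v)) \<partial>M2 t)"
  unfolding bad_def
proof (rule average[where \<Phi>="exchange2 k t" and e="\<lambda>v x. entry k t (fst x) v" and col="\<lambda>x. limit_color (fst x) (snd x)", OF prob_M2 B])
  note cs = measurable_cong_sets[OF sets_M2 refl]
  note wd = wide_UNIV[of k t]
  show "(\<lambda>x. entry k t (fst x) v) \<in> M2 t \<rightarrow>\<^sub>M count_space UNIV" for v using fst_C2[OF entry_measurable] cs by blast
  show "(\<lambda>x. limit_color (fst x) (snd x) v) \<in> M2 t \<rightarrow>\<^sub>M count_space UNIV" for v using limit_color_measurable cs by blast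
  show "exchange2 k t S \<in> M2 t \<rightarrow>\<^sub>M M2 t" if "S \<subseteq> ties k" for S
    using exchange2_measurable[OF finite_subset[OF that finite_ties]] measurable_cong_sets[OF sets_M2 sets_M2] by blast
  show "distr (M2 t) (M2 t) (exchange2 k t S) = M2 t" if "S \<subseteq> ties k" for S by (rule distr_exchange2[OF t k that])
  show "AE x in M2 t. \<forall>v\<in>B. (entry k t (fst x) v \<notin> {r, s} \<longrightarrow> d r (tree_anc k (entry k t (fst x) v)) = k) \<and>
       forced k (entry k t (fst x) v) (limit_color (fst x) (snd x) v) \<and>
       (\<forall>v'\<in>B. entry k t (fst x) v = entry k t (fst x) v' \<longrightarrow> limit_color (fst x) (snd x) v = limit_color (fst x) (snd x) v')"
    using AE_selects_pair[OF t]
  proof eventually_elim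
    fix x :: "('v \<Rightarrow> 'v) \<times> ('v \<Rightarrow> bool)" assume g: "selects UNIV t (fst x)"
    note p = limit_color_props[OF t k g subset_refl]
    show "\<forall>v\<in>B. (entry k t (fst x) v \<notin> {r, s} \<longrightarrow> d r (tree_anc k (entry k t (fst x) v)) = k) \<and>
       forced k (entry k t (fst x) v) (limit_color (fst x) (snd x) v) \<and>
       (\<forall>v'\<in>B. entry k t (fst x) v = entry k t (fst x) v' \<longrightarrow> limit_color (fst x) (snd x) v = limit_color (fst x) (snd x) v')"
    proof (intro ballI conjI impI)
      fix v assume v: "v \<in> B"
      show "forced k (entry k t (fst x) v) (limit_color (fst x) (snd x) v)" by (rule p(1))
      show "d r (tree_anc k (entry k t (fst x) v)) = k" if "entry k t (fst x) v \<notin> {r, s}" by (rule entry_level[OF t wd g that])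
      show "limit_color (fst x) (snd x) v = limit_color (fst x) (snd x) v'" if "entry k t (fst x) v = entry k t (fst x) v'" for v' by (rule p(3)[OF that])
    qed
  qed
  show "AE x in M2 t. \<forall>v\<in>B. entry k t (fst (exchange2 k t S x)) v = entry k t (fst x) v \<and>
      limit_color (fst (exchange2 k t S x)) (snd (exchange2 k t S x)) v = turned k S (entry k t (fst x) v) (limit_color (fst x) (snd x) v)"
    if S: "S \<subseteq> ties k" for S
    using AE_selects_pair[OF t]
  proof eventually_elim
    fix x :: "('v \<Rightarrow> 'v) \<times> ('v \<Rightarrow> bool)" assume g: "selects UNIV t (fst x)"
    show "\<forall>v\<in>B. entry k t (fst (exchange2 k t S x)) v = entry k t (fst x) v \<and>
      limit_color (fst (exchange2 k t S x)) (snd (exchange2 k t S x)) v = turned k S (entry k t (fst x) v) (limit_color (fst x) (snd x) v)"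
      using entry_exchange[OF t wd g] limit_color_props(2)[OF t k g S] by (simp add: exchange2_def)
  qed
qed

definition bad_prob :: "nat \<Rightarrow> 'v set \<Rightarrow> 'v set \<Rightarrow> ('v \<Rightarrow> real) \<Rightarrow> ennreal" where
  "bad_prob k B G t = emeasure (QG G t) {g \<in> space (QG G t). bad k t B g}"

lemma bad_measurable: "finite B \<Longrightarrow> Measurable.pred (CS I) (\<lambda>g. bad k t B g)"
  unfolding bad_def clash_def
  by (intro pred_intros_finite pred_intros_logic pred_eq2 entry_measurable
      measurable_compose[OF entry_measurable, where g="tree_anc k"] pred_comp[OF entry_measurable, where Q="\<lambda>x. x \<in> {r, s}"]) simp_all

lemma bad_prob_integral:
  assumes "finite B"
  shows "bad_prob k B G t = (\<integral>\<^sup>+g. (if clash k B (\<lambda>v. entry k t g v) then 1 else 0) \<partial>QG G t)"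
proof -
  have s: "{g \<in> space (QG G t). bad k t B g} \<in> sets (QG G t)"
    using bad_measurable[OF assms, where I="G - {r, s}" and k=k and t=t] sets_eq_imp_space_eq[OF sets_QG[of G t]] by (simp add: pred_def)
  have "bad_prob k B G t = (\<integral>\<^sup>+g. indicator {g \<in> space (QG G t). bad k t B g} g \<partial>QG G t)"
    unfolding bad_prob_def using s by simp
  also have "\<dots> = (\<integral>\<^sup>+g. (if clash k B (\<lambda>v. entry k t g v) then 1 else 0) \<partial>QG G t)"
    by (intro nn_integral_cong) (simp add: indicator_def bad_def)
  finally show ?thesis .
qed

lemma bad_prob_tendsto:
  assumes t: "good t" and B: "finite B"
  shows "(\<lambda>k. bad_prob k B UNIV t) \<longlonglongrightarrow> 0"
proof -
  interpret Q: prob_space "QG UNIV t" by (rule prob_QG)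
  let ?f = "\<lambda>k g. if bad k t B g then 1 else 0 :: ennreal"
  have m: "?f k \<in> borel_measurable (QG UNIV t)" for k
  proof -
    have "Measurable.pred (QG UNIV t) (\<lambda>g. bad k t B g)"
      using bad_measurable[OF B] measurable_cong_sets[OF sets_QG refl] by blast
    then show ?thesis by (intro measurable_If) (simp_all add: pred_def)
  qed
  have "(\<lambda>k. \<integral>\<^sup>+g. ?f k g \<partial>QG UNIV t) \<longlonglongrightarrow> (\<integral>\<^sup>+g. 0 \<partial>QG UNIV t)"
  proof (rule nn_integral_dominated_convergence[where w="\<lambda>_. 1"])
    show "AE g in QG UNIV t. (\<lambda>k. ?f k g) \<longlonglongrightarrow> 0"
      using AE_selects[OF t UNIV_I]
    proof eventually_elim
      fix g assume "selects UNIV t g"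
      then obtain k0 where "\<And>k. k0 \<le> k \<Longrightarrow> \<not> bad k t B g" using eventually_not_bad[OF t _ B] by blast
      then have "eventually (\<lambda>k. ?f k g = 0) sequentially"
        unfolding eventually_sequentially by (intro exI[of _ k0]) simp
      then show "(\<lambda>k. ?f k g) \<longlonglongrightarrow> 0" by (rule tendsto_eventually)
    qed
  qed (use m Q.emeasure_space_1 in auto)
  then show ?thesis by (simp add: bad_prob_integral[OF B] bad_def)
qed

text \<open>Without a clash the two probabilities coincide: both are averages of the same function
  \<open>share\<close> of the entry points, and the entry points have the same law.\<close>

lemma quenched_compare:
  assumes t: "good t" and k: "d r s < k" and B: "finite B" and G: "finite G" "r \<in> G" "s \<in> G"
    and wd: "\<And>v. v \<in> B \<Longrightarrow> wide G k t v"
  shows "ball_prob B G c t \<le> limit_prob B c t + bad_prob k B UNIV t" "limit_prob B c t \<le> ball_prob B G c t + bad_prob k B UNIV t"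
proof -
  interpret Y: prob_space YY by (rule prob_YY)
  interpret Q: prob_space "QG UNIV t" by (rule prob_QG)
  interpret PP: pair_prob_space "QG UNIV t" YY ..
  let ?G = "QG G t"
  let ?A = "{g \<in> space ?G. \<not> bad k t B g \<and> (\<forall>v\<in>B. ball_color g v = c v)}"
  let ?A2 = "{x \<in> space (M2 t). \<not> bad k t B (fst x) \<and> (\<forall>v\<in>B. limit_color (fst x) (snd x) v = c v)}"
  have "2 ^ card (ties k) * emeasure ?G ?A = (\<integral>\<^sup>+g. of_nat (share k B c (\<lambda>v. entry k t g v)) \<partial>?G)"
    by (rule fin_average[OF t k B G wd])
  also have "\<dots> = (\<integral>\<^sup>+g. of_nat (share k B c (\<lambda>v. entry k t g v)) \<partial>QG UNIV t)"
    by (rule same_entries[OF t B wd G(2)]) (use share_cong in metis)+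
  also have "\<dots> = (\<integral>\<^sup>+g. of_nat (share k B c (\<lambda>v. entry k t g v)) \<partial>distr (M2 t) (QG UNIV t) fst)"
    by (simp only: Y.distr_pair_fst)
  also have "\<dots> = (\<integral>\<^sup>+x. of_nat (share k B c (\<lambda>v. entry k t (fst x) v)) \<partial>M2 t)"
  proof (rule nn_integral_distr[OF measurable_fst])
    have "(\<lambda>g. of_nat (share k B c (\<lambda>v. entry k t g v)) :: ennreal) \<in> borel_measurable (CS (UNIV - {r, s}))"
      by (rule entry_fun_measurable[OF B]) (use share_cong in metis)
    then show "(\<lambda>g. of_nat (share k B c (\<lambda>v. entry k t g v)) :: ennreal) \<in> borel_measurable (distr (M2 t) (QG UNIV t) fst)"
      unfolding measurable_distr_eq1 using measurable_cong_sets[OF sets_QG refl] by blast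
  qed
  also have "\<dots> = 2 ^ card (ties k) * emeasure (M2 t) ?A2"
    by (rule inf_average[OF t k B, symmetric])
  finally have eq: "emeasure ?G ?A = emeasure (M2 t) ?A2"
    by (simp add: ennreal_mult_cancel_left power_eq_top_ennreal)
  have bG: "emeasure ?G {g \<in> space ?G. bad k t B g} = bad_prob k B UNIV t"
  proof -
    have "bad_prob k B G t = bad_prob k B UNIV t"
      unfolding bad_prob_integral[OF B] by (rule same_entries[OF t B wd G(2)]) (use clash_cong in metis)+
    then show ?thesis by (simp add: bad_prob_def)
  qed
  have b2: "emeasure (M2 t) {x \<in> space (M2 t). bad k t B (fst x)} = bad_prob k B UNIV t"
  proof -
    have s: "{g \<in> space (QG UNIV t). bad k t B g} \<in> sets (QG UNIV t)"
      using bad_measurable[OF B, where I="UNIV - {r, s}" and k=k and t=t] sets_eq_imp_space_eq[OF sets_QG[of UNIV t]] by (simp add: pred_def)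
    have "bad_prob k B UNIV t = emeasure (distr (M2 t) (QG UNIV t) fst) {g \<in> space (QG UNIV t). bad k t B g}"
      unfolding bad_prob_def by (simp only: Y.distr_pair_fst)
    also have "\<dots> = emeasure (M2 t) (fst -` {g \<in> space (QG UNIV t). bad k t B g} \<inter> space (M2 t))"
      by (rule emeasure_distr[OF measurable_fst s])
    also have "fst -` {g \<in> space (QG UNIV t). bad k t B g} \<inter> space (M2 t) = {x \<in> space (M2 t). bad k t B (fst x)}"
      by (auto simp: space_pair_measure)
    finally show ?thesis by simp
  qed
  have sG: "{g \<in> space ?G. bad k t B g} \<in> sets ?G" "{g \<in> space ?G. \<forall>v\<in>B. ball_color g v = c v} \<in> sets ?G" "?A \<in> sets ?G"
  proof -
    have b: "Measurable.pred ?G (\<lambda>g. bad k t B g)" using bad_measurable[OF B] measurable_cong_sets[OF sets_QG refl] by blast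
    have "Measurable.pred (CS (G - {r, s})) (\<lambda>g. \<forall>v\<in>B. ball_color g v = c v)"
      by (intro pred_intros_finite B pred_comp[OF ball_color_measurable, where Q="\<lambda>x. x = c _"])
    then have f: "Measurable.pred ?G (\<lambda>g. \<forall>v\<in>B. ball_color g v = c v)" using measurable_cong_sets[OF sets_QG refl] by blast
    show "{g \<in> space ?G. bad k t B g} \<in> sets ?G" "{g \<in> space ?G. \<forall>v\<in>B. ball_color g v = c v} \<in> sets ?G"
      using b f by (simp_all add: pred_def)
    have "Measurable.pred ?G (\<lambda>g. \<not> bad k t B g \<and> (\<forall>v\<in>B. ball_color g v = c v))" by (intro pred_intros_logic b f)
    then show "?A \<in> sets ?G" by (simp add: pred_def)
  qed
  have s2: "{x \<in> space (M2 t). bad k t B (fst x)} \<in> sets (M2 t)" "{x \<in> space (M2 t). \<forall>v\<in>B. limit_color (fst x) (snd x) v = c v} \<in> sets (M2 t)"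
    "?A2 \<in> sets (M2 t)"
  proof -
    have b: "Measurable.pred (M2 t) (\<lambda>x. bad k t B (fst x))" using fst_C2[OF bad_measurable[OF B]] measurable_cong_sets[OF sets_M2 refl] by blast
    have "Measurable.pred C2 (\<lambda>x. \<forall>v\<in>B. limit_color (fst x) (snd x) v = c v)"
      by (intro pred_intros_finite B pred_comp[OF limit_color_measurable, where Q="\<lambda>x. x = c _"])
    then have f: "Measurable.pred (M2 t) (\<lambda>x. \<forall>v\<in>B. limit_color (fst x) (snd x) v = c v)" using measurable_cong_sets[OF sets_M2 refl] by blast
    show "{x \<in> space (M2 t). bad k t B (fst x)} \<in> sets (M2 t)" "{x \<in> space (M2 t). \<forall>v\<in>B. limit_color (fst x) (snd x) v = c v} \<in> sets (M2 t)"
      using b f by (simp_all add: pred_def)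
    have "Measurable.pred (M2 t) (\<lambda>x. \<not> bad k t B (fst x) \<and> (\<forall>v\<in>B. limit_color (fst x) (snd x) v = c v))" by (intro pred_intros_logic b f)
    then show "?A2 \<in> sets (M2 t)" by (simp add: pred_def)
  qed
  have "ball_prob B G c t \<le> emeasure ?G (?A \<union> {g \<in> space ?G. bad k t B g})"
    unfolding ball_prob_def by (rule emeasure_mono) (use sG in auto)
  also have "\<dots> \<le> emeasure ?G ?A + bad_prob k B UNIV t" unfolding bG[symmetric] by (rule emeasure_subadditive[OF sG(3,1)])
  also have "emeasure ?G ?A \<le> limit_prob B c t" unfolding eq limit_prob_def by (rule emeasure_mono[OF _ s2(2)]) auto
  finally show "ball_prob B G c t \<le> limit_prob B c t + bad_prob k B UNIV t" by (simp add: add_right_mono)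
  have "limit_prob B c t \<le> emeasure (M2 t) (?A2 \<union> {x \<in> space (M2 t). bad k t B (fst x)})"
    unfolding limit_prob_def by (rule emeasure_mono) (use s2 in auto)
  also have "\<dots> \<le> emeasure (M2 t) ?A2 + bad_prob k B UNIV t" unfolding b2[symmetric] by (rule emeasure_subadditive[OF s2(3,1)])
  also have "emeasure (M2 t) ?A2 \<le> ball_prob B G c t" unfolding eq[symmetric] ball_prob_def by (rule emeasure_mono[OF _ sG(2)]) auto
  finally show "limit_prob B c t \<le> ball_prob B G c t + bad_prob k B UNIV t" by (simp add: add_right_mono)
qed

text \<open>Only finitely many vertices are explored, and their candidates lie in a large ball.\<close>

lemma eventually_wide:
  assumes t: "good t" and B: "finite B"
  shows "\<exists>l0. \<forall>l\<ge>l0. \<forall>v\<in>B. wide (gball E r l) k t v"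
proof -
  define W where "W = insert s (B \<union> (\<Union>v\<in>B. inner k t v))"
  have W: "finite W" unfolding W_def
    by (intro finite.insertI finite_UnI finite_UN_I B finite_subset[OF _ finite_explored[OF t]]) (auto simp: inner_def)
  define l0 where "l0 = (\<Sum>y\<in>W. 2 * d r y)"
  have le: "2 * d r y \<le> l0" if "y \<in> W" for y unfolding l0_def by (rule member_le_sum[OF that]) (use W in auto)
  have "wide (gball E r l) k t v" if l: "l0 \<le> l" and v: "v \<in> B" for l v
    unfolding wide_def
  proof (intro conjI ballI)
    have in_ball: "y \<in> gball E r l" if "y \<in> W" for y using le[OF that] l by (simp add: gball_def)
    show "v \<in> gball E r l" "s \<in> gball E r l" using in_ball v by (auto simp: W_def)
    show "r \<in> gball E r l" by (simp add: gball_def)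
    fix y assume y: "y \<in> inner k t v"
    then have yW: "y \<in> W" using v by (auto simp: W_def)
    show "y \<in> gball E r l" by (rule in_ball[OF yW])
    show "candG (gball E r l) t y = cand t y"
      by (rule candG_ball) (use le[OF yW] l inner_nonseed[OF y] good_pos[OF t] in auto)
  qed
  then show ?thesis by blast
qed

text \<open>The level \<open>k\<close> is chosen first, so that a clash is unlikely, and the ball afterwards,
  so that the exploration up to this level does not notice its boundary.\<close>

lemma quenched_limit:
  assumes t: "good t" and B: "finite B"
  shows "(\<lambda>l. ball_prob B (gball E r l) c t) \<longlonglongrightarrow> limit_prob B c t"
proof -
  have fin: "limit_prob B c t \<le> 1" unfolding limit_prob_def using prob_M2 by (rule prob_space.measure_le_1)
  have fin': "ball_prob B G c t \<le> 1" for G unfolding ball_prob_def using prob_QG by (rule prob_space.measure_le_1)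
  have near: "eventually (\<lambda>l. ball_prob B (gball E r l) c t \<le> limit_prob B c t + ennreal e \<and> limit_prob B c t \<le> ball_prob B (gball E r l) c t + ennreal e) sequentially"
    if e: "0 < e" for e
  proof -
    have "eventually (\<lambda>k. bad_prob k B UNIV t < ennreal e) sequentially"
      using bad_prob_tendsto[OF t B] e by (intro order_tendstoD(2)) auto
    then have "eventually (\<lambda>k. bad_prob k B UNIV t < ennreal e \<and> d r s < k) sequentially"
      by (intro eventually_conj eventually_gt_at_top)
    then obtain k where k: "bad_prob k B UNIV t < ennreal e" "d r s < k"
      unfolding eventually_sequentially by blast
    obtain l0 where l0: "\<And>l v. l0 \<le> l \<Longrightarrow> v \<in> B \<Longrightarrow> wide (gball E r l) k t v" using eventually_wide[OF t B] by blast
    have "ball_prob B (gball E r l) c t \<le> limit_prob B c t + ennreal e \<and> limit_prob B c t \<le> ball_prob B (gball E r l) c t + ennreal e"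
      if l: "max l0 (d r s) \<le> l" for l
    proof -
      have G: "finite (gball E r l)" "r \<in> gball E r l" "s \<in> gball E r l" using l by (simp_all, simp_all add: gball_def)
      have wd: "wide (gball E r l) k t v" if "v \<in> B" for v using l0 l that by simp
      note q = quenched_compare[OF t k(2) B G wd, where c=c]
      show ?thesis using q k(1) by (meson add_left_mono less_imp_le order_trans)
    qed
    then show ?thesis unfolding eventually_sequentially by blast
  qed
  have "(\<lambda>l. enn2real (ball_prob B (gball E r l) c t)) \<longlonglongrightarrow> enn2real (limit_prob B c t)"
  proof (rule LIMSEQ_I)
    fix e :: real assume e: "0 < e"
    have "0 < e / 2" using e by simp
    from near[OF this] obtain l0 where l0: "\<And>l. l0 \<le> l \<Longrightarrow> ball_prob B (gball E r l) c t \<le> limit_prob B c t + ennreal (e / 2)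
      \<and> limit_prob B c t \<le> ball_prob B (gball E r l) c t + ennreal (e / 2)"
      unfolding eventually_sequentially by blast
    have "norm (enn2real (ball_prob B (gball E r l) c t) - enn2real (limit_prob B c t)) < e" if l: "l0 \<le> l" for l
    proof -
      have r1: "ennreal (enn2real (ball_prob B (gball E r l) c t)) = ball_prob B (gball E r l) c t"
        using fin'[of "gball E r l"] by (intro ennreal_enn2real) (simp add: order_le_less_trans ennreal_one_less_top)
      have r2: "ennreal (enn2real (limit_prob B c t)) = limit_prob B c t"
        using fin by (intro ennreal_enn2real) (simp add: order_le_less_trans ennreal_one_less_top)
      have "ennreal (enn2real (ball_prob B (gball E r l) c t)) \<le> ennreal (enn2real (limit_prob B c t) + e / 2)"
        using l0[OF l] e r1 r2 by (simp add: ennreal_plus)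
      then have 1: "enn2real (ball_prob B (gball E r l) c t) \<le> enn2real (limit_prob B c t) + e / 2"
        using e by (subst (asm) ennreal_le_iff) (auto simp: add_nonneg_nonneg)
      have "ennreal (enn2real (limit_prob B c t)) \<le> ennreal (enn2real (ball_prob B (gball E r l) c t) + e / 2)"
        using l0[OF l] e r1 r2 by (simp add: ennreal_plus)
      then have 2: "enn2real (limit_prob B c t) \<le> enn2real (ball_prob B (gball E r l) c t) + e / 2"
        using e by (subst (asm) ennreal_le_iff) (auto simp: add_nonneg_nonneg)
      show ?thesis using 1 2 e unfolding real_norm_def by linarith
    qed
    then show "\<exists>l0. \<forall>l\<ge>l0. norm (enn2real (ball_prob B (gball E r l) c t) - enn2real (limit_prob B c t)) < e" by blast
  qed
  then have "(\<lambda>l. ennreal (enn2real (ball_prob B (gball E r l) c t))) \<longlonglongrightarrow> ennreal (enn2real (limit_prob B c t))"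
    by (rule tendsto_ennrealI)
  moreover have "ennreal (enn2real (ball_prob B G c t)) = ball_prob B G c t" for G
    using fin'[of G] by (intro ennreal_enn2real) (simp add: order_le_less_trans ennreal_one_less_top)
  moreover have "ennreal (enn2real (limit_prob B c t)) = limit_prob B c t"
    using fin by (intro ennreal_enn2real) (simp add: order_le_less_trans ennreal_one_less_top)
  ultimately show ?thesis by simp
qed

section \<open>The genealogy as a mixture over the arrival times\<close>

abbreviation TM :: "'v set \<Rightarrow> ('v \<Rightarrow> real) measure" where "TM G \<equiv> PiM (G - {r, s}) (\<lambda>_. \<mu>)"

lemma tau_measurable_TM: "u \<in> G \<Longrightarrow> (\<lambda>t. tau t u) \<in> borel_measurable (TM G)"
proof (cases "u \<in> {r, s}")
  case True then show ?thesis by (simp add: with_seeds_def)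
next
  case False
  assume "u \<in> G"
  then have "(\<lambda>t. t u) \<in> TM G \<rightarrow>\<^sub>M \<mu>" using False by (intro measurable_component_singleton) simp
  then have "(\<lambda>t. t u) \<in> borel_measurable (TM G)" by (simp only: measurable_cong_sets[OF refl sets_mu])
  then show ?thesis using False by (simp add: with_seeds_def)
qed

lemma candG_pred: assumes v: "v \<in> G" shows "Measurable.pred (TM G) (\<lambda>t. z \<in> candG G t v)"
proof (cases "z \<in> G")
  case True
  have lt: "Measurable.pred (TM G) (\<lambda>t. u \<in> G \<and> tau t u < tau t v)" for u
  proof (cases "u \<in> G")
    case True
    then show ?thesis using borel_measurable_pred_less[OF tau_measurable_TM tau_measurable_TM, of u G v] v by simp
  qed simp
  have "Measurable.pred (TM G) (\<lambda>t. (z \<in> G \<and> tau t z < tau t v) \<and> (\<forall>u. u \<in> G \<and> tau t u < tau t v \<longrightarrow> d v z \<le> d v u))"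
    by (intro pred_intros_logic pred_all_vertex lt) simp
  moreover have "z \<in> candG G t v \<longleftrightarrow> (z \<in> G \<and> tau t z < tau t v) \<and> (\<forall>u. u \<in> G \<and> tau t u < tau t v \<longrightarrow> d v z \<le> d v u)" for t
    by (auto simp: candG_def parent_candidates_def)
  ultimately show ?thesis by simp
next
  case False
  then have "z \<notin> candG G t v" for t by (auto simp: candG_def parent_candidates_def)
  then show ?thesis by simp
qed

lemma candG_measurable: assumes v: "v \<in> G" shows "(\<lambda>t. candG G t v) \<in> TM G \<rightarrow>\<^sub>M count_space {A. finite A}"
proof (rule measurable_countI)
  show "countable {A :: 'v set. finite A}"
    using countable_Collect_finite_subset[OF countable_UNIV] by simp
  fix a :: "'v set"
  have "Measurable.pred (TM G) (\<lambda>t. \<forall>z. z \<in> candG G t v \<longleftrightarrow> z \<in> a)"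
    by (intro pred_intros_logic pred_all_vertex candG_pred[OF v]) simp
  then show "{t \<in> space (TM G). candG G t v = a} \<in> sets (TM G)" by (simp add: pred_def set_eq_iff)
qed (simp add: finite_cand)

lemma QG_measurable: "(\<lambda>t. QG G t) \<in> TM G \<rightarrow>\<^sub>M prob_algebra (CS (G - {r, s}))"
proof (rule measurable_prob_algebra_generated[OF sets_PiM Int_stable_prod_algebra prod_algebra_sets_into_space prob_QG sets_QG])
  fix A assume "A \<in> prod_algebra (G - {r, s}) (\<lambda>_. count_space (UNIV :: 'v set))"
  then obtain J X where A: "A = prod_emb (G - {r, s}) (\<lambda>_. count_space UNIV) J (Pi\<^sub>E J X)" and J: "finite J" "J \<subseteq> G - {r, s}"
    by (rule prod_algebraE)
  have "emeasure (QG G t) A = (\<Prod>j\<in>J. emeasure (measure_pmf (pmf_of_set (candG G t j))) (X j))" for t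
  proof -
    have e: "A = prod_emb (G - {r, s}) (\<lambda>v. measure_pmf (pmf_of_set (candG G t v))) J (Pi\<^sub>E J X)"
      unfolding A by (simp add: prod_emb_def)
    show ?thesis unfolding e QG_eq
      by (rule emeasure_PiM_emb) (use J measure_pmf.prob_space_axioms in auto)
  qed
  moreover have "(\<lambda>t. \<Prod>j\<in>J. emeasure (measure_pmf (pmf_of_set (candG G t j))) (X j)) \<in> borel_measurable (TM G)"
  proof (rule borel_measurable_prod_ennreal)
    fix j assume "j \<in> J"
    then have "j \<in> G" using J by auto
    show "(\<lambda>t. emeasure (measure_pmf (pmf_of_set (candG G t j))) (X j)) \<in> borel_measurable (TM G)"
      by (rule measurable_compose[OF candG_measurable[OF \<open>j \<in> G\<close>]]) simp
  qed
  ultimately show "(\<lambda>t. emeasure (QG G t) A) \<in> borel_measurable (TM G)" by simp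
qed

text \<open>The parent map does not depend on times at the seeds or outside of \<open>G\<close>. This allows to
  use the same family of times for all balls and for the whole tree.\<close>

lemma QG_restrict: "QG G (\<lambda>v\<in>G - {r, s}. t v) = QG G t"
  unfolding QG_eq
proof (rule PiM_cong[OF refl])
  fix v assume v: "v \<in> G - {r, s}"
  have "tau (\<lambda>v\<in>G - {r, s}. t v) u = tau t u" if "u \<in> G" for u using that by (simp add: with_seeds_def)
  then have "candG G (\<lambda>v\<in>G - {r, s}. t v) v = candG G t v"
    using v unfolding candG_def parent_candidates_def by auto
  then show "measure_pmf (pmf_of_set (candG G (\<lambda>v\<in>G - {r, s}. t v) v)) = measure_pmf (pmf_of_set (candG G t v))" by simp
qed

lemma restrict_time: "(\<lambda>t. \<lambda>v\<in>G - {r, s}. t v) \<in> P \<rightarrow>\<^sub>M TM G"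
  by (rule measurable_restrict) (rule measurable_component_singleton, simp)

lemma distr_time: "distr P (TM G) (\<lambda>t. \<lambda>v\<in>G - {r, s}. t v) = TM G"
  using distr_PiM_reindex[of UNIV "\<lambda>_. \<mu>" "\<lambda>v. v" "G - {r, s}"] prob_mu by auto

lemma QG_measurable_P: "(\<lambda>t. QG G t) \<in> P \<rightarrow>\<^sub>M prob_algebra (CS (G - {r, s}))"
  using measurable_compose[OF restrict_time[of G] QG_measurable[of G]] by (simp only: QG_restrict)

lemma sets_gl: "sets (genealogy_law E \<mu> r s G) = sets (CS (G - {r, s}))"
  unfolding genealogy_law_def
  by (rule sets_bind) (use prob_space.not_empty[OF prob_space_PiM[of "G - {r, s}" "\<lambda>_. \<mu>"]] prob_mu in auto)

lemma nn_integral_gl: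
  assumes f: "f \<in> borel_measurable (CS (G - {r, s}))"
  shows "(\<integral>\<^sup>+g. f g \<partial>genealogy_law E \<mu> r s G) = (\<integral>\<^sup>+t. \<integral>\<^sup>+g. f g \<partial>QG G t \<partial>P)"
proof -
  have k: "(\<lambda>t. QG G t) \<in> TM G \<rightarrow>\<^sub>M subprob_algebra (CS (G - {r, s}))"
    using QG_measurable by (rule measurable_prob_algebraD)
  have h: "(\<lambda>t. \<integral>\<^sup>+g. f g \<partial>QG G t) \<in> borel_measurable (TM G)"
    using nn_integral_measurable_subprob_algebra[OF f] k by (rule measurable_compose[rotated])
  have "(\<integral>\<^sup>+g. f g \<partial>genealogy_law E \<mu> r s G) = (\<integral>\<^sup>+t. \<integral>\<^sup>+g. f g \<partial>QG G t \<partial>TM G)"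
    unfolding genealogy_law_def by (rule nn_integral_bind[OF f k])
  also have "\<dots> = (\<integral>\<^sup>+t. \<integral>\<^sup>+g. f g \<partial>QG G t \<partial>distr P (TM G) (\<lambda>t. \<lambda>v\<in>G - {r, s}. t v))"
    by (simp only: distr_time)
  also have "\<dots> = (\<integral>\<^sup>+t. \<integral>\<^sup>+g. f g \<partial>QG G (\<lambda>v\<in>G - {r, s}. t v) \<partial>P)"
    by (rule nn_integral_distr[OF restrict_time]) (use h in simp)
  finally show ?thesis by (simp only: QG_restrict)
qed

lemma emeasure_gl:
  assumes A: "A \<in> sets (CS (G - {r, s}))"
  shows "emeasure (genealogy_law E \<mu> r s G) A = (\<integral>\<^sup>+t. emeasure (QG G t) A \<partial>P)"
proof -
  have "emeasure (genealogy_law E \<mu> r s G) A = (\<integral>\<^sup>+g. indicator A g \<partial>genealogy_law E \<mu> r s G)"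
    using A sets_gl by simp
  also have "\<dots> = (\<integral>\<^sup>+t. \<integral>\<^sup>+g. indicator A g \<partial>QG G t \<partial>P)" by (rule nn_integral_gl) (use A in simp)
  also have "\<dots> = (\<integral>\<^sup>+t. emeasure (QG G t) A \<partial>P)" using A by simp
  finally show ?thesis .
qed

section \<open>The coloring on a ball\<close>

lemma CS_finite_sets:
  assumes "finite I" "X \<subseteq> Pi\<^sub>E I (\<lambda>_. UNIV)" shows "X \<in> sets (CS I)"
proof -
  have "countable (Pi\<^sub>E I (\<lambda>_. UNIV :: 'v set))" by (intro countable_PiE assms(1) countable_UNIV)
  then have "countable X" using assms(2) countable_subset by blast
  moreover have "{g} \<in> sets (CS I)" if "g \<in> X" for g
  proof -
    have "g \<in> extensional I" using assms(2) that by (auto simp: PiE_iff)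
    then have "{g} = Pi\<^sub>E I (\<lambda>i. {g i})" by (rule PiE_singleton[symmetric])
    also have "\<dots> \<in> sets (CS I)" by (rule sets_PiM_I_finite[OF assms(1)]) simp
    finally show ?thesis .
  qed
  ultimately show ?thesis by (rule sets.countable[rotated])
qed

lemma singleton_color:
  assumes "finite B" "c \<in> Pi\<^sub>E B (\<lambda>_. UNIV)"
  shows "{c} \<in> sets (PiM B (\<lambda>_. count_space (UNIV :: color set)))"
proof -
  have "c \<in> extensional B" using assms(2) by (auto simp: PiE_iff)
  then have "{c} = Pi\<^sub>E B (\<lambda>i. {c i})" by (rule PiE_singleton[symmetric])
  also have "\<dots> \<in> sets (PiM B (\<lambda>_. count_space (UNIV :: color set)))" by (rule sets_PiM_I_finite[OF assms(1)]) simp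
  finally show ?thesis .
qed

lemma ball_prob_measurable: assumes "finite B" shows "ball_prob B G c \<in> borel_measurable P"
proof -
  have "Measurable.pred (CS (G - {r, s})) (\<lambda>g. \<forall>v\<in>B. ball_color g v = c v)"
    by (intro pred_intros_finite assms pred_comp[OF ball_color_measurable, where Q="\<lambda>x. x = c _"])
  then have A: "{g \<in> space (CS (G - {r, s})). \<forall>v\<in>B. ball_color g v = c v} \<in> sets (CS (G - {r, s}))" by (simp add: pred_def)
  have "(\<lambda>t. emeasure (QG G t) {g \<in> space (CS (G - {r, s})). \<forall>v\<in>B. ball_color g v = c v}) \<in> borel_measurable P"
    by (rule measurable_emeasure_kernel[OF measurable_prob_algebraD[OF QG_measurable_P] A])
  moreover have "space (QG G t) = space (CS (G - {r, s}))" for t by (rule sets_eq_imp_space_eq[OF sets_QG])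
  ultimately show ?thesis unfolding ball_prob_def[abs_def] by simp
qed

text \<open>Almost surely every parent lies in the ball, and then the paths of the genealogical
  graph are the ancestral paths.\<close>

lemma emeasure_restricted_fin:
  assumes l: "N \<le> l" "d r s \<le> l" and c: "c \<in> Pi\<^sub>E (gball E r N) (\<lambda>_. UNIV)"
  shows "emeasure (restricted_law E r N (finite_coloring_law E \<mu> r s l)) {c}
    = (\<integral>\<^sup>+t. ball_prob (gball E r N) (gball E r l) c t \<partial>P)"
proof -
  define G where "G = gball E r l"
  define B where "B = gball E r N"
  have BG: "B \<subseteq> G" using l by (auto simp: B_def G_def gball_def)
  have G: "finite G" "finite B" "r \<in> G" "s \<in> G"
    using l by (simp_all add: G_def B_def) (simp_all add: gball_def)
  let ?L = "genealogy_law E \<mu> r s G"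
  let ?CG = "PiM G (\<lambda>_. count_space (UNIV :: color set))" and ?CB = "PiM B (\<lambda>_. count_space (UNIV :: color set))"
  have spL: "space ?L = Pi\<^sub>E (G - {r, s}) (\<lambda>_. UNIV)"
    using sets_eq_imp_space_eq[OF sets_gl[of G]] by (simp add: space_PiM)
  have fm: "finite_coloring r s G \<in> ?L \<rightarrow>\<^sub>M ?CG"
  proof (rule measurableI)
    show "finite_coloring r s G g \<in> space ?CG" for g by (simp add: finite_coloring_def space_PiM)
    show "finite_coloring r s G -` A \<inter> space ?L \<in> sets ?L" for A
      unfolding sets_gl by (rule CS_finite_sets) (use G spL in auto)
  qed
  have rm: "(\<lambda>f. restrict f B) \<in> ?CG \<rightarrow>\<^sub>M ?CB" by (rule measurable_restrict_subset[OF BG])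
  have cs: "{c} \<in> sets ?CB" by (rule singleton_color) (use G c in \<open>auto simp: B_def\<close>)
  let ?A = "{g \<in> space ?L. restrict (finite_coloring r s G g) B = c}"
  have "restricted_law E r N (finite_coloring_law E \<mu> r s l) = distr ?L ?CB (\<lambda>g. restrict (finite_coloring r s G g) B)"
    unfolding restricted_law_def finite_coloring_law_def G_def[symmetric] B_def[symmetric]
    using distr_distr[OF rm fm] by (simp add: comp_def)
  then have "emeasure (restricted_law E r N (finite_coloring_law E \<mu> r s l)) {c} = emeasure ?L ((\<lambda>g. restrict (finite_coloring r s G g) B) -` {c} \<inter> space ?L)"
    using emeasure_distr[OF measurable_compose[OF fm rm] cs] by simp
  also have "(\<lambda>g. restrict (finite_coloring r s G g) B) -` {c} \<inter> space ?L = ?A" by auto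
  also have "emeasure ?L ?A = (\<integral>\<^sup>+t. emeasure (QG G t) ?A \<partial>P)"
    by (rule emeasure_gl) (rule CS_finite_sets, use G spL in auto)
  also have "\<dots> = (\<integral>\<^sup>+t. ball_prob B G c t \<partial>P)"
  proof (rule nn_integral_cong_AE)
    show "AE t in P. emeasure (QG G t) ?A = ball_prob B G c t"
      using AE_good
    proof eventually_elim
      fix t assume t: "good t"
      have fS: "X \<in> sets (QG G t)" if "X \<subseteq> Pi\<^sub>E (G - {r, s}) (\<lambda>_. UNIV)" for X
        unfolding sets_QG by (rule CS_finite_sets[OF _ that]) (use G in simp)
      show "emeasure (QG G t) ?A = ball_prob B G c t"
        unfolding ball_prob_def
      proof (rule emeasure_eq_AE)
        show "AE g in QG G t. g \<in> ?A \<longleftrightarrow> g \<in> {g \<in> space (QG G t). \<forall>v\<in>B. ball_color g v = c v}"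
          using AE_selects[OF t G(3)]
        proof eventually_elim
          fix g assume g: "selects G t g"
          have gG: "g y \<in> G" if "y \<in> G - {r, s}" for y using g that candG_G unfolding selects_def by blast
          have col: "finite_coloring r s G g v = ball_color g v" if "v \<in> B" for v
          proof -
            have "v \<in> G" using that BG by blast
            then show ?thesis using graph_rtrancl[of G g v r, OF gG] by (simp add: finite_coloring_def ball_color_def)
          qed
          have "restrict (finite_coloring r s G g) B = c \<longleftrightarrow> (\<forall>v\<in>B. finite_coloring r s G g v = c v)"
            using c by (auto simp: B_def fun_eq_iff PiE_iff extensional_def)
          then show "g \<in> ?A \<longleftrightarrow> g \<in> {g \<in> space (QG G t). \<forall>v\<in>B. ball_color g v = c v}"
            using col by (simp add: spL space_QG)
        qed
        show "?A \<in> sets (QG G t)" by (rule fS) (auto simp: spL)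
        show "{g \<in> space (QG G t). \<forall>v\<in>B. ball_color g v = c v} \<in> sets (QG G t)" by (rule fS) (auto simp: space_QG)
      qed
    qed
  qed
  finally show ?thesis unfolding G_def B_def .
qed

section \<open>The law in infinite volume\<close>

abbreviation CC :: "('v \<Rightarrow> color) measure" where "CC \<equiv> PiM UNIV (\<lambda>_. count_space UNIV)"

lemma tied_rep: "C \<in> tied_components E r s g \<Longrightarrow> rep C \<in> C"
  unfolding tied_components_iff using rep(1)[OF component_self] by blast

lemma component_rep: assumes "C \<in> tied_components E r s g" shows "component r s g (rep C) = C"
proof -
  obtain v where v: "C = component r s g v" using assms unfolding tied_components_iff by blast
  show ?thesis using component_eq[of "rep C" g v] tied_rep[OF assms] by (simp only: v)
qed

lemma rep_inj: "inj_on rep (tied_components E r s g)"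
  by (rule inj_on_inverseI[of _ "component r s g"]) (rule component_rep)

text \<open>Different tied components have different representatives, and so the coins of the
  representatives are independent.\<close>

lemma limit_kernel:
  "distr (PiM (tied_components E r s g) (\<lambda>_. measure_pmf coin)) CC (limit_coloring E r s g) = distr YY CC (limit_color g)"
proof -
  let ?T = "tied_components E r s g"
  let ?h = "\<lambda>Y. \<lambda>C\<in>?T. Y (rep C)"
  have dist: "distr YY (PiM ?T (\<lambda>_. measure_pmf coin)) ?h = PiM ?T (\<lambda>_. measure_pmf coin)"
    using distr_PiM_reindex[of UNIV "\<lambda>_. measure_pmf coin" rep ?T] rep_inj measure_pmf.prob_space_axioms by auto
  have hm: "?h \<in> YY \<rightarrow>\<^sub>M PiM ?T (\<lambda>_. measure_pmf coin)"
    by (rule measurable_restrict) (rule measurable_component_singleton, simp)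
  have lm: "limit_coloring E r s g \<in> PiM ?T (\<lambda>_. measure_pmf coin) \<rightarrow>\<^sub>M CC"
  proof (rule measurable_PiM_single')
    fix v
    show "(\<lambda>X. limit_coloring E r s g X v) \<in> PiM ?T (\<lambda>_. measure_pmf coin) \<rightarrow>\<^sub>M count_space UNIV"
    proof (cases "free g v \<and> tied g v")
      case True
      then have "component r s g v \<in> ?T" unfolding tied_components_iff by blast
      then have "(\<lambda>X. X (component r s g v)) \<in> PiM ?T (\<lambda>_. measure_pmf coin) \<rightarrow>\<^sub>M measure_pmf coin"
        by (rule measurable_component_singleton)
      then have p: "(\<lambda>X. X (component r s g v)) \<in> PiM ?T (\<lambda>_. measure_pmf coin) \<rightarrow>\<^sub>M count_space UNIV"
        by (simp cong: measurable_cong_sets)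
      have "limit_coloring E r s g X v = (\<lambda>b. limit_coloring E r s g (\<lambda>_. b) v) (X (component r s g v))" for X
        by (simp add: limit_coloring_eq)
      then show ?thesis using measurable_compose[OF p, of "\<lambda>b. limit_coloring E r s g (\<lambda>_. b) v" "count_space UNIV"] by simp
    next
      case False
      then have "limit_coloring E r s g X v = limit_coloring E r s g (\<lambda>_. True) v" for X
        by (auto simp: limit_coloring_eq free_def)
      then have "(\<lambda>X. limit_coloring E r s g X v) = (\<lambda>X. limit_coloring E r s g (\<lambda>_. True) v)" by (rule ext)
      then show ?thesis by simp
    qed
  qed (simp add: space_PiM)
  have "limit_coloring E r s g (?h Y) v = limit_color g Y v" for Y v
  proof (cases "free g v \<and> tied g v")
    case True
    then have "component r s g v \<in> ?T" unfolding tied_components_iff by blast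
    then show ?thesis by (simp add: limit_color_def limit_coloring_eq)
  next
    case False
    then show ?thesis by (auto simp: limit_color_def limit_coloring_eq free_def)
  qed
  then have eq: "limit_coloring E r s g \<circ> ?h = limit_color g" by (simp add: fun_eq_iff)
  have "distr (distr YY (PiM ?T (\<lambda>_. measure_pmf coin)) ?h) CC (limit_coloring E r s g) = distr YY CC (limit_coloring E r s g \<circ> ?h)"
    by (rule distr_distr[OF lm hm])
  then show ?thesis unfolding dist eq .
qed

lemma chi_eq: "chi E \<mu> r s = bind (genealogy_law E \<mu> r s UNIV) (\<lambda>g. distr YY CC (limit_color g))"
  unfolding chi_def limit_kernel ..

lemma limit_color_fun_measurable: "(\<lambda>x. limit_color (fst x) (snd x)) \<in> C2 \<rightarrow>\<^sub>M CC"
  by (rule measurable_PiM_single') (auto intro: limit_color_measurable simp: space_PiM)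

lemma limit_color_section: "g \<in> space (CS (UNIV - {r, s})) \<Longrightarrow> limit_color g \<in> YY \<rightarrow>\<^sub>M CC"
proof -
  assume g: "g \<in> space (CS (UNIV - {r, s}))"
  have "(\<lambda>Y. limit_color (fst (g, Y)) (snd (g, Y))) \<in> CY \<rightarrow>\<^sub>M CC"
    by (rule measurable_compose[OF measurable_Pair1'[OF g] limit_color_fun_measurable])
  then show ?thesis using measurable_cong_sets[OF sets_YY refl] by simp
qed

lemma limit_color_kernel: "(\<lambda>g. distr YY CC (limit_color g)) \<in> CS (UNIV - {r, s}) \<rightarrow>\<^sub>M subprob_algebra CC"
proof (rule measurable_distr2)
  have "(\<lambda>x. limit_color (fst x) (snd x)) \<in> CS (UNIV - {r, s}) \<Otimes>\<^sub>M YY \<rightarrow>\<^sub>M CC"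
    using limit_color_fun_measurable measurable_cong_sets[OF sets_pair_measure_cong[OF refl sets_YY] refl] by blast
  then show "(\<lambda>(g, Y). limit_color g Y) \<in> CS (UNIV - {r, s}) \<Otimes>\<^sub>M YY \<rightarrow>\<^sub>M CC" by (simp add: split_beta')
  show "(\<lambda>g. YY) \<in> CS (UNIV - {r, s}) \<rightarrow>\<^sub>M subprob_algebra YY"
    by (rule measurable_const) (simp add: space_subprob_algebra prob_space_imp_subprob_space[OF prob_YY])
qed

lemma limit_prob_measurable: assumes "finite B" shows "limit_prob B c \<in> borel_measurable P"
proof -
  have "Measurable.pred C2 (\<lambda>x. \<forall>v\<in>B. limit_color (fst x) (snd x) v = c v)"
    by (intro pred_intros_finite assms pred_comp[OF limit_color_measurable, where Q="\<lambda>x. x = c _"])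
  then have A: "{x \<in> space C2. \<forall>v\<in>B. limit_color (fst x) (snd x) v = c v} \<in> sets (CS (UNIV - {r, s}) \<Otimes>\<^sub>M YY)"
    unfolding sets_pair_measure_cong[OF refl sets_YY] by (simp add: pred_def)
  have "(\<lambda>t. YY) \<in> P \<rightarrow>\<^sub>M prob_algebra YY"
    by (rule measurable_const) (simp add: space_prob_algebra prob_YY)
  from measurable_pair_prob[OF QG_measurable_P[of UNIV] this]
  have "(\<lambda>t. M2 t) \<in> P \<rightarrow>\<^sub>M prob_algebra (CS (UNIV - {r, s}) \<Otimes>\<^sub>M YY)" .
  then have "(\<lambda>t. emeasure (M2 t) {x \<in> space C2. \<forall>v\<in>B. limit_color (fst x) (snd x) v = c v}) \<in> borel_measurable P"
    by (rule measurable_emeasure_kernel[OF measurable_prob_algebraD A])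
  moreover have "space (M2 t) = space C2" for t by (rule sets_eq_imp_space_eq[OF sets_M2])
  ultimately show ?thesis unfolding limit_prob_def[abs_def] by simp
qed

lemma emeasure_restricted_inf:
  assumes c: "c \<in> Pi\<^sub>E (gball E r N) (\<lambda>_. UNIV)"
  shows "emeasure (restricted_law E r N (chi E \<mu> r s)) {c} = (\<integral>\<^sup>+t. limit_prob (gball E r N) c t \<partial>P)"
proof -
  interpret Y: prob_space YY by (rule prob_YY)
  define B where "B = gball E r N"
  have B: "finite B" by (simp add: B_def)
  let ?L = "genealogy_law E \<mu> r s UNIV"
  let ?k = "\<lambda>g. distr YY CC (limit_color g)"
  let ?CB = "PiM B (\<lambda>_. count_space (UNIV :: color set))"
  let ?A = "{f \<in> space CC. \<forall>v\<in>B. f v = c v}"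
  have neL: "space ?L \<noteq> {}" using sets_eq_imp_space_eq[OF sets_gl[of UNIV]] by (simp add: space_PiM PiE_eq_empty_iff)
  have km: "?k \<in> ?L \<rightarrow>\<^sub>M subprob_algebra CC" using limit_color_kernel measurable_cong_sets[OF sets_gl refl] by blast
  have sc: "sets (chi E \<mu> r s) = sets CC" unfolding chi_eq by (rule sets_bind) (use neL in auto)
  have A: "?A \<in> sets CC"
  proof -
    have "(\<lambda>f. f v) \<in> CC \<rightarrow>\<^sub>M count_space UNIV" for v by (rule measurable_component_singleton) simp
    then have "Measurable.pred CC (\<lambda>f. \<forall>v\<in>B. f v = c v)"
      by (intro pred_intros_finite B pred_comp[where Q="\<lambda>x. x = c _"])
    then show ?thesis by (simp add: pred_def)
  qed
  have rm: "(\<lambda>f. restrict f B) \<in> chi E \<mu> r s \<rightarrow>\<^sub>M ?CB"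
    using measurable_restrict_subset[of B UNIV "\<lambda>_. count_space (UNIV :: color set)"] measurable_cong_sets[OF sc refl] by blast
  have cs: "{c} \<in> sets ?CB" by (rule singleton_color) (use B c in \<open>auto simp: B_def\<close>)
  have "emeasure (restricted_law E r N (chi E \<mu> r s)) {c} = emeasure (chi E \<mu> r s) ((\<lambda>f. restrict f B) -` {c} \<inter> space (chi E \<mu> r s))"
    unfolding restricted_law_def B_def[symmetric] by (rule emeasure_distr[OF rm cs])
  also have "(\<lambda>f. restrict f B) -` {c} \<inter> space (chi E \<mu> r s) = ?A"
    using c sets_eq_imp_space_eq[OF sc] by (auto simp: B_def fun_eq_iff PiE_iff extensional_def)
  also have "emeasure (chi E \<mu> r s) ?A = (\<integral>\<^sup>+g. emeasure (?k g) ?A \<partial>?L)"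
    unfolding chi_eq by (rule emeasure_bind[OF neL km A])
  also have "\<dots> = (\<integral>\<^sup>+t. \<integral>\<^sup>+g. emeasure (?k g) ?A \<partial>QG UNIV t \<partial>P)"
    by (rule nn_integral_gl) (rule measurable_emeasure_kernel[OF limit_color_kernel A])
  also have "\<dots> = (\<integral>\<^sup>+t. limit_prob B c t \<partial>P)"
  proof (rule nn_integral_cong)
    fix t
    let ?X = "{x \<in> space (M2 t). \<forall>v\<in>B. limit_color (fst x) (snd x) v = c v}"
    have "Measurable.pred C2 (\<lambda>x. \<forall>v\<in>B. limit_color (fst x) (snd x) v = c v)"
      by (intro pred_intros_finite B pred_comp[OF limit_color_measurable, where Q="\<lambda>x. x = c _"])
    then have X: "?X \<in> sets (M2 t)" using sets_eq_imp_space_eq[OF sets_M2[of t]] by (simp add: pred_def sets_M2)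
    have "limit_prob B c t = (\<integral>\<^sup>+g. emeasure YY (Pair g -` ?X) \<partial>QG UNIV t)"
      unfolding limit_prob_def by (rule Y.emeasure_pair_measure_alt[OF X])
    also have "\<dots> = (\<integral>\<^sup>+g. emeasure (?k g) ?A \<partial>QG UNIV t)"
    proof (rule nn_integral_cong)
      fix g assume g: "g \<in> space (QG UNIV t)"
      have "g \<in> space (CS (UNIV - {r, s}))" using g sets_eq_imp_space_eq[OF sets_QG[of UNIV t]] by simp
      then have "emeasure (?k g) ?A = emeasure YY (limit_color g -` ?A \<inter> space YY)"
        by (rule emeasure_distr[OF limit_color_section A])
      also have "limit_color g -` ?A \<inter> space YY = Pair g -` ?X" using g by (auto simp: space_pair_measure space_PiM)
      finally show "emeasure YY (Pair g -` ?X) = emeasure (?k g) ?A" by simp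
    qed
    finally show "(\<integral>\<^sup>+g. emeasure (?k g) ?A \<partial>QG UNIV t) = limit_prob B c t" by simp
  qed
  finally show ?thesis unfolding B_def .
qed

section \<open>Convergence\<close>

text \<open>There are only finitely many colorings of \<open>B\<close>.\<close>

lemma integral_colorings:
  fixes f :: "('v \<Rightarrow> color) \<Rightarrow> real"
  assumes B: "finite B" and sets: "sets M = sets (PiM B (\<lambda>_. count_space (UNIV :: color set)))"
    and fin: "\<And>c. c \<in> Pi\<^sub>E B (\<lambda>_. UNIV) \<Longrightarrow> emeasure M {c} \<le> 1"
  shows "(\<integral>c. f c \<partial>M) = (\<Sum>c\<in>Pi\<^sub>E B (\<lambda>_. UNIV). f c * measure M {c})"
proof -
  let ?C = "Pi\<^sub>E B (\<lambda>_. UNIV :: color set)"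
  have "finite (UNIV :: color set)" by (rule finite_subset[of _ "{Blue, Red}"]) (auto intro: color.exhaust)
  then have C: "finite ?C" by (intro finite_PiE B) auto
  have sp: "space M = ?C" using sets_eq_imp_space_eq[OF sets] by (simp add: space_PiM)
  have s: "{c} \<in> sets M" if "c \<in> ?C" for c unfolding sets by (rule singleton_color[OF B that])
  have lt: "emeasure M {c} < \<infinity>" if "c \<in> ?C" for c
    by (rule order_le_less_trans[OF fin[OF that]]) (simp add: ennreal_one_less_top)
  have "(\<integral>c. f c \<partial>M) = (\<integral>x. (\<Sum>c\<in>?C. f c * indicator {c} x) \<partial>M)"
  proof (rule Bochner_Integration.integral_cong[OF refl])
    fix x assume "x \<in> space M"
    then have "x \<in> ?C" using sp by simp
    then have "(\<Sum>c\<in>?C. f c * indicator {c} x) = (\<Sum>c\<in>{x}. f c * indicator {c} x)"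
      by (intro sum.mono_neutral_right C) (auto simp: indicator_def)
    then show "f x = (\<Sum>c\<in>?C. f c * indicator {c} x)" by simp
  qed
  also have "\<dots> = (\<Sum>c\<in>?C. \<integral>x. f c * indicator {c} x \<partial>M)"
    by (rule Bochner_Integration.integral_sum) (use s lt in \<open>auto intro!: integrable_mult_right integrable_real_indicator\<close>)
  also have "\<dots> = (\<Sum>c\<in>?C. f c * measure M {c})"
  proof (rule sum.cong[OF refl])
    fix c assume "c \<in> ?C"
    then have "{c} \<inter> space M = {c}" using sp by auto
    then show "(\<integral>x. f c * indicator {c} x \<partial>M) = f c * measure M {c}" by simp
  qed
  finally show ?thesis .
qed

lemma converges: "locally_converges E r (\<lambda>l. finite_coloring_law E \<mu> r s l) (chi E \<mu> r s)"
  unfolding locally_converges_def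
proof (intro allI)
  fix N and f :: "('v \<Rightarrow> color) \<Rightarrow> real"
  interpret P: prob_space P by (rule prob_P)
  define B where "B = gball E r N"
  let ?C = "Pi\<^sub>E B (\<lambda>_. UNIV :: color set)"
  let ?L = "\<lambda>l. restricted_law E r N (finite_coloring_law E \<mu> r s l)"
  let ?X = "restricted_law E r N (chi E \<mu> r s)"
  have B: "finite B" by (simp add: B_def)
  have mf1: "ball_prob B G c t \<le> 1" for G c t unfolding ball_prob_def using prob_QG by (rule prob_space.measure_le_1)
  have mi1: "limit_prob B c t \<le> 1" for c t unfolding limit_prob_def using prob_M2 by (rule prob_space.measure_le_1)
  have int1: "(\<integral>\<^sup>+t. h t \<partial>P) \<le> 1" if "\<And>t. h t \<le> 1" for h
  proof -
    have "(\<integral>\<^sup>+t. h t \<partial>P) \<le> (\<integral>\<^sup>+t. 1 \<partial>P)" by (intro nn_integral_mono that)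
    then show ?thesis using P.emeasure_space_1 by simp
  qed
  have conv: "(\<lambda>l. \<integral>\<^sup>+t. ball_prob B (gball E r l) c t \<partial>P) \<longlonglongrightarrow> (\<integral>\<^sup>+t. limit_prob B c t \<partial>P)" for c
  proof (rule nn_integral_dominated_convergence[where w="\<lambda>_. 1"])
    show "AE t in P. (\<lambda>l. ball_prob B (gball E r l) c t) \<longlonglongrightarrow> limit_prob B c t"
      using AE_good by eventually_elim (rule quenched_limit[OF _ B])
  qed (use ball_prob_measurable[OF B] limit_prob_measurable[OF B] mf1 int1 in \<open>auto simp: order_le_less_trans ennreal_one_less_top\<close>)
  have emL: "emeasure (?L l) {c} = (\<integral>\<^sup>+t. ball_prob B (gball E r l) c t \<partial>P)" if "max N (d r s) \<le> l" "c \<in> ?C" for l c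
    unfolding B_def by (rule emeasure_restricted_fin) (use that in \<open>auto simp: B_def\<close>)
  have emX: "emeasure ?X {c} = (\<integral>\<^sup>+t. limit_prob B c t \<partial>P)" if "c \<in> ?C" for c
    unfolding B_def by (rule emeasure_restricted_inf) (use that in \<open>simp add: B_def\<close>)
  have intL: "(\<integral>c. f c \<partial>?L l) = (\<Sum>c\<in>?C. f c * enn2real (\<integral>\<^sup>+t. ball_prob B (gball E r l) c t \<partial>P))" if l: "max N (d r s) \<le> l" for l
  proof -
    have "(\<integral>c. f c \<partial>?L l) = (\<Sum>c\<in>?C. f c * measure (?L l) {c})"
    proof (rule integral_colorings[OF B])
      show "sets (?L l) = sets (PiM B (\<lambda>_. count_space UNIV))" by (simp add: restricted_law_def B_def)
      show "emeasure (?L l) {c} \<le> 1" if "c \<in> ?C" for c unfolding emL[OF l that] by (rule int1) (rule mf1)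
    qed
    also have "\<dots> = (\<Sum>c\<in>?C. f c * enn2real (\<integral>\<^sup>+t. ball_prob B (gball E r l) c t \<partial>P))"
      by (rule sum.cong[OF refl]) (simp only: measure_def emL[OF l])
    finally show ?thesis .
  qed
  have intX: "(\<integral>c. f c \<partial>?X) = (\<Sum>c\<in>?C. f c * enn2real (\<integral>\<^sup>+t. limit_prob B c t \<partial>P))"
  proof -
    have "(\<integral>c. f c \<partial>?X) = (\<Sum>c\<in>?C. f c * measure ?X {c})"
    proof (rule integral_colorings[OF B])
      show "sets ?X = sets (PiM B (\<lambda>_. count_space UNIV))" by (simp add: restricted_law_def B_def)
      show "emeasure ?X {c} \<le> 1" if "c \<in> ?C" for c unfolding emX[OF that] by (rule int1) (rule mi1)
    qed
    also have "\<dots> = (\<Sum>c\<in>?C. f c * enn2real (\<integral>\<^sup>+t. limit_prob B c t \<partial>P))"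
      by (rule sum.cong[OF refl]) (simp only: measure_def emX)
    finally show ?thesis .
  qed
  have "(\<lambda>l. \<Sum>c\<in>?C. f c * enn2real (\<integral>\<^sup>+t. ball_prob B (gball E r l) c t \<partial>P)) \<longlonglongrightarrow> (\<Sum>c\<in>?C. f c * enn2real (\<integral>\<^sup>+t. limit_prob B c t \<partial>P))"
  proof (intro tendsto_sum tendsto_mult_left)
    fix c
    have "(\<integral>\<^sup>+t. limit_prob B c t \<partial>P) < \<top>" by (rule order_le_less_trans[OF int1[OF mi1]]) (simp add: ennreal_one_less_top)
    then show "(\<lambda>l. enn2real (\<integral>\<^sup>+t. ball_prob B (gball E r l) c t \<partial>P)) \<longlonglongrightarrow> enn2real (\<integral>\<^sup>+t. limit_prob B c t \<partial>P)"
      by (intro tendsto_enn2real) (simp_all add: conv)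
  qed
  moreover have "eventually (\<lambda>l. (\<Sum>c\<in>?C. f c * enn2real (\<integral>\<^sup>+t. ball_prob B (gball E r l) c t \<partial>P)) = (\<integral>c. f c \<partial>?L l)) sequentially"
    unfolding eventually_sequentially using intL by (intro exI[of _ "max N (d r s)"]) simp
  ultimately show "(\<lambda>l. \<integral>c. f c \<partial>?L l) \<longlonglongrightarrow> (\<integral>c. f c \<partial>?X)"
    unfolding intX by (rule Lim_transform_eventually)
qed

end

theorem theorem6:
  fixes K :: nat and E :: "'v \<Rightarrow> 'v \<Rightarrow> bool" and r s :: 'v and \<mu> :: "real measure"
  assumes "K \<ge> 2"
    and "regular_tree K E"
    and "s \<noteq> r"
    and "prob_space \<mu>" and "sets \<mu> = sets borel"
    and "emeasure \<mu> {0<..} = 1"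
    and "\<And>x. emeasure \<mu> {x} = 0"
  shows "locally_converges E r (\<lambda>l. finite_coloring_law E \<mu> r s l) (chi E \<mu> r s)"
proof -
  have "arrival K E r s \<mu>"
    using assms by (intro arrival.intro tree.intro arrival_axioms.intro)
  then show ?thesis by (rule arrival.converges)
qed

end
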